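(* There is a constant $C>0$ (possibly depending on $T$), not depending on $N$ or $g$, such that for every $N\ge3$ and every $g\in\mathcal H^*$ the U-statistic $$U_N(g)=\frac1{N^2}\sum_{1\le i\ne j\le N}g^\dagger(\overline W^i,\overline W^j),\qquad g^\dagger(\overline W^i,\overline W^j)=\int_0^T\langle\xi_{i,j}^g(t),\,d\overline W_t^i\rangle,$$ satisfies $$\overline{\mathbb P}^N(|U_N(g)|>u)\le\exp\Big\{-\Big(\frac{uN}{CB\log\log N}\Big)^{2/3}\Big\}\qquad\text{for all }u\ge\frac{CB(\log N)^2}{N},$$ and $$\|U_N(g)\|_{\psi_{2/3}}\le\frac{3CB\log\log N}{N}.$$
   Context: Fix $d\ge1$, $T>0$; $\mathbb T^d=\mathbb R^d/\mathbb Z^d$, $\mathcal P(\mathbb T^d)$ its Borel probability measures. $\tilde{\mathcal H}$ is a class of functions $F:\mathbb T^d\to\mathbb R^d$ with $\|F\|_\infty\le B$ and Lipschitz constant $\|F\|_{\mathrm{Lip}}\le L$ for all $F\in\tilde{\mathcal H}$. $\mathcal H$ is the set of $b:\mathcal P(\mathbb T^d)\times\mathbb T^d\to\mathbb R^d$ of the form $b(\nu,x)=G(x)+\int_{\mathbb T^d}F(x-y)d\nu(y)$ with $F,G\in\tilde{\mathcal H}$; $b^*\in\mathcal H$; $\mathcal H^*=\{b-b^*:b\in\mathcal H\}$. For $g\in\mathcal H^*$ write $\tilde g(x,y)=g(\delta_y,x)$, so $g(\nu,x)=\int\tilde g(x,y)d\nu(y)$. $\mu_t$ is the law at time $t$ of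 the solution of the McKean–Vlasov SDE $dX_t=b^*(\mu_t,X_t)dt+dW_t$, $\mu_t=\mathrm{Law}(X_t)$, with initial law $\mu_0$ (values in $\mathbb T^d$). Under $\overline{\mathbb P}^N$, $\overline W^1,\dots,\overline W^N$ are independent $d$-dimensional Brownian motions and $X^1,\dots,X^N$ are i.i.d. solutions on $[0,T]$ of $dX_t^i=b^*(\mu_t,X_t^i)dt+d\overline W_t^i$ with $X_0^i\sim\mu_0$ i.i.d. and independent of the $\overline W^i$. $\xi_{i,j}^g(t)=\tilde g(X_t^i,X_t^j)-\int_{\mathbb T^d}\tilde g(X_t^i,y)\,d\mu_t(y)$. For $\beta>0$ the Orlicz (quasi-)norm under $\overline{\mathbb P}^N$ is $\|\xi\|_{\psi_\beta}=\inf\{c>0:\mathbb E[e^{(|\xi|/c)^\beta}-1]\le1\}$. *)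

theory Defs
  imports "HOL-Probability.Probability"
begin

section \<open>The flat torus\<close>

definition int_lattice :: "(real ^ 'd::finite) set" where
  "int_lattice = {k. \<forall>i. k $ i \<in> \<int>}"

lemma int_lattice_0: "0 \<in> int_lattice"
  by (simp add: int_lattice_def)

lemma int_lattice_add: "a \<in> int_lattice \<Longrightarrow> b \<in> int_lattice \<Longrightarrow> a + b \<in> int_lattice"
  by (simp add: int_lattice_def)

lemma int_lattice_uminus: "a \<in> int_lattice \<Longrightarrow> - a \<in> int_lattice"
  by (simp add: int_lattice_def)

lemma int_lattice_diff: "a \<in> int_lattice \<Longrightarrow> b \<in> int_lattice \<Longrightarrow> a - b \<in> int_lattice"
  by (simp add: int_lattice_def)

lemma closed_int_lattice: "closed (int_lattice :: (real ^ 'd::finite) set)"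
proof -
  have eq: "(int_lattice :: (real ^ 'd) set) = (\<Inter>i. (\<lambda>k. k $ i) -` \<int>)"
    by (auto simp: int_lattice_def)
  have "closed ((\<lambda>k :: real ^ 'd. k $ i) -` \<int>)" for i
    by (rule closed_vimage[OF closed_Ints]) (intro continuous_intros)
  then show ?thesis
    unfolding eq by blast
qed

lemma infdist_lattice_shift_le:
  fixes x k :: "real ^ 'd::finite"
  assumes "k \<in> int_lattice"
  shows "infdist (x + k) int_lattice \<le> infdist x int_lattice"
proof -
  have ne: "(int_lattice :: (real ^ 'd) set) \<noteq> {}" using int_lattice_0 by blast
  have "infdist (x + k) int_lattice \<le> dist x a" if "a \<in> int_lattice" for a
    using infdist_le[OF int_lattice_add[OF that assms], of "x + k"] by (simp add: dist_norm)
  then show ?thesis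
    unfolding infdist_notempty[OF ne, of x] using ne by (intro cINF_greatest) auto
qed

lemma infdist_lattice_shift:
  fixes x y :: "real ^ 'd::finite"
  assumes "x - y \<in> int_lattice"
  shows "infdist x int_lattice = infdist y int_lattice"
  using infdist_lattice_shift_le[OF assms, of y]
    infdist_lattice_shift_le[OF int_lattice_uminus[OF assms], of x] by simp

lemma infdist_lattice_uminus_le:
  fixes x :: "real ^ 'd::finite"
  shows "infdist (- x) int_lattice \<le> infdist x int_lattice"
proof -
  have ne: "(int_lattice :: (real ^ 'd) set) \<noteq> {}" using int_lattice_0 by blast
  have "infdist (- x) int_lattice \<le> dist x a" if "a \<in> int_lattice" for a
    using infdist_le[OF int_lattice_uminus[OF that], of "- x"] by (simp add: dist_minus)
  then show ?thesis
    unfolding infdist_notempty[OF ne, of x] using ne by (intro cINF_greatest) auto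
qed

lemma infdist_lattice_add_le:
  fixes x y :: "real ^ 'd::finite"
  shows "infdist (x + y) int_lattice \<le> infdist x int_lattice + infdist y int_lattice"
proof -
  have ne: "(int_lattice :: (real ^ 'd) set) \<noteq> {}" using int_lattice_0 by blast
  have "infdist (x + y) int_lattice - infdist x int_lattice \<le> dist y a"
    if a: "a \<in> int_lattice" for a
  proof -
    have "infdist (x + y) int_lattice \<le> infdist (x + a) int_lattice + dist (x + y) (x + a)"
      by (rule infdist_triangle)
    also have "infdist (x + a) int_lattice = infdist x int_lattice"
      by (rule infdist_lattice_shift) (simp add: a)
    finally show ?thesis by (simp add: dist_norm)
  qed
  then have "infdist (x + y) int_lattice - infdist x int_lattice \<le> infdist y int_lattice"
    unfolding infdist_notempty[OF ne, of y] using ne by (intro cINF_greatest) auto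
  then show ?thesis by simp
qed

quotient_type (overloaded) 'd torus = "real ^ 'd::finite" / "\<lambda>x y. x - y \<in> int_lattice"
  morphisms rep_torus to_torus
proof (rule equivpI)
  show "reflp (\<lambda>x y :: real ^ 'd. x - y \<in> int_lattice)"
    by (rule reflpI) (simp add: int_lattice_0)
  show "symp (\<lambda>x y :: real ^ 'd. x - y \<in> int_lattice)"
    by (rule sympI) (use int_lattice_uminus in fastforce)
  show "transp (\<lambda>x y :: real ^ 'd. x - y \<in> int_lattice)"
    by (rule transpI) (use int_lattice_add in fastforce)
qed

instantiation torus :: (finite) ab_group_add
begin

lift_definition zero_torus :: "'a torus" is 0 .

lift_definition plus_torus :: "'a torus \<Rightarrow> 'a torus \<Rightarrow> 'a torus" is "(+)"
proof -
  fix x x' y y' :: "real ^ 'a"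
  assume "x - x' \<in> int_lattice" "y - y' \<in> int_lattice"
  then show "(x + y) - (x' + y') \<in> int_lattice"
    unfolding add_diff_add by (rule int_lattice_add)
qed

lift_definition minus_torus :: "'a torus \<Rightarrow> 'a torus \<Rightarrow> 'a torus" is "(-)"
proof -
  fix x x' y y' :: "real ^ 'a"
  assume "x - x' \<in> int_lattice" "y - y' \<in> int_lattice"
  then have "(x - x') - (y - y') \<in> int_lattice" by (rule int_lattice_diff)
  moreover have "(x - y) - (x' - y') = (x - x') - (y - y')" by simp
  ultimately show "(x - y) - (x' - y') \<in> int_lattice" by (simp only:)
qed

lift_definition uminus_torus :: "'a torus \<Rightarrow> 'a torus" is uminus
proof -
  fix x x' :: "real ^ 'a"
  assume "x - x' \<in> int_lattice"
  then show "- x - - x' \<in> int_lattice"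
    unfolding minus_diff_minus by (rule int_lattice_uminus)
qed

instance
proof
  fix a b c :: "'a torus"
  show "a + b + c = a + (b + c)" by transfer (simp add: int_lattice_0 add.assoc)
  show "a + b = b + a" by transfer (simp add: int_lattice_0 add.commute)
  show "0 + a = a" by transfer (simp add: int_lattice_0)
  show "- a + a = 0" by transfer (simp add: int_lattice_0)
  show "a - b = a + - b" by transfer (simp add: int_lattice_0)
qed

end

text \<open>
  The quotient metric: the distance of two classes is the minimal Euclidean distance of
  their representatives. Its topology is the quotient topology.
\<close>

instantiation torus :: (finite) metric_space
begin

lift_definition dist_torus :: "'a torus \<Rightarrow> 'a torus \<Rightarrow> real"
  is "\<lambda>x y. infdist (x - y) int_lattice"
proof -
  fix x x' y y' :: "real ^ 'a"
  assume "x - x' \<in> int_lattice" "y - y' \<in> int_lattice"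
  then have "(x - x') - (y - y') \<in> int_lattice" by (rule int_lattice_diff)
  then show "infdist (x - y) int_lattice = infdist (x' - y') int_lattice"
    by (intro infdist_lattice_shift) (simp add: algebra_simps)
qed

definition uniformity_torus :: "('a torus \<times> 'a torus) filter" where
  "uniformity_torus = (INF e\<in>{0<..}. principal {(x, y). dist x y < e})"

definition open_torus :: "'a torus set \<Rightarrow> bool" where
  "open_torus U \<longleftrightarrow> (\<forall>x\<in>U. eventually (\<lambda>(x', y). x' = x \<longrightarrow> y \<in> U) uniformity)"

instance
proof
  fix x y z :: "'a torus"
  have ne: "(int_lattice :: (real ^ 'a) set) \<noteq> {}" using int_lattice_0 by blast
  show "dist x y = 0 \<longleftrightarrow> x = y"
    by transfer (simp add: in_closed_iff_infdist_zero[OF closed_int_lattice ne])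
  show "dist x y \<le> dist x z + dist y z"
  proof transfer
    fix x y z :: "real ^ 'a"
    have "infdist (x - y) int_lattice \<le> infdist (x - z) int_lattice + infdist (z - y) int_lattice"
      using infdist_lattice_add_le[of "x - z" "z - y"] by simp
    also have "infdist (z - y) int_lattice \<le> infdist (y - z) int_lattice"
      using infdist_lattice_uminus_le[of "y - z"] by simp
    finally show "infdist (x - y) int_lattice
        \<le> infdist (x - z) int_lattice + infdist (y - z) int_lattice" by simp
  qed
qed (simp_all add: uniformity_torus_def open_torus_def)

end

lemma dist_to_torus: "dist (to_torus x) (to_torus y) = infdist (x - y) int_lattice"
  by (rule dist_torus.abs_eq)

lemma dist_to_torus_le: "dist (to_torus x) (to_torus y) \<le> dist x y"
  unfolding dist_to_torus using infdist_le[OF int_lattice_0, of "x - y"] by (simp add: dist_norm)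

lemma open_torus_iff: "open U \<longleftrightarrow> open (to_torus -` U)"
proof
  have "continuous_on UNIV (to_torus :: real ^ 'a \<Rightarrow> 'a torus)"
    unfolding continuous_on_iff by (meson dist_to_torus_le le_less_trans)
  then show "open U \<Longrightarrow> open (to_torus -` U)"
    by (rule open_vimage[rotated])
next
  assume op: "open (to_torus -` U)"
  show "open U"
    unfolding open_dist
  proof
    fix p assume p: "p \<in> U"
    obtain x where x: "p = to_torus x"
      using Quotient3_abs_rep[OF Quotient3_torus] by metis
    from op p x obtain e where e: "e > 0" "\<And>y. dist y x < e \<Longrightarrow> to_torus y \<in> U"
      unfolding open_dist by auto
    have "q \<in> U" if q: "dist q p < e" for q
    proof -
      obtain y where y: "q = to_torus y"
        using Quotient3_abs_rep[OF Quotient3_torus] by metis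
      have ne: "(int_lattice :: (real ^ 'a) set) \<noteq> {}" using int_lattice_0 by blast
      have "(INF a\<in>int_lattice. dist (y - x) a) < e"
        using q by (simp add: x y dist_to_torus infdist_notempty[OF ne])
      then obtain a where a: "a \<in> int_lattice" "dist (y - x) a < e"
        by (subst (asm) cINF_less_iff) (use ne in auto)
      have "to_torus (y - a) \<in> U"
        using a(2) by (intro e) (simp add: dist_norm algebra_simps)
      moreover have "to_torus (y - a) = to_torus y"
        by (simp add: torus.abs_eq_iff a(1) int_lattice_uminus)
      ultimately show ?thesis by (simp add: y)
    qed
    with e(1) show "\<exists>e>0. \<forall>q. dist q p < e \<longrightarrow> q \<in> U" by blast
  qed
qed

section \<open>Drifts\<close>

text \<open>
  The set \<open>space (prob_algebra borel)\<close> consists of the Borel probability measures; the values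
  of a drift at other measures are irrelevant.
\<close>

definition drift_class :: "('d::finite torus \<Rightarrow> real ^ 'd) set
    \<Rightarrow> ('d torus measure \<Rightarrow> 'd torus \<Rightarrow> real ^ 'd) set" where
  "drift_class HH = {b. \<exists>F\<in>HH. \<exists>G\<in>HH. \<forall>\<nu>\<in>space (prob_algebra borel). \<forall>x.
      b \<nu> x = G x + (LINT y|\<nu>. F (x - y))}"

definition drift_differences :: "('d::finite torus \<Rightarrow> real ^ 'd) set
    \<Rightarrow> ('d torus measure \<Rightarrow> 'd torus \<Rightarrow> real ^ 'd)
    \<Rightarrow> ('d torus measure \<Rightarrow> 'd torus \<Rightarrow> real ^ 'd) set" where
  "drift_differences HH bstar = {\<lambda>\<nu> x. b \<nu> x - bstar \<nu> x | b. b \<in> drift_class HH}"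

definition dirac_kernel :: "('d::finite torus measure \<Rightarrow> 'd torus \<Rightarrow> real ^ 'd)
    \<Rightarrow> 'd torus \<Rightarrow> 'd torus \<Rightarrow> real ^ 'd" where
  "dirac_kernel g x y = g (return borel y) x"

section \<open>Brownian motions and stochastic differential equations on a filtered space\<close>

definition filtered_prob_space :: "'a measure \<Rightarrow> (real \<Rightarrow> 'a measure) \<Rightarrow> bool" where
  "filtered_prob_space M F \<longleftrightarrow>
     prob_space M \<and> filtration (space M) F \<and> (\<forall>t. subalgebra M (F t))"

definition brownian_motion :: "'a measure \<Rightarrow> (real \<Rightarrow> 'a measure) \<Rightarrow> real
    \<Rightarrow> (real \<Rightarrow> 'a \<Rightarrow> real ^ 'd::finite) \<Rightarrow> bool" where
  "brownian_motion M F T W \<longleftrightarrow>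
     (\<forall>t\<in>{0..T}. W t \<in> borel_measurable (F t)) \<and>
     (\<forall>\<omega>\<in>space M. continuous_on {0..T} (\<lambda>t. W t \<omega>)) \<and>
     (AE \<omega> in M. W 0 \<omega> = 0) \<and>
     (\<forall>s t. 0 \<le> s \<and> s < t \<and> t \<le> T \<longrightarrow>
        distributed M lborel (\<lambda>\<omega>. W t \<omega> - W s \<omega>)
          (\<lambda>x. ennreal (\<Prod>i\<in>UNIV. normal_density 0 (sqrt (t - s)) (x $ i))) \<and>
        prob_space.indep_set M (sets (F s))
          (sets (vimage_algebra (space M) (\<lambda>\<omega>. W t \<omega> - W s \<omega>) borel)))"

text \<open>
  Independent Brownian motions with respect to one common filtration: the joint process is a
  Brownian motion with values in a product of copies of \<open>real ^ 'd\<close>. Together with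
  adaptedness, the condition on the increments yields the independence of the processes
  \<open>W i\<close> and, jointly, their independence of \<open>F 0\<close>.
\<close>

definition independent_brownian_motions :: "'a measure \<Rightarrow> (real \<Rightarrow> 'a measure) \<Rightarrow> real \<Rightarrow> 'i set
    \<Rightarrow> ('i \<Rightarrow> real \<Rightarrow> 'a \<Rightarrow> real ^ 'd::finite) \<Rightarrow> bool" where
  "independent_brownian_motions M F T I W \<longleftrightarrow>
     (\<forall>i\<in>I. brownian_motion M F T (W i)) \<and>
     (\<forall>s t. 0 \<le> s \<and> s < t \<and> t \<le> T \<longrightarrow>
        prob_space.indep_vars M (\<lambda>_. borel) (\<lambda>i \<omega>. W i t \<omega> - W i s \<omega>) I \<and>
        prob_space.indep_set M (sets (F s))
          (sets (vimage_algebra (space M) (\<lambda>\<omega>. \<lambda>i\<in>I. W i t \<omega> - W i s \<omega>) (\<Pi>\<^sub>M i\<in>I. borel))))"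

text \<open>
  \<open>X\<close> solves \<open>dX = b(\<mu>, X) dt + dW\<close> on \<open>[0, T]\<close>. The noise is additive, so the integral form
  of the equation involves no stochastic integral.
\<close>

definition sde_solution :: "'a measure \<Rightarrow> (real \<Rightarrow> 'a measure) \<Rightarrow> real
    \<Rightarrow> ('d::finite torus measure \<Rightarrow> 'd torus \<Rightarrow> real ^ 'd) \<Rightarrow> (real \<Rightarrow> 'd torus measure)
    \<Rightarrow> (real \<Rightarrow> 'a \<Rightarrow> real ^ 'd) \<Rightarrow> (real \<Rightarrow> 'a \<Rightarrow> 'd torus) \<Rightarrow> bool" where
  "sde_solution M F T b \<mu> W X \<longleftrightarrow>
     (\<forall>t\<in>{0..T}. X t \<in> borel_measurable (F t)) \<and>
     (\<forall>\<omega>\<in>space M. continuous_on {0..T} (\<lambda>t. X t \<omega>)) \<and>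
     (AE \<omega> in M. \<forall>t\<in>{0..T}.
        X t \<omega> = X 0 \<omega> + to_torus (integral {0..t} (\<lambda>s. b (\<mu> s) (X s \<omega>)) + W t \<omega>))"

definition mckean_vlasov_solution :: "'a measure \<Rightarrow> (real \<Rightarrow> 'a measure) \<Rightarrow> real
    \<Rightarrow> ('d::finite torus measure \<Rightarrow> 'd torus \<Rightarrow> real ^ 'd)
    \<Rightarrow> (real \<Rightarrow> 'a \<Rightarrow> real ^ 'd) \<Rightarrow> (real \<Rightarrow> 'a \<Rightarrow> 'd torus) \<Rightarrow> bool" where
  "mckean_vlasov_solution M F T b W X \<longleftrightarrow>
     filtered_prob_space M F \<and> brownian_motion M F T W \<and>
     sde_solution M F T b (\<lambda>t. distr M borel (X t)) W X"

definition iid_processes :: "'a measure \<Rightarrow> real \<Rightarrow> 'i set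
    \<Rightarrow> ('i \<Rightarrow> real \<Rightarrow> 'a \<Rightarrow> 'b::topological_space) \<Rightarrow> bool" where
  "iid_processes M T I X \<longleftrightarrow>
     prob_space.indep_vars M (\<lambda>_. \<Pi>\<^sub>M t\<in>{0..T}. borel) (\<lambda>i \<omega>. \<lambda>t\<in>{0..T}. X i t \<omega>) I \<and>
     (\<forall>i\<in>I. \<forall>j\<in>I.
        distr M (\<Pi>\<^sub>M t\<in>{0..T}. borel) (\<lambda>\<omega>. \<lambda>t\<in>{0..T}. X i t \<omega>) =
        distr M (\<Pi>\<^sub>M t\<in>{0..T}. borel) (\<lambda>\<omega>. \<lambda>t\<in>{0..T}. X j t \<omega>))"

section \<open>The Ito integral\<close>

text \<open>
  The data \<open>n\<close>, \<open>\<tau>\<close>, \<open>h\<close> encode the simple process with value \<open>h k\<close> on \<open>(\<tau> k, \<tau> (k + 1)]\<close>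
  for \<open>k < n\<close>.
\<close>

definition simple_integrand :: "(real \<Rightarrow> 'a measure) \<Rightarrow> real
    \<Rightarrow> nat \<Rightarrow> (nat \<Rightarrow> real) \<Rightarrow> (nat \<Rightarrow> 'a \<Rightarrow> real ^ 'd::finite) \<Rightarrow> bool" where
  "simple_integrand F T n \<tau> h \<longleftrightarrow>
     0 \<le> \<tau> 0 \<and> \<tau> n \<le> T \<and> (\<forall>k<n. \<tau> k \<le> \<tau> (Suc k)) \<and>
     (\<forall>k<n. h k \<in> borel_measurable (F (\<tau> k)) \<and> bounded (h k ` space (F (\<tau> k))))"

definition simple_process :: "nat \<Rightarrow> (nat \<Rightarrow> real) \<Rightarrow> (nat \<Rightarrow> 'a \<Rightarrow> real ^ 'd::finite)
    \<Rightarrow> real \<Rightarrow> 'a \<Rightarrow> real ^ 'd" where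
  "simple_process n \<tau> h t \<omega> = (\<Sum>k<n. indicator {\<tau> k<..\<tau> (Suc k)} t *\<^sub>R h k \<omega>)"

definition simple_integral :: "(real \<Rightarrow> 'a \<Rightarrow> real ^ 'd::finite)
    \<Rightarrow> nat \<Rightarrow> (nat \<Rightarrow> real) \<Rightarrow> (nat \<Rightarrow> 'a \<Rightarrow> real ^ 'd) \<Rightarrow> 'a \<Rightarrow> real" where
  "simple_integral W n \<tau> h \<omega> = (\<Sum>k<n. h k \<omega> \<bullet> (W (\<tau> (Suc k)) \<omega> - W (\<tau> k) \<omega>))"

text \<open>
  \<open>Y\<close> is a version of the integral of \<open>\<xi>\<close> over \<open>[0, T]\<close> against \<open>W\<close>: the mean square limit of
  the integrals of simple processes that converge to \<open>\<xi>\<close> in mean square over \<open>[0, T] \<times> \<Omega>\<close>.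
\<close>

definition has_ito_integral :: "'a measure \<Rightarrow> (real \<Rightarrow> 'a measure) \<Rightarrow> real
    \<Rightarrow> (real \<Rightarrow> 'a \<Rightarrow> real ^ 'd::finite) \<Rightarrow> (real \<Rightarrow> 'a \<Rightarrow> real ^ 'd) \<Rightarrow> ('a \<Rightarrow> real) \<Rightarrow> bool" where
  "has_ito_integral M F T W \<xi> Y \<longleftrightarrow>
     (\<lambda>(t, \<omega>). \<xi> t \<omega>) \<in> borel_measurable (restrict_space borel {0..T} \<Otimes>\<^sub>M M) \<and>
     Y \<in> borel_measurable M \<and>
     (\<exists>n \<tau> h.
        (\<forall>m. simple_integrand F T (n m) (\<tau> m) (h m)) \<and>
        (\<lambda>m. \<integral>\<^sup>+\<omega>. (\<integral>\<^sup>+t\<in>{0..T}.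
            ennreal ((norm (\<xi> t \<omega> - simple_process (n m) (\<tau> m) (h m) t \<omega>))\<^sup>2) \<partial>lborel) \<partial>M)
          \<longlonglongrightarrow> 0 \<and>
        (\<lambda>m. \<integral>\<^sup>+\<omega>. ennreal ((Y \<omega> - simple_integral W (n m) (\<tau> m) (h m) \<omega>)\<^sup>2) \<partial>M)
          \<longlonglongrightarrow> 0)"

definition ito_integral :: "'a measure \<Rightarrow> (real \<Rightarrow> 'a measure) \<Rightarrow> real
    \<Rightarrow> (real \<Rightarrow> 'a \<Rightarrow> real ^ 'd::finite) \<Rightarrow> (real \<Rightarrow> 'a \<Rightarrow> real ^ 'd) \<Rightarrow> 'a \<Rightarrow> real" where
  "ito_integral M F T W \<xi> = (SOME Y. has_ito_integral M F T W \<xi> Y)"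

section \<open>The U-statistic\<close>

definition xi_process :: "('d::finite torus measure \<Rightarrow> 'd torus \<Rightarrow> real ^ 'd)
    \<Rightarrow> (real \<Rightarrow> 'd torus measure) \<Rightarrow> (nat \<Rightarrow> real \<Rightarrow> 'a \<Rightarrow> 'd torus)
    \<Rightarrow> nat \<Rightarrow> nat \<Rightarrow> real \<Rightarrow> 'a \<Rightarrow> real ^ 'd" where
  "xi_process g \<mu> X i j t \<omega> =
     dirac_kernel g (X i t \<omega>) (X j t \<omega>) - (LINT y|\<mu> t. dirac_kernel g (X i t \<omega>) y)"

definition U_statistic :: "'a measure \<Rightarrow> (real \<Rightarrow> 'a measure) \<Rightarrow> real
    \<Rightarrow> (real \<Rightarrow> 'd::finite torus measure) \<Rightarrow> nat
    \<Rightarrow> (nat \<Rightarrow> real \<Rightarrow> 'a \<Rightarrow> real ^ 'd) \<Rightarrow> (nat \<Rightarrow> real \<Rightarrow> 'a \<Rightarrow> 'd torus)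
    \<Rightarrow> ('d torus measure \<Rightarrow> 'd torus \<Rightarrow> real ^ 'd) \<Rightarrow> 'a \<Rightarrow> real" where
  "U_statistic M F T \<mu> N W X g \<omega> =
     1 / (real N)\<^sup>2 * (\<Sum>i\<in>{1..N}. \<Sum>j\<in>{1..N} - {i}.
       ito_integral M F T (W i) (xi_process g \<mu> X i j) \<omega>)"

text \<open>With values in \<^typ>\<open>ennreal\<close>, the infimum of the empty set is \<open>\<infinity>\<close>.\<close>

definition orlicz_norm :: "'a measure \<Rightarrow> real \<Rightarrow> ('a \<Rightarrow> real) \<Rightarrow> ennreal" where
  "orlicz_norm M \<beta> Y =
     Inf {ennreal c | c. c > 0 \<and> (\<integral>\<^sup>+\<omega>. ennreal (exp ((\<bar>Y \<omega>\<bar> / c) powr \<beta>) - 1) \<partial>M) \<le> 1}"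

end

theory Submission
  imports Defs
begin

text \<open>
  In \<open>\<xi>\<^sub>i\<^sub>j\<close> the parts of the drift that do not involve \<open>X\<^sup>j\<close> cancel, so
  \<open>\<xi>\<^sub>i\<^sub>j(t) = \<kappa>(X\<^sup>i - X\<^sup>j) - \<integral>\<kappa>(X\<^sup>i - y) d\<mu>\<^sub>t(y)\<close> with \<open>\<kappa>\<close> bounded and continuous. With
  \<open>D\<^sub>i = \<Sum>\<^sub>j \<xi>\<^sub>i\<^sub>j\<close>, the variable \<open>N\<^sup>2 U\<^sub>N\<close> is the terminal value of a martingale with bracket
  \<open>\<integral>\<Sum>\<^sub>i |D\<^sub>i(t)|\<^sup>2 dt\<close>. For fixed \<open>t\<close> and given \<open>X\<^sup>i\<close>, \<open>D\<^sub>i(t)\<close> is a sum of at most \<open>N\<close> independent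
  centred vectors of size \<open>B\<close>, hence sub-Gaussian; by convexity the bracket divided by
  \<open>N\<^sup>2 B\<^sup>2\<close> has an exponential moment. The exponential martingale then gives
  \<open>E exp (N |U\<^sub>N| / (K B)) \<le> 3\<close> with \<open>K\<close> depending only on \<open>d\<close> and \<open>T\<close>. This is stronger than both
  claims, since \<open>ln (ln N) \<ge> ln (ln 3) > 0\<close>. The martingale argument is applied to Riemann sums of
  the Ito integrals and passed to the limit by Fatou's lemma. That the summands are centred means
  that \<open>X\<^sup>j(t)\<close> has law \<open>\<mu>\<^sub>t\<close>, which is uniqueness in law: both processes are pathwise limits of
  their Euler schemes, whose laws depend only on the initial law.
\<close>

section \<open>Topology of the torus\<close>

text \<open>The double sum is treated as a single sum of \<open>N\<close> martingales: all
  \<open>W i\<close> are Brownian motions for one filtration to which every \<open>X j\<close> is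
  adapted, so the sum over \<open>j\<close> goes inside the integrand and \<open>D i\<close> is an
  ordinary adapted integrand. The moment of the bracket uses independence of the particles at one
  time only; times, particles and coordinates are combined by Jensen's inequality, whose loss is
  compensated by the mesh width and the normalisation. On Riemann sums the exponential martingale is
  a Gaussian moment computed step by step. The price is that \<open>ito_integral\<close> is an
  arbitrary choice of version, so existence and the convergence of Riemann sums to whichever version
  is chosen have to be derived from the isometry. Constants: \<open>128 = 2 * 4 * 4^2\<close>
  collects the \<open>2\<close> from the bracket in \<open>exp_stochastic_sum_le\<close>, the
  \<open>4\<close> from the Gaussian linearisation and the bound \<open>4 * B\<close> on
  \<open>\<xi>\<close>. In \<open>C\<close> the factor \<open>64\<close> is adapted to
  \<open>64 powr (2/3) = 16\<close>, and \<open>1 / ln (ln 3)\<close> makes up for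
  \<open>ln (ln N)\<close> being possibly as small as \<open>ln (ln 3)\<close>, which is below
  \<open>1\<close>.\<close>

lemma to_torus_surj: "\<exists>x. p = to_torus x"
  using Quotient3_abs_rep[OF Quotient3_torus] by metis

lemma continuous_on_to_torus [continuous_intros]:
  fixes f :: "'a::topological_space \<Rightarrow> real ^ 'd::finite"
  assumes "continuous_on A f"
  shows "continuous_on A (\<lambda>x. to_torus (f x))"
proof -
  have "continuous_on UNIV (to_torus :: real ^ 'd \<Rightarrow> 'd torus)"
    unfolding continuous_on_iff by (meson dist_to_torus_le le_less_trans)
  then show ?thesis
    using assms by (rule continuous_on_compose2) auto
qed

lemma to_torus_add: "to_torus (x + y) = to_torus x + to_torus y"
  by (simp add: plus_torus.abs_eq)

lemma to_torus_diff: "to_torus (x - y) = to_torus x - to_torus y"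
  by (simp add: minus_torus.abs_eq)

lemma dist_torus_add_right [simp]: "dist (x + z) (y + z) = dist x (y :: 'd::finite torus)"
  by transfer simp

lemma dist_torus_add_left [simp]: "dist (z + x) (z + y) = dist x (y :: 'd::finite torus)"
  by transfer simp

lemma dist_torus_diff_right [simp]: "dist (x - z) (y - z) = dist x (y :: 'd::finite torus)"
  by transfer simp

lemma dist_torus_uminus [simp]: "dist (- x) (- y) = dist x (y :: 'd::finite torus)"
proof -
  \<comment> \<open>Translation by \<open>x + y\<close> turns the pair \<open>- x\<close>,
    \<open>- y\<close> into \<open>y\<close>, \<open>x\<close>.\<close>
  have "dist (- x) (- y) = dist (- x + (x + y)) (- y + (x + y))" by (simp only: dist_torus_add_right)
  also have "\<dots> = dist x y" by (simp add: dist_commute)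
  finally show ?thesis .
qed

lemma dist_torus_add_le: "dist (x + y) (x' + y') \<le> dist x x' + dist y (y' :: 'd::finite torus)"
  using dist_triangle[of "x + y" "x' + y'" "x' + y"] by simp

instance torus :: (finite) topological_ab_group_add
proof
  fix a b :: "'a torus"
  show "((\<lambda>x. fst x + snd x) \<longlongrightarrow> a + b) (nhds a \<times>\<^sub>F nhds b)"
  proof (rule tendstoI)
    fix e :: real assume e: "e > 0"
    have "eventually (\<lambda>x. dist (fst x) a < e / 2 \<and> dist (snd x) b < e / 2) (nhds a \<times>\<^sub>F nhds b)"
      unfolding eventually_prod_filter eventually_nhds_metric using e
      by (intro exI[of _ "\<lambda>x. dist x a < e / 2"] exI[of _ "\<lambda>x. dist x b < e / 2"])
        (auto intro!: exI[of _ "e / 2"])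
    then show "eventually (\<lambda>x. dist (fst x + snd x) (a + b) < e) (nhds a \<times>\<^sub>F nhds b)"
    proof (rule eventually_mono)
      fix x assume "dist (fst x) a < e / 2 \<and> dist (snd x) b < e / 2"
      then show "dist (fst x + snd x) (a + b) < e"
        using dist_torus_add_le[of "fst x" "snd x" a b] by simp
    qed
  qed
  show "(uminus \<longlongrightarrow> - a) (nhds a)"
  proof (rule tendstoI)
    fix e :: real assume "e > 0"
    then show "eventually (\<lambda>x. dist (- x) (- a) < e) (nhds a)"
      by (auto simp: eventually_nhds_metric)
  qed
qed

text \<open>The quotient map is open, because the saturation of an open set is the union of its
  lattice translates; hence the images of a countable basis form a basis. Second countability makes
  the Borel sets of the product generated by rectangles, so that addition on the torus is
  measurable.\<close>

instance torus :: (finite) second_countable_topology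
proof
  obtain B :: "(real ^ 'a) set set" where B: "countable B" "topological_basis B"
    using ex_countable_basis by blast
  define B' where "B' = (\<lambda>U. (to_torus ` U :: 'a torus set)) ` B"
  have op: "open (to_torus ` U :: 'a torus set)" if U: "open U" for U :: "(real ^ 'a) set"
  proof -
    have "to_torus -` (to_torus ` U) = (\<Union>k\<in>int_lattice. (+) k ` U)"
    proof safe
      fix x y assume "to_torus x = to_torus y" "y \<in> U"
      then have "x - y \<in> int_lattice" by (simp add: torus.abs_eq_iff)
      with \<open>y \<in> U\<close> show "x \<in> (\<Union>k\<in>int_lattice. (+) k ` U)"
        by (intro UN_I[of "x - y"] image_eqI[of _ _ y]) auto
    next
      fix k y :: "real ^ 'a" assume "k \<in> int_lattice" "y \<in> U"
      then show "k + y \<in> to_torus -` (to_torus ` U)"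
        by (auto intro!: image_eqI[of _ _ y] simp: torus.abs_eq_iff)
    qed
    then show ?thesis
      unfolding open_torus_iff using U by (auto intro: open_translation)
  qed
  have "topological_basis B'"
  proof (rule topological_basisI)
    show "open V" if "V \<in> B'" for V
      using that op topological_basis_open[OF B(2)] by (auto simp: B'_def)
    fix V and p :: "'a torus" assume V: "open V" "p \<in> V"
    obtain x where x: "p = to_torus x" using to_torus_surj by blast
    have "open (to_torus -` V)" "x \<in> to_torus -` V"
      using V x by (auto simp: open_torus_iff[symmetric])
    then obtain U where "U \<in> B" "x \<in> U" "U \<subseteq> to_torus -` V"
      using topological_basisE[OF B(2)] by metis
    then show "\<exists>W\<in>B'. p \<in> W \<and> W \<subseteq> V"
      unfolding B'_def x by auto
  qed
  moreover have "countable B'" using B(1) by (simp add: B'_def)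
  ultimately show "\<exists>B::'a torus set set. countable B \<and> open = generate_topology B"
    using topological_basis_imp_subbasis by blast
qed

lemma borel_measurable_to_torus [measurable]: "to_torus \<in> borel_measurable borel"
  by (intro borel_measurable_continuous_onI continuous_on_to_torus continuous_on_id)

lemma borel_measurable_torus_add [measurable]:
  fixes f g :: "'a \<Rightarrow> 'd::finite torus"
  assumes "f \<in> borel_measurable M" "g \<in> borel_measurable M"
  shows "(\<lambda>x. f x + g x) \<in> borel_measurable M"
  using assms by (rule borel_measurable_continuous_Pair) (intro continuous_intros)

lemma borel_measurable_torus_diff [measurable]:
  fixes f g :: "'a \<Rightarrow> 'd::finite torus"
  assumes "f \<in> borel_measurable M" "g \<in> borel_measurable M"
  shows "(\<lambda>x. f x - g x) \<in> borel_measurable M"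
  using assms by (rule borel_measurable_continuous_Pair) (intro continuous_intros)

section \<open>Independence of a random variable from a sub-sigma-algebra\<close>

text \<open>This takes the place of conditioning on \<open>G\<close>: the
  \<open>G\<close>-measurable dependence on \<open>\<omega>\<close> is frozen while \<open>V\<close>
  is integrated out. Independence says that the identity, viewed as a map into \<open>G\<close>, and
  \<open>V\<close> have a product as joint law, which is checked on rectangles; Tonelli does the
  rest.\<close>

lemma (in prob_space) nn_integral_indep_subalgebra:
  assumes sub: "subalgebra M G"
    and V[measurable]: "V \<in> measurable M N"
    and ind: "indep_set (sets G) (sets (vimage_algebra (space M) V N))"
    and f: "f \<in> borel_measurable (G \<Otimes>\<^sub>M N)"
  shows "(\<integral>\<^sup>+\<omega>. f (\<omega>, V \<omega>) \<partial>M) = (\<integral>\<^sup>+\<omega>. \<integral>\<^sup>+v. f (\<omega>, v) \<partial>distr M N V \<partial>M)"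
proof -
  have [measurable]: "(\<lambda>x. x) \<in> measurable M G"
    using measurable_from_subalg[OF sub measurable_ident_sets[OF refl]] by simp
  have spG: "space G = space M" using sub by (simp add: subalgebra_def)
  interpret VN: prob_space "distr M N V" by (rule prob_space_distr) simp
  interpret Id: prob_space "distr M G (\<lambda>x. x)" by (rule prob_space_distr) simp
  have eq: "distr M G (\<lambda>x. x) \<Otimes>\<^sub>M distr M N V = distr M (G \<Otimes>\<^sub>M N) (\<lambda>x. (x, V x))"
  proof (rule pair_measure_eqI)
    fix A B assume A: "A \<in> sets (distr M G (\<lambda>x. x))" and B: "B \<in> sets (distr M N V)"
    have A': "A \<in> sets G" "A \<in> sets M" "A \<subseteq> space M"
      using A sub sets.sets_into_space[of A G] spG by (auto simp: subalgebra_def)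
    have "V -` B \<inter> space M \<in> sets (vimage_algebra (space M) V N)"
      using B by (intro in_vimage_algebra) simp
    then have "prob (A \<inter> (V -` B \<inter> space M)) = prob A * prob (V -` B \<inter> space M)"
      using ind A' unfolding indep_sets2_eq by blast
    moreover have "(\<lambda>x. (x, V x)) -` (A \<times> B) \<inter> space M = A \<inter> (V -` B \<inter> space M)"
      using A' by auto
    moreover have "(\<lambda>x. x) -` A \<inter> space M = A" using A' by auto
    ultimately show "emeasure (distr M G (\<lambda>x. x)) A * emeasure (distr M N V) B =
        emeasure (distr M (G \<Otimes>\<^sub>M N) (\<lambda>x. (x, V x))) (A \<times> B)"
      using A' B by (simp add: emeasure_distr emeasure_eq_measure ennreal_mult'')
  qed (auto intro: Id.sigma_finite_measure_axioms VN.sigma_finite_measure_axioms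
      cong: sets_pair_measure_cong)
  have f': "f \<in> borel_measurable (distr M G (\<lambda>x. x) \<Otimes>\<^sub>M distr M N V)"
    using f by (simp cong: measurable_cong_sets sets_pair_measure_cong)
  have "(\<integral>\<^sup>+\<omega>. f (\<omega>, V \<omega>) \<partial>M) = (\<integral>\<^sup>+p. f p \<partial>distr M (G \<Otimes>\<^sub>M N) (\<lambda>x. (x, V x)))"
    using f by (subst nn_integral_distr) auto
  also have "\<dots> = (\<integral>\<^sup>+\<omega>. \<integral>\<^sup>+v. f (\<omega>, v) \<partial>distr M N V \<partial>distr M G (\<lambda>x. x))"
    unfolding eq[symmetric] using f' by (rule VN.nn_integral_fst[symmetric])
  also have "\<dots> = (\<integral>\<^sup>+\<omega>. \<integral>\<^sup>+v. f (\<omega>, v) \<partial>distr M N V \<partial>M)"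
  proof -
    have "(\<lambda>\<omega>. \<integral>\<^sup>+v. f (\<omega>, v) \<partial>distr M N V) \<in> borel_measurable G"
      using VN.borel_measurable_nn_integral_fst[of f G] f
      by (simp cong: measurable_cong_sets sets_pair_measure_cong)
    then show ?thesis by (subst nn_integral_distr) auto
  qed
  finally show ?thesis .
qed

text \<open>The sigma-algebras generated by \<open>Z\<close> and by \<open>f (V \<omega>)\<close>
  lie inside the two independent ones, so expectations multiply. This version serves signed
  integrands, as they occur in the moments of increments.\<close>

lemma (in prob_space) integral_mult_indep_subalgebra:
  fixes Z :: "'a \<Rightarrow> real" and f :: "'b \<Rightarrow> real"
  assumes sub: "subalgebra M G"
    and V[measurable]: "V \<in> measurable M N"
    and ind: "indep_set (sets G) (sets (vimage_algebra (space M) V N))"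
    and Z: "Z \<in> borel_measurable G" "integrable M Z"
    and f[measurable]: "f \<in> borel_measurable N" "integrable M (\<lambda>\<omega>. f (V \<omega>))"
  shows "integrable M (\<lambda>\<omega>. Z \<omega> * f (V \<omega>))"
    and "(\<integral>\<omega>. Z \<omega> * f (V \<omega>) \<partial>M) = (\<integral>\<omega>. Z \<omega> \<partial>M) * (\<integral>\<omega>. f (V \<omega>) \<partial>M)"
proof -
  have spG: "space G = space M" using sub by (simp add: subalgebra_def)
  have [measurable]: "Z \<in> borel_measurable M"
    using measurable_from_subalg[OF sub Z(1)] .
  have "indep_var borel Z borel (\<lambda>\<omega>. f (V \<omega>))"
    unfolding indep_var_eq
  proof (intro conjI)
    have A: "sigma_sets (space M) {Z -` A \<inter> space M |A. A \<in> sets borel} \<subseteq> sets G"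
      using Z(1) spG unfolding measurable_iff_sets by (simp add: sets_vimage_algebra)
    have "(\<lambda>\<omega>. f (V \<omega>)) \<in> borel_measurable (vimage_algebra (space M) V N)"
      using measurable_space[OF V] by (intro measurable_compose[OF measurable_vimage_algebra1 f(1)]) auto
    then have B: "sigma_sets (space M) {(\<lambda>\<omega>. f (V \<omega>)) -` A \<inter> space M |A. A \<in> sets borel}
        \<subseteq> sets (vimage_algebra (space M) V N)"
      unfolding measurable_iff_sets by (simp add: sets_vimage_algebra)
    from ind show "indep_set (sigma_sets (space M) {Z -` A \<inter> space M |A. A \<in> sets borel})
     (sigma_sets (space M) {(\<lambda>\<omega>. f (V \<omega>)) -` A \<inter> space M |A. A \<in> sets borel})"
      unfolding indep_sets2_eq using A B by blast
  qed simp_all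
  from indep_var_integrable[OF this Z(2) f(2)] indep_var_lebesgue_integral[OF this Z(2) f(2)]
  show "integrable M (\<lambda>\<omega>. Z \<omega> * f (V \<omega>))"
    and "(\<integral>\<omega>. Z \<omega> * f (V \<omega>) \<partial>M) = (\<integral>\<omega>. Z \<omega> \<partial>M) * (\<integral>\<omega>. f (V \<omega>) \<partial>M)" .
qed

section \<open>Centred Gaussian vectors\<close>

lemma prod_Basis_vec:
  fixes f :: "real ^ 'd::finite \<Rightarrow> 'b::comm_monoid_mult"
  shows "(\<Prod>b\<in>Basis. f b) = (\<Prod>i\<in>UNIV. f (axis i 1))"
proof -
  have B: "(Basis :: (real ^ 'd) set) = range (\<lambda>i. axis i 1)"
    by (auto simp: Basis_vec_def)
  have "inj (\<lambda>i :: 'd. axis i (1::real))"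
    by (simp add: inj_on_def axis_eq_axis)
  from prod.reindex[OF this, of f] show ?thesis
    unfolding B by (simp add: o_def)
qed

lemma has_bochner_integral_lborel_vec_prod:
  fixes f :: "'d::finite \<Rightarrow> real \<Rightarrow> real"
  assumes "\<And>i. has_bochner_integral lborel (f i) (c i)"
  shows "has_bochner_integral lborel (\<lambda>x. \<Prod>i\<in>UNIV. f i (x $ i)) (\<Prod>i\<in>UNIV. c i)"
proof -
  \<comment> \<open>\<open>idx\<close> inverts \<open>axis\<close>, so that a family indexed by
    coordinates becomes one indexed by \<open>Basis\<close>, over which \<open>lborel\<close> is a
    product.\<close>
  define idx where "idx b = (SOME i. b = axis i (1::real))" for b :: "real ^ 'd"
  have idx: "idx (axis i 1) = i" for i
    unfolding idx_def by (rule some_equality) (auto simp: axis_eq_axis)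
  have I: "integrable lborel (f i)" "integral\<^sup>L lborel (f i) = c i" for i
    using assms[of i] by (simp_all add: has_bochner_integral_iff)
  have [measurable]: "f i \<in> borel_measurable borel" for i
    using I(1)[of i] by (simp add: integrable_iff_bounded)
  let ?P = "\<Pi>\<^sub>M b\<in>(Basis :: (real ^ 'd) set). (lborel :: real measure)"
  interpret product_sigma_finite "\<lambda>_ :: real ^ 'd. lborel :: real measure" ..
  have "integrable ?P (\<lambda>x. \<Prod>b\<in>Basis. f (idx b) (x b))"
    by (rule product_integrable_prod) (auto intro: I)
  moreover have "integral\<^sup>L ?P (\<lambda>x. \<Prod>b\<in>Basis. f (idx b) (x b)) = (\<Prod>b\<in>(Basis :: (real ^ 'd) set). c (idx b))"
    by (subst product_integral_prod) (auto intro: I simp: I)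
  ultimately have "has_bochner_integral ?P (\<lambda>x. \<Prod>b\<in>Basis. f (idx b) ((\<Sum>b\<in>Basis. x b *\<^sub>R b) \<bullet> b))
      (\<Prod>b\<in>(Basis :: (real ^ 'd) set). c (idx b))"
    by (simp add: has_bochner_integral_iff cong: prod.cong)
  then have "has_bochner_integral lborel (\<lambda>x. \<Prod>b\<in>(Basis :: (real ^ 'd) set). f (idx b) (x \<bullet> b))
      (\<Prod>b\<in>(Basis :: (real ^ 'd) set). c (idx b))"
    by (subst lborel_eq) (simp add: has_bochner_integral_iff integrable_distr_eq integral_distr)
  then show ?thesis by (simp add: prod_Basis_vec idx inner_axis)
qed

text \<open>The centred normal law with covariance \<open>s\<close> times the identity;
  \<open>s\<close> is the variance, hence the square root. The density has the form used in
  \<open>brownian_motion\<close>, so this is directly the law of an increment over a time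
  \<open>s\<close>.\<close>

definition gauss :: "real \<Rightarrow> (real ^ 'd::finite) measure" where
  "gauss s = density lborel (\<lambda>x. ennreal (\<Prod>i\<in>UNIV. normal_density 0 (sqrt s) (x $ i)))"

lemma sets_gauss [simp, measurable_cong]: "sets (gauss s) = sets borel"
  by (simp add: gauss_def)

lemma space_gauss [simp]: "space (gauss s) = UNIV"
  by (simp add: gauss_def)

lemma has_bochner_integral_gauss_prod:
  fixes f :: "'d::finite \<Rightarrow> real \<Rightarrow> real"
  assumes [measurable]: "\<And>i. f i \<in> borel_measurable borel"
    and "\<And>i. has_bochner_integral lborel (\<lambda>x. normal_density 0 (sqrt s) x * f i x) (c i)"
  shows "has_bochner_integral (gauss s) (\<lambda>x. \<Prod>i\<in>UNIV. f i (x $ i)) (\<Prod>i\<in>UNIV. c i)"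
proof -
  have "has_bochner_integral lborel (\<lambda>x. \<Prod>i\<in>UNIV. normal_density 0 (sqrt s) (x $ i) * f i (x $ i)) (\<Prod>i\<in>UNIV. c i)"
    using assms(2) by (rule has_bochner_integral_lborel_vec_prod)
  then have "has_bochner_integral lborel (\<lambda>x. (\<Prod>i\<in>UNIV. normal_density 0 (sqrt s) (x $ i)) *\<^sub>R (\<Prod>i\<in>UNIV. f i (x $ i))) (\<Prod>i\<in>UNIV. c i)"
    by (simp add: prod.distrib)
  then show ?thesis
    unfolding gauss_def
    by (intro has_bochner_integral_density) (auto intro!: prod_nonneg)
qed

lemma has_bochner_integral_normal_1:
  "s > 0 \<Longrightarrow> has_bochner_integral lborel (\<lambda>x. normal_density 0 (sqrt s) x * 1) 1"
  using integral_normal_density[of "sqrt s" 0] integrable_normal_density[of "sqrt s" 0]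
  by (simp add: has_bochner_integral_iff)

lemma gauss_mean:
  assumes "s > 0"
  shows "has_bochner_integral (gauss s) (\<lambda>x :: real ^ 'd::finite. x $ a) 0"
proof -
  \<comment> \<open>The coordinate is padded with factors \<open>1\<close> to a product over all
    coordinates, for which the integral factorises.\<close>
  have "has_bochner_integral (gauss s) (\<lambda>x :: real ^ 'd. \<Prod>i\<in>UNIV. (if i = a then x $ i else 1))
     (\<Prod>i\<in>UNIV. (if i = a then 0 else 1))"
  proof (rule has_bochner_integral_gauss_prod)
    fix i
    show "has_bochner_integral lborel (\<lambda>x. normal_density 0 (sqrt s) x * (if i = a then x else 1)) (if i = a then 0 else 1)"
      using has_bochner_integral_normal_1[OF assms] normal_moment_nz_1[of "sqrt s" 0] assms by auto
  qed simp
  then show ?thesis by (simp add: prod.delta)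
qed

lemma gauss_covariance:
  assumes "s > 0"
  shows "has_bochner_integral (gauss s) (\<lambda>x :: real ^ 'd::finite. x $ a * x $ b) (if a = b then s else 0)"
proof (cases "a = b")
  case True
  have 2: "has_bochner_integral lborel (\<lambda>x. normal_density 0 (sqrt s) x * (x * x)) s"
    using normal_moment_even[of "sqrt s" 0 1] assms
    by (simp add: power2_eq_square fact_numeral)
  have "has_bochner_integral (gauss s) (\<lambda>x :: real ^ 'd. \<Prod>i\<in>UNIV. (if i = a then x $ i * x $ i else 1))
     (\<Prod>i\<in>UNIV. (if i = a then s else 1))"
  proof (rule has_bochner_integral_gauss_prod)
    fix i
    show "has_bochner_integral lborel (\<lambda>x. normal_density 0 (sqrt s) x * (if i = a then x * x else 1)) (if i = a then s else 1)"
      using has_bochner_integral_normal_1[OF assms] 2 by auto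
  qed simp
  then show ?thesis using True by (simp add: prod.delta)
next
  case False
  have "has_bochner_integral (gauss s) (\<lambda>x :: real ^ 'd. \<Prod>i\<in>UNIV. ((if i = a then x $ i else 1) * (if i = b then x $ i else 1)))
     (\<Prod>i\<in>UNIV. (if i = a then 0 else if i = b then 0 else 1))"
  proof (rule has_bochner_integral_gauss_prod)
    fix i
    show "has_bochner_integral lborel (\<lambda>x. normal_density 0 (sqrt s) x * ((if i = a then x else 1) * (if i = b then x else 1)))
        (if i = a then 0 else if i = b then 0 else 1)"
      using has_bochner_integral_normal_1[OF assms] normal_moment_nz_1[of "sqrt s" 0] assms False by auto
  qed simp
  moreover have "(\<Prod>i\<in>UNIV. (if i = a then 0 else if i = b then 0 else 1 :: real)) = 0"
    by (rule prod_zero) auto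
  ultimately show ?thesis using False by (simp add: prod.distrib prod.delta)
qed

text \<open>Completing the square: the exponential tilts the density into the one with mean
  \<open>h * \<sigma>\<^sup>2\<close>, up to the constant on the right.\<close>

lemma nn_integral_exp_normal:
  assumes "\<sigma> > 0"
  shows "(\<integral>\<^sup>+x. ennreal (normal_density 0 \<sigma> x * exp (h * x)) \<partial>lborel) = ennreal (exp (\<sigma>\<^sup>2 * h\<^sup>2 / 2))"
proof -
  have eq: "normal_density 0 \<sigma> x * exp (h * x) = exp (\<sigma>\<^sup>2 * h\<^sup>2 / 2) * normal_density (h * \<sigma>\<^sup>2) \<sigma> x" for x
  proof -
    have "- (x - 0)\<^sup>2 / (2 * \<sigma>\<^sup>2) + h * x = \<sigma>\<^sup>2 * h\<^sup>2 / 2 + - (x - h * \<sigma>\<^sup>2)\<^sup>2 / (2 * \<sigma>\<^sup>2)"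
      using assms by (simp add: field_simps power2_eq_square)
    then show ?thesis
      unfolding normal_density_def by (simp add: exp_add[symmetric] mult_ac)
  qed
  have "(\<integral>\<^sup>+x. ennreal (normal_density 0 \<sigma> x * exp (h * x)) \<partial>lborel) =
      ennreal (exp (\<sigma>\<^sup>2 * h\<^sup>2 / 2)) * (\<integral>\<^sup>+x. ennreal (normal_density (h * \<sigma>\<^sup>2) \<sigma> x) \<partial>lborel)"
    unfolding eq by (subst nn_integral_cmult[symmetric]) (auto simp: ennreal_mult)
  also have "(\<integral>\<^sup>+x. ennreal (normal_density (h * \<sigma>\<^sup>2) \<sigma> x) \<partial>lborel) = 1"
    using assms by (subst nn_integral_eq_integral) auto
  finally show ?thesis by simp
qed

lemma nn_integral_exp_gauss:
  fixes h :: "real ^ 'd::finite"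
  assumes s: "s > 0"
  shows "(\<integral>\<^sup>+x. ennreal (exp (h \<bullet> x)) \<partial>gauss s) = ennreal (exp (s * (norm h)\<^sup>2 / 2))"
proof -
  have "has_bochner_integral (gauss s) (\<lambda>x :: real ^ 'd. \<Prod>i\<in>UNIV. exp (h $ i * x $ i)) (\<Prod>i\<in>UNIV. exp (s * (h $ i)\<^sup>2 / 2))"
  proof (rule has_bochner_integral_gauss_prod)
    fix i
    show "has_bochner_integral lborel (\<lambda>x. normal_density 0 (sqrt s) x * exp (h $ i * x)) (exp (s * (h $ i)\<^sup>2 / 2))"
      using s by (intro has_bochner_integral_nn_integral) (auto simp: nn_integral_exp_normal)
  qed simp
  moreover have "(\<Prod>i\<in>UNIV. exp (h $ i * x $ i)) = exp (h \<bullet> x)" for x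
    by (simp add: inner_vec_def exp_sum)
  moreover have "(\<Prod>i\<in>UNIV. exp (s * (h $ i)\<^sup>2 / 2)) = exp (s * (norm h)\<^sup>2 / 2)"
    by (simp add: exp_sum[symmetric] norm_vec_def L2_set_def sum_nonneg sum_distrib_left sum_divide_distrib)
  ultimately show ?thesis
    by (subst nn_integral_eq_integral) (auto simp: has_bochner_integral_iff)
qed

text \<open>The total mass is the exponential moment at \<open>h = 0\<close>.\<close>

lemma prob_space_gauss: "s > 0 \<Longrightarrow> prob_space (gauss s :: (real ^ 'd::finite) measure)"
  using nn_integral_exp_gauss[of s "0 :: real ^ 'd"]
  by (intro prob_spaceI) simp

text \<open>The factor halves the quadratic exponent, which leaves an unnormalised normal density of
  variance \<open>2\<close>. Its mass \<open>sqrt 2\<close> is the constant in all later exponential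
  moments of squares.\<close>

lemma nn_integral_exp_square_normal:
  "(\<integral>\<^sup>+z. ennreal (std_normal_density z * exp (z\<^sup>2 / 4)) \<partial>lborel) = ennreal (sqrt 2)"
proof -
  have "std_normal_density z * exp (z\<^sup>2 / 4) = sqrt 2 * normal_density 0 (sqrt 2) z" for z
  proof -
    have "- z\<^sup>2 / 2 + z\<^sup>2 / 4 = - z\<^sup>2 / (2 * (sqrt 2)\<^sup>2)" by simp
    then show ?thesis
      unfolding normal_density_def by (simp add: exp_add[symmetric] real_sqrt_mult field_simps)
  qed
  then have "(\<integral>\<^sup>+z. ennreal (std_normal_density z * exp (z\<^sup>2 / 4)) \<partial>lborel) =
     ennreal (sqrt 2) * (\<integral>\<^sup>+z. ennreal (normal_density 0 (sqrt 2) z) \<partial>lborel)"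
    by (subst nn_integral_cmult[symmetric]) (auto simp: ennreal_mult)
  also have "(\<integral>\<^sup>+z. ennreal (normal_density 0 (sqrt 2) z) \<partial>lborel) = 1"
    by (subst nn_integral_eq_integral) auto
  finally show ?thesis by simp
qed

section \<open>Increments of Brownian motion\<close>

locale filtered = prob_space M for M :: "'a measure" +
  fixes F :: "real \<Rightarrow> 'a measure"
  assumes fps: "filtered_prob_space M F"
begin

lemma subalg: "subalgebra M (F t)"
  using fps by (simp add: filtered_prob_space_def)

lemma space_F [simp]: "space (F t) = space M"
  using subalg[of t] by (simp add: subalgebra_def)

lemma measurable_F: "f \<in> measurable (F t) N \<Longrightarrow> f \<in> measurable M N"
  using measurable_from_subalg[OF subalg] .

lemma subalg_F: "s \<le> t \<Longrightarrow> subalgebra (F t) (F s)"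
proof -
  assume "s \<le> t"
  moreover have "filtration (space M) F" using fps by (simp add: filtered_prob_space_def)
  ultimately show ?thesis
    unfolding subalgebra_def using filtration.sets_F_mono by fastforce
qed

lemma measurable_F_mono: "f \<in> measurable (F s) N \<Longrightarrow> s \<le> t \<Longrightarrow> f \<in> measurable (F t) N"
  using measurable_from_subalg[OF subalg_F] .

definition bdd_meas :: "real \<Rightarrow> ('a \<Rightarrow> 'b::euclidean_space) \<Rightarrow> bool" where
  "bdd_meas t h \<longleftrightarrow> h \<in> borel_measurable (F t) \<and> bounded (h ` space M)"

lemma bdd_meas_mono: "bdd_meas s h \<Longrightarrow> s \<le> t \<Longrightarrow> bdd_meas t h"
  by (auto simp: bdd_meas_def intro: measurable_F_mono)

lemma bdd_meas_integrable:
  assumes "bdd_meas s (h :: 'a \<Rightarrow> real)" "integrable M g"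
  shows "integrable M (\<lambda>\<omega>. h \<omega> * g \<omega>)"
proof -
  have [measurable]: "h \<in> borel_measurable M"
    using assms(1) by (auto simp: bdd_meas_def intro: measurable_F)
  have [measurable]: "g \<in> borel_measurable M" using assms(2) by simp
  obtain C where C: "\<And>\<omega>. \<omega> \<in> space M \<Longrightarrow> norm (h \<omega>) \<le> C"
    using assms(1) by (auto simp: bdd_meas_def bounded_iff)
  show ?thesis
  proof (rule Bochner_Integration.integrable_bound[of _ "\<lambda>\<omega>. C * g \<omega>"])
    show "AE \<omega> in M. norm (h \<omega> * g \<omega>) \<le> norm (C * g \<omega>)"
    proof (rule AE_I2)
      fix \<omega> assume "\<omega> \<in> space M"
      from C[OF this] show "norm (h \<omega> * g \<omega>) \<le> norm (C * g \<omega>)"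
        by (simp add: abs_mult mult_right_mono)
    qed
  qed (use assms(2) in auto)
qed

lemma bdd_meas_nth:
  assumes "bdd_meas s (h :: 'a \<Rightarrow> real ^ 'd::finite)"
  shows "bdd_meas s (\<lambda>\<omega>. h \<omega> $ a)"
proof -
  obtain C where "\<And>\<omega>. \<omega> \<in> space M \<Longrightarrow> norm (h \<omega>) \<le> C"
    using assms by (auto simp: bdd_meas_def bounded_iff)
  then have "bounded ((\<lambda>\<omega>. h \<omega> $ a) ` space M)"
    unfolding bounded_iff using component_le_norm_cart[of "h _" a]
    by (auto intro!: exI[of _ C] intro: order_trans)
  moreover have "(\<lambda>\<omega>. h \<omega> $ a) \<in> borel_measurable (F s)"
    using assms measurable_compose[of h "F s" borel "\<lambda>x. x $ a"] by (auto simp: bdd_meas_def)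
  ultimately show ?thesis by (simp add: bdd_meas_def)
qed

lemma bdd_meas_uminus: "bdd_meas s h \<Longrightarrow> bdd_meas s (\<lambda>\<omega>. - h \<omega>)"
  by (auto simp: bdd_meas_def bounded_iff)

lemma bdd_meas_mult:
  assumes "bdd_meas s (g :: 'a \<Rightarrow> real)" "bdd_meas s (h :: 'a \<Rightarrow> real)"
  shows "bdd_meas s (\<lambda>\<omega>. g \<omega> * h \<omega>)"
  unfolding bdd_meas_def
proof
  show "(\<lambda>\<omega>. g \<omega> * h \<omega>) \<in> borel_measurable (F s)"
    using assms by (auto simp: bdd_meas_def)
  obtain C D where C: "\<And>\<omega>. \<omega> \<in> space M \<Longrightarrow> norm (g \<omega>) \<le> C"
     and D: "\<And>\<omega>. \<omega> \<in> space M \<Longrightarrow> norm (h \<omega>) \<le> D"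
    using assms by (auto simp: bdd_meas_def bounded_iff)
  have "norm (g \<omega> * h \<omega>) \<le> C * D" if "\<omega> \<in> space M" for \<omega>
    unfolding norm_mult using C[OF that] D[OF that] by (intro mult_mono) (auto intro: order_trans)
  then show "bounded ((\<lambda>\<omega>. g \<omega> * h \<omega>) ` space M)"
    by (auto simp: bounded_iff)
qed

end

locale brownian = filtered +
  fixes T :: real and W :: "real \<Rightarrow> 'a \<Rightarrow> real ^ 'd::finite"
  assumes bm: "brownian_motion M F T W"
begin

abbreviation inc :: "real \<Rightarrow> real \<Rightarrow> 'a \<Rightarrow> real ^ 'd" where
  "inc s t \<omega> \<equiv> W t \<omega> - W s \<omega>"

lemma W_measurable_F: "0 \<le> s \<Longrightarrow> s \<le> t \<Longrightarrow> s \<le> T \<Longrightarrow> W s \<in> borel_measurable (F t)"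
  using bm by (auto simp: brownian_motion_def intro: measurable_F_mono)

lemma W_measurable: "0 \<le> s \<Longrightarrow> s \<le> T \<Longrightarrow> W s \<in> borel_measurable M"
  using W_measurable_F[of s s] measurable_F by auto

lemma inc_measurable: "0 \<le> s \<Longrightarrow> s \<le> t \<Longrightarrow> t \<le> T \<Longrightarrow> inc s t \<in> borel_measurable M"
  by (intro borel_measurable_diff W_measurable) auto

lemma inc_indep:
  "0 \<le> s \<Longrightarrow> s < t \<Longrightarrow> t \<le> T \<Longrightarrow>
    indep_set (sets (F s)) (sets (vimage_algebra (space M) (inc s t) borel))"
  using bm by (simp add: brownian_motion_def)

lemma distr_inc:
  assumes "0 \<le> s" "s < t" "t \<le> T"
  shows "distr M borel (inc s t) = gauss (t - s)"
proof -
  have "distributed M lborel (inc s t) (\<lambda>x. ennreal (\<Prod>i\<in>UNIV. normal_density 0 (sqrt (t - s)) (x $ i)))"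
    using bm assms by (simp add: brownian_motion_def)
  then have "distr M lborel (inc s t) = gauss (t - s)"
    by (simp add: distributed_def gauss_def)
  moreover have "distr M borel (inc s t) = distr M lborel (inc s t)"
    by (rule distr_cong) auto
  ultimately show ?thesis by simp
qed

lemma inc_moment:
  assumes "0 \<le> s" "s < t" "t \<le> T" "f \<in> borel_measurable borel" "has_bochner_integral (gauss (t - s)) f (c :: real)"
  shows "has_bochner_integral M (\<lambda>\<omega>. f (inc s t \<omega>)) c"
proof -
  have "inc s t \<in> borel_measurable M" using assms by (intro inc_measurable) auto
  from integrable_distr_eq[OF this assms(4)] integral_distr[OF this assms(4)] show ?thesis
    using assms(5) unfolding distr_inc[OF assms(1-3), symmetric] by (simp add: has_bochner_integral_iff)
qed

text \<open>\<open>brownian_motion\<close> gives laws only for \<open>s < t\<close>. The case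
  \<open>s = t\<close> is included because the partition of a simple integrand may repeat points and
  the overlap of two intervals may degenerate.\<close>

lemma inc_mean:
  assumes "0 \<le> s" "s \<le> t" "t \<le> T"
  shows "has_bochner_integral M (\<lambda>\<omega>. inc s t \<omega> $ a) 0"
proof (cases "s = t")
  case False
  then show ?thesis using assms by (intro inc_moment[where f = "\<lambda>x. x $ a"] gauss_mean) auto
qed (simp add: has_bochner_integral_iff)

lemma inc_covariance:
  assumes "0 \<le> s" "s \<le> t" "t \<le> T"
  shows "has_bochner_integral M (\<lambda>\<omega>. inc s t \<omega> $ a * inc s t \<omega> $ b) (if a = b then t - s else 0)"
proof (cases "s = t")
  case False
  then show ?thesis using assms by (intro inc_moment[where f = "\<lambda>x. x $ a * x $ b"] gauss_covariance) auto
qed (simp add: has_bochner_integral_iff)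

lemma has_bochner_integral_indep_inc:
  fixes Z :: "'a \<Rightarrow> real" and f :: "real ^ 'd \<Rightarrow> real"
  assumes "0 \<le> s" "s \<le> t" "t \<le> T" "Z \<in> borel_measurable (F s)" "integrable M Z"
    and f[measurable]: "f \<in> borel_measurable borel"
    and "has_bochner_integral M (\<lambda>\<omega>. f (inc s t \<omega>)) c"
  shows "has_bochner_integral M (\<lambda>\<omega>. Z \<omega> * f (inc s t \<omega>)) (integral\<^sup>L M Z * c)"
proof (cases "s = t")
  case True
  \<comment> \<open>A vanishing increment makes the integrand constant, and total mass
    \<open>1\<close> forces \<open>c = f 0\<close>.\<close>
  have "has_bochner_integral M (\<lambda>\<omega>. f 0) (f 0)"
    by (simp add: has_bochner_integral_iff prob_space)
  then have "c = f 0"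
    using assms(7) True by (auto dest: has_bochner_integral_eq)
  then show ?thesis
    using True assms(5) by (auto simp: has_bochner_integral_iff)
next
  case False
  then have st: "s < t" using assms by simp
  have "integrable M (\<lambda>\<omega>. f (inc s t \<omega>))" "(\<integral>\<omega>. f (inc s t \<omega>) \<partial>M) = c"
    using assms(7) by (auto simp: has_bochner_integral_iff)
  with integral_mult_indep_subalgebra[OF subalg inc_measurable[OF assms(1-3)] inc_indep[OF assms(1) st assms(3)] assms(4,5) f]
  show ?thesis by (auto simp: has_bochner_integral_iff)
qed

text \<open>The later increment is centred and independent of \<open>F r\<close>, while both
  coefficients and the earlier increment are known at time \<open>r\<close>.\<close>

lemma past_future:
  assumes "0 \<le> p" "p \<le> q" "q \<le> r" "r \<le> t" "t \<le> T"
    and h: "bdd_meas r h" and h': "bdd_meas r h'"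
  shows "has_bochner_integral M (\<lambda>\<omega>. (h \<omega> \<bullet> inc p q \<omega>) * (h' \<omega> \<bullet> inc r t \<omega>)) 0"
proof -
  have "has_bochner_integral M (\<lambda>\<omega>. \<Sum>b\<in>UNIV. ((h \<omega> \<bullet> inc p q \<omega>) * h' \<omega> $ b) * inc r t \<omega> $ b) (\<Sum>b\<in>(UNIV :: 'd set). 0)"
  proof (rule has_bochner_integral_sum)
    fix b :: 'd
    let ?Z = "\<lambda>\<omega>. (h \<omega> \<bullet> inc p q \<omega>) * h' \<omega> $ b"
    have Z: "?Z = (\<lambda>\<omega>. \<Sum>a\<in>UNIV. (h \<omega> $ a * h' \<omega> $ b) * inc p q \<omega> $ a)"
      by (auto simp: inner_vec_def sum_distrib_left sum_distrib_right mult_ac)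
    have "W q \<in> borel_measurable (F r)" "W p \<in> borel_measurable (F r)"
      using assms by (auto intro: W_measurable_F)
    then have "?Z \<in> borel_measurable (F r)"
      using h bdd_meas_nth[OF h', of b] unfolding bdd_meas_def
      by (intro borel_measurable_times borel_measurable_inner borel_measurable_diff) auto
    moreover have "integrable M ?Z"
      unfolding Z
    proof (rule Bochner_Integration.integrable_sum)
      fix a :: 'd
      have "bdd_meas r (\<lambda>\<omega>. h \<omega> $ a * h' \<omega> $ b)"
        using h h' by (intro bdd_meas_mult bdd_meas_nth)
      moreover have "integrable M (\<lambda>\<omega>. inc p q \<omega> $ a)"
        using inc_mean[of p q a] assms by (auto simp: has_bochner_integral_iff)
      ultimately show "integrable M (\<lambda>\<omega>. (h \<omega> $ a * h' \<omega> $ b) * inc p q \<omega> $ a)"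
        by (rule bdd_meas_integrable)
    qed
    ultimately have "has_bochner_integral M (\<lambda>\<omega>. ?Z \<omega> * (\<lambda>x. x $ b) (inc r t \<omega>)) (integral\<^sup>L M ?Z * 0)"
      using assms inc_mean[of r t b] by (intro has_bochner_integral_indep_inc) auto
    then show "has_bochner_integral M (\<lambda>\<omega>. ?Z \<omega> * inc r t \<omega> $ b) 0" by simp
  qed
  then show ?thesis
    by (simp add: inner_vec_def[of "h' _"] sum_distrib_left mult_ac)
qed

text \<open>The increment is independent of \<open>F r\<close> with covariance \<open>t - r\<close>
  times the identity, so only the diagonal of the double sum over coordinates survives.\<close>

lemma same_increment:
  assumes "0 \<le> r" "r \<le> t" "t \<le> T" and h: "bdd_meas r h" and h': "bdd_meas r h'"
  shows "has_bochner_integral M (\<lambda>\<omega>. (h \<omega> \<bullet> inc r t \<omega>) * (h' \<omega> \<bullet> inc r t \<omega>)) ((t - r) * (\<integral>\<omega>. h \<omega> \<bullet> h' \<omega> \<partial>M))"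
proof -
  let ?Z = "\<lambda>a b \<omega>. h \<omega> $ a * h' \<omega> $ b"
  have Z: "bdd_meas r (?Z a b)" for a b
    using h h' by (intro bdd_meas_mult bdd_meas_nth)
  have Zi: "integrable M (?Z a b)" for a b
    using bdd_meas_integrable[OF Z, of "\<lambda>_. 1"] by simp
  have "has_bochner_integral M (\<lambda>\<omega>. \<Sum>a\<in>UNIV. \<Sum>b\<in>UNIV. ?Z a b \<omega> * (\<lambda>x. x $ a * x $ b) (inc r t \<omega>))
     (\<Sum>a\<in>UNIV. \<Sum>b\<in>UNIV. integral\<^sup>L M (?Z a b) * (if a = b then t - r else 0))"
    using assms Z Zi inc_covariance[of r t]
    by (intro has_bochner_integral_sum has_bochner_integral_indep_inc) (auto simp: bdd_meas_def)
  moreover have "(\<Sum>a\<in>UNIV. \<Sum>b\<in>UNIV. integral\<^sup>L M (?Z a b) * (if a = b then t - r else 0)) = (t - r) * (\<Sum>a\<in>UNIV. integral\<^sup>L M (?Z a a))"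
  proof -
    have "integral\<^sup>L M (?Z a b) * (if a = b then t - r else 0) =
        (if a = b then (t - r) * integral\<^sup>L M (?Z a b) else 0)" for a b
      by simp
    then show ?thesis by (simp only: sum.delta' finite sum_distrib_left) (simp add: sum_distrib_left)
  qed
  moreover have "(\<Sum>a\<in>UNIV. integral\<^sup>L M (?Z a a)) = (\<integral>\<omega>. h \<omega> \<bullet> h' \<omega> \<partial>M)"
    unfolding inner_vec_def using Zi by (subst Bochner_Integration.integral_sum[symmetric]) auto
  moreover have "(\<Sum>a\<in>UNIV. \<Sum>b\<in>UNIV. ?Z a b \<omega> * (inc r t \<omega> $ a * inc r t \<omega> $ b)) =
      (h \<omega> \<bullet> inc r t \<omega>) * (h' \<omega> \<bullet> inc r t \<omega>)" for \<omega>
    unfolding inner_vec_def sum_product by (simp add: mult_ac)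
  ultimately show ?thesis
    by simp
qed

text \<open>The intervals are cut at \<open>c\<close> and at \<open>m = min b d\<close>. The common
  piece from \<open>c\<close> to \<open>m\<close> contributes by \<open>same_increment\<close>; the
  other pairs of pieces are separated in time and orthogonal by \<open>past_future\<close>.\<close>

lemma elementary_pair_aux:
  assumes "0 \<le> a" "a \<le> b" "b \<le> T" "a \<le> c" "c \<le> d" "d \<le> T"
    and h: "bdd_meas a h" and h': "bdd_meas c h'"
  shows "has_bochner_integral M (\<lambda>\<omega>. (h \<omega> \<bullet> inc a b \<omega>) * (h' \<omega> \<bullet> inc c d \<omega>))
    (max 0 (min b d - c) * (\<integral>\<omega>. h \<omega> \<bullet> h' \<omega> \<partial>M))"
proof (cases "b \<le> c")
  case True
  then show ?thesis
    using past_future[of a b c d h h'] assms bdd_meas_mono[OF h] by (simp add: max_absorb1)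
next
  case False
  define m where "m = min b d"
  have hc: "bdd_meas c h" using h assms(4) by (rule bdd_meas_mono)
  have m: "c \<le> m" "m \<le> b" "m \<le> d" using False assms by (auto simp: m_def)
  have hm: "bdd_meas m h" "bdd_meas m h'"
    using hc h' m by (auto intro: bdd_meas_mono)
  have 1: "has_bochner_integral M (\<lambda>\<omega>. (h \<omega> \<bullet> inc a c \<omega>) * (h' \<omega> \<bullet> inc c d \<omega>)) 0"
    using past_future[of a c c d h h'] assms hc by simp
  have 2: "has_bochner_integral M (\<lambda>\<omega>. (h \<omega> \<bullet> inc c m \<omega>) * (h' \<omega> \<bullet> inc c m \<omega>)) ((m - c) * (\<integral>\<omega>. h \<omega> \<bullet> h' \<omega> \<partial>M))"
    using same_increment[of c m h h'] assms hc m by simp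
  have 3: "has_bochner_integral M (\<lambda>\<omega>. (h \<omega> \<bullet> inc c m \<omega>) * (h' \<omega> \<bullet> inc m d \<omega>)) 0"
    using past_future[of c m m d h h'] assms hm m by simp
  have 4: "has_bochner_integral M (\<lambda>\<omega>. (h' \<omega> \<bullet> inc c m \<omega>) * (h \<omega> \<bullet> inc m b \<omega>)) 0"
    using past_future[of c m m b h' h] assms hm m by simp
  have eq: "(h \<omega> \<bullet> inc a b \<omega>) * (h' \<omega> \<bullet> inc c d \<omega>) =
      (h \<omega> \<bullet> inc a c \<omega>) * (h' \<omega> \<bullet> inc c d \<omega>) + (h \<omega> \<bullet> inc c m \<omega>) * (h' \<omega> \<bullet> inc c m \<omega>)
      + (h \<omega> \<bullet> inc c m \<omega>) * (h' \<omega> \<bullet> inc m d \<omega>) + (h' \<omega> \<bullet> inc c m \<omega>) * (h \<omega> \<bullet> inc m b \<omega>)" for \<omega>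
  proof -
    \<comment> \<open>Since \<open>m\<close> is \<open>b\<close> or \<open>d\<close>, one of the two
      remainders is empty.\<close>
    have "(h \<omega> \<bullet> inc m b \<omega>) * (h' \<omega> \<bullet> inc m d \<omega>) = 0"
      using m by (auto simp: m_def min_def)
    then show ?thesis by (simp add: inner_diff_right algebra_simps)
  qed
  have "has_bochner_integral M (\<lambda>\<omega>. (h \<omega> \<bullet> inc a b \<omega>) * (h' \<omega> \<bullet> inc c d \<omega>))
    (0 + (m - c) * (\<integral>\<omega>. h \<omega> \<bullet> h' \<omega> \<partial>M) + 0 + 0)"
    unfolding eq by (intro has_bochner_integral_add 1 2 3 4)
  then show ?thesis using m by (simp add: m_def max_def)
qed

lemma elementary_pair:
  assumes "0 \<le> a" "a \<le> b" "b \<le> T" "0 \<le> c" "c \<le> d" "d \<le> T"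
    and h: "bdd_meas a h" and h': "bdd_meas c h'"
  shows "has_bochner_integral M (\<lambda>\<omega>. (h \<omega> \<bullet> inc a b \<omega>) * (h' \<omega> \<bullet> inc c d \<omega>))
    (max 0 (min b d - max a c) * (\<integral>\<omega>. h \<omega> \<bullet> h' \<omega> \<partial>M))"
proof (cases "a \<le> c")
  case True
  then show ?thesis
    using elementary_pair_aux[of a b c d h h'] assms by (simp add: max_def)
next
  case False
  then show ?thesis
    using elementary_pair_aux[of c d a b h' h] assms
    by (simp add: max_absorb1 min.commute mult.commute inner_commute)
qed

end

section \<open>Mean square distance\<close>

text \<open>The squared \<open>L2\<close> distance, with values in \<open>ennreal\<close> so that it
  makes sense before integrability is known. It is used on the probability space and on time times
  probability space, which turns the isometry into an equation between two instances.\<close>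

definition sq_dist :: "'a measure \<Rightarrow> ('a \<Rightarrow> 'b::real_normed_vector) \<Rightarrow> ('a \<Rightarrow> 'b) \<Rightarrow> ennreal" where
  "sq_dist M f g = (\<integral>\<^sup>+x. ennreal ((norm (f x - g x))\<^sup>2) \<partial>M)"

lemma sq_dist_commute: "sq_dist M f g = sq_dist M g f"
  by (simp add: sq_dist_def norm_minus_commute)

lemma sq_dist_triangle:
  fixes f g k :: "'a \<Rightarrow> 'b::{real_normed_vector, second_countable_topology}"
  assumes [measurable]: "f \<in> borel_measurable M" "g \<in> borel_measurable M" "k \<in> borel_measurable M"
  shows "sq_dist M f g \<le> 2 * (sq_dist M f k + sq_dist M k g)"
proof -
  have "sq_dist M f g \<le> (\<integral>\<^sup>+x. 2 * (ennreal ((norm (f x - k x))\<^sup>2) + ennreal ((norm (k x - g x))\<^sup>2)) \<partial>M)"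
    unfolding sq_dist_def
  proof (rule nn_integral_mono)
    fix x
    let ?a = "norm (f x - k x)" and ?b = "norm (k x - g x)"
    have "norm (f x - g x) \<le> ?a + ?b"
      using norm_triangle_ineq[of "f x - k x" "k x - g x"] by simp
    then have "(norm (f x - g x))\<^sup>2 \<le> (?a + ?b)\<^sup>2" by (intro power_mono) auto
    also have "\<dots> \<le> 2 * (?a\<^sup>2 + ?b\<^sup>2)"
      using sum_squares_bound[of ?a ?b] by (simp add: power2_sum)
    finally have "ennreal ((norm (f x - g x))\<^sup>2) \<le> ennreal (2 * (?a\<^sup>2 + ?b\<^sup>2))" by (rule ennreal_leI)
    also have "\<dots> = 2 * (ennreal (?a\<^sup>2) + ennreal (?b\<^sup>2))"
      by (simp add: ennreal_mult)
    finally show "ennreal ((norm (f x - g x))\<^sup>2) \<le> 2 * (ennreal (?a\<^sup>2) + ennreal (?b\<^sup>2))" .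
  qed
  also have "\<dots> = 2 * (sq_dist M f k + sq_dist M k g)"
    unfolding sq_dist_def by (simp add: nn_integral_cmult nn_integral_add)
  finally show ?thesis .
qed

lemma sq_dist_tendsto_triangle:
  fixes f g k :: "nat \<Rightarrow> 'a \<Rightarrow> 'b::{real_normed_vector, second_countable_topology}"
  assumes "\<And>m. f m \<in> borel_measurable M" "\<And>m. g m \<in> borel_measurable M" "\<And>m. k m \<in> borel_measurable M"
    and "(\<lambda>m. sq_dist M (f m) (k m)) \<longlonglongrightarrow> 0" "(\<lambda>m. sq_dist M (k m) (g m)) \<longlonglongrightarrow> 0"
  shows "(\<lambda>m. sq_dist M (f m) (g m)) \<longlonglongrightarrow> 0"
proof (rule tendsto_sandwich[OF _ _ tendsto_const])
  have "(\<lambda>m. 2 * (sq_dist M (f m) (k m) + sq_dist M (k m) (g m))) \<longlonglongrightarrow> 2 * (0 + 0)"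
    by (intro tendsto_add ennreal_tendsto_cmult assms) auto
  then show "(\<lambda>m. 2 * (sq_dist M (f m) (k m) + sq_dist M (k m) (g m))) \<longlonglongrightarrow> 0" by simp
  show "\<forall>\<^sub>F m in sequentially. sq_dist M (f m) (g m) \<le> 2 * (sq_dist M (f m) (k m) + sq_dist M (k m) (g m))"
    using assms(1-3) by (intro always_eventually allI sq_dist_triangle)
qed simp

text \<open>From \<open>\<bar>x\<bar> \<le> e + x\<^sup>2 / e\<close>. This passes from mean square
  to \<open>L1\<close> convergence, from which almost everywhere convergent subsequences are
  extracted.\<close>

lemma (in prob_space) L1_le_sq_dist:
  fixes f g :: "'a \<Rightarrow> real"
  assumes [measurable]: "f \<in> borel_measurable M" "g \<in> borel_measurable M" and e: "e > 0"
    and "sq_dist M f g \<le> ennreal (e\<^sup>2)"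
  shows "integrable M (\<lambda>x. f x - g x)" "(\<integral>x. norm (f x - g x) \<partial>M) \<le> 2 * e"
proof -
  have "(\<integral>\<^sup>+x. ennreal \<bar>f x - g x\<bar> \<partial>M) \<le> (\<integral>\<^sup>+x. ennreal e + ennreal (1 / e) * ennreal ((norm (f x - g x))\<^sup>2) \<partial>M)"
  proof (rule nn_integral_mono)
    fix x
    have "\<bar>f x - g x\<bar> * e \<le> e\<^sup>2 + (f x - g x)\<^sup>2"
      using sum_squares_bound[of "\<bar>f x - g x\<bar>" e] mult_nonneg_nonneg[OF abs_ge_zero[of "f x - g x"], of e] e
      unfolding power2_abs by linarith
    then have "\<bar>f x - g x\<bar> \<le> e + 1 / e * (norm (f x - g x))\<^sup>2"
      using e by (simp add: field_simps power2_eq_square)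
    then show "ennreal \<bar>f x - g x\<bar> \<le> ennreal e + ennreal (1 / e) * ennreal ((norm (f x - g x))\<^sup>2)"
      using e by (simp add: ennreal_mult'[symmetric] ennreal_plus[symmetric] del: ennreal_plus)
  qed
  also have "\<dots> = ennreal e + ennreal (1 / e) * sq_dist M f g"
    unfolding sq_dist_def by (simp add: nn_integral_add nn_integral_cmult emeasure_space_1)
  also have "\<dots> \<le> ennreal e + ennreal (1 / e) * ennreal (e\<^sup>2)"
    using assms by (intro add_left_mono mult_left_mono) auto
  also have "\<dots> = ennreal (2 * e)"
    using e by (simp add: ennreal_mult'[symmetric] ennreal_plus[symmetric] power2_eq_square del: ennreal_plus)
  finally have le: "(\<integral>\<^sup>+x. ennreal \<bar>f x - g x\<bar> \<partial>M) \<le> ennreal (2 * e)" .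
  then show int: "integrable M (\<lambda>x. f x - g x)"
    by (intro integrableI_bounded) (auto intro: le_less_trans)
  show "(\<integral>x. norm (f x - g x) \<partial>M) \<le> 2 * e"
    using le nn_integral_eq_integral[OF integrable_norm[OF int]] e by simp
qed

lemma (in prob_space) sq_dist_AE_subseq:
  fixes f :: "nat \<Rightarrow> 'a \<Rightarrow> real"
  assumes f: "\<And>m. f m \<in> borel_measurable M" and Y: "Y \<in> borel_measurable M"
    and lim: "(\<lambda>m. sq_dist M (f m) Y) \<longlonglongrightarrow> 0"
  shows "\<exists>r :: nat \<Rightarrow> nat. AE x in M. (\<lambda>k. f (r k) x) \<longlonglongrightarrow> Y x"
proof -
  have small: "\<exists>n. \<forall>m\<ge>n. sq_dist M (f m) Y \<le> ennreal (e\<^sup>2)" if "0 < e" for e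
  proof -
    have "0 < ennreal (e\<^sup>2)" using that unfolding ennreal_less_zero_iff by simp
    from order_tendstoD(2)[OF lim this] show ?thesis
      unfolding eventually_sequentially using less_imp_le by blast
  qed
  \<comment> \<open>From index \<open>n\<close> on the distance to \<open>Y\<close> is finite, hence
    the differences are integrable; the sequence is shifted by \<open>n\<close> accordingly.\<close>
  obtain n where n: "\<And>m. m \<ge> n \<Longrightarrow> sq_dist M (f m) Y \<le> ennreal (1\<^sup>2)" using small[of 1] by auto
  have "(\<lambda>m. \<integral>x. norm (f (m + n) x - Y x) \<partial>M) \<longlonglongrightarrow> 0"
  proof (rule LIMSEQ_I)
    fix e :: real assume e: "0 < e"
    then obtain k where k: "\<And>m. m \<ge> k \<Longrightarrow> sq_dist M (f m) Y \<le> ennreal ((e / 4)\<^sup>2)" using small[of "e / 4"] by auto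
    have "norm ((\<integral>x. norm (f (m + n) x - Y x) \<partial>M) - 0) < e" if "m \<ge> k" for m
      using L1_le_sq_dist(2)[OF f Y _ k, of "m + n"] that e by simp
    then show "\<exists>k. \<forall>m\<ge>k. norm ((\<integral>x. norm (f (m + n) x - Y x) \<partial>M) - 0) < e" by blast
  qed
  from tendsto_L1_AE_subseq[OF L1_le_sq_dist(1)[OF f Y zero_less_one n[OF le_add2]] this]
  obtain r :: "nat \<Rightarrow> nat" where "AE x in M. (\<lambda>k. f (r k + n) x - Y x) \<longlonglongrightarrow> 0" by blast
  then have "AE x in M. (\<lambda>k. f (r k + n) x) \<longlonglongrightarrow> Y x" by (simp add: LIM_zero_iff)
  then show ?thesis by (intro exI[of _ "\<lambda>k. r k + n"])
qed

text \<open>The Riesz-Fischer argument: a subsequence converges almost everywhere, and Fatou's lemma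
  along it carries the Cauchy bound over to the distance from the limit.\<close>

lemma (in prob_space) sq_dist_complete:
  fixes f :: "nat \<Rightarrow> 'a \<Rightarrow> real"
  assumes [measurable]: "\<And>m. f m \<in> borel_measurable M"
    and Cauchy: "\<And>e :: real. e > 0 \<Longrightarrow> \<exists>n0. \<forall>m\<ge>n0. \<forall>n\<ge>n0. sq_dist M (f m) (f n) \<le> ennreal e"
  shows "\<exists>Y\<in>borel_measurable M. (\<lambda>m. sq_dist M (f m) Y) \<longlonglongrightarrow> 0"
proof -
  obtain n where n: "\<And>i j. i \<ge> n \<Longrightarrow> j \<ge> n \<Longrightarrow> sq_dist M (f i) (f j) \<le> ennreal (1\<^sup>2)"
    using Cauchy[of 1] by auto
  have "\<exists>k. \<forall>i\<ge>k. \<forall>j\<ge>k. (\<integral>x. norm ((f (i + n) x - f n x) - (f (j + n) x - f n x)) \<partial>M) < e" if e: "0 < e" for e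
  proof -
    obtain k where k: "\<And>i j. i \<ge> k \<Longrightarrow> j \<ge> k \<Longrightarrow> sq_dist M (f i) (f j) \<le> ennreal ((e / 4)\<^sup>2)"
      using Cauchy[of "(e / 4)\<^sup>2"] e by auto
    have "(\<integral>x. norm ((f (i + n) x - f n x) - (f (j + n) x - f n x)) \<partial>M) < e" if "i \<ge> k" "j \<ge> k" for i j
      using L1_le_sq_dist(2)[OF assms(1) assms(1) _ k, of "i + n" "j + n"] that e by simp
    then show ?thesis by blast
  qed
  from cauchy_L1_AE_cauchy_subseq[OF L1_le_sq_dist(1)[OF assms(1) assms(1) zero_less_one n[OF le_add2 order_refl]] this]
  obtain q where q: "strict_mono q" and qC: "AE x in M. Cauchy (\<lambda>i. f (q i + n) x - f n x)" by blast
  from qC have conv: "AE x in M. convergent (\<lambda>k. f (q k + n) x)"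
  proof eventually_elim
    case (elim x)
    then obtain y where "(\<lambda>i. f (q i + n) x - f n x) \<longlonglongrightarrow> y" by (auto simp: Cauchy_convergent_iff convergent_def)
    from tendsto_add[OF this tendsto_const[of "f n x"]] show ?case by (auto simp: convergent_def)
  qed
  define r where "r k = q k + n" for k
  have rk: "k \<le> r k" for k using strict_mono_imp_increasing[OF q, of k] by (simp add: r_def)
  define Y where "Y x = lim (\<lambda>k. f (r k) x)" for x
  have [measurable]: "Y \<in> borel_measurable M" unfolding Y_def by measurable
  have Y: "AE x in M. (\<lambda>k. f (r k) x) \<longlonglongrightarrow> Y x"
    using conv by eventually_elim (simp add: Y_def r_def convergent_LIMSEQ_iff)
  have "(\<lambda>m. sq_dist M (f m) Y) \<longlonglongrightarrow> 0"
  proof (rule order_tendstoI)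
    fix e :: ennreal assume "0 < e"
    from dense[OF this] obtain z where z: "0 < z" "z < e" by auto
    \<comment> \<open>A finite positive level below \<open>e\<close>, which may itself be
      infinite.\<close>
    define e' where "e' = enn2real z"
    have "z < top" by (rule order.strict_trans2[OF z(2) top_greatest])
    then have e': "e' > 0" "ennreal e' < e"
      using z unfolding e'_def by (simp_all only: enn2real_positive_iff ennreal_enn2real)
    obtain n0 where n0: "\<And>m n. m \<ge> n0 \<Longrightarrow> n \<ge> n0 \<Longrightarrow> sq_dist M (f m) (f n) \<le> ennreal e'"
      using Cauchy[OF e'(1)] by blast
    have "sq_dist M (f m) Y \<le> ennreal e'" if m: "m \<ge> n0" for m
    proof -
      have "sq_dist M (f m) Y = (\<integral>\<^sup>+x. liminf (\<lambda>k. ennreal ((norm (f m x - f (r k) x))\<^sup>2)) \<partial>M)"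
        unfolding sq_dist_def
      proof (rule nn_integral_cong_AE)
        show "AE x in M. ennreal ((norm (f m x - Y x))\<^sup>2) = liminf (\<lambda>k. ennreal ((norm (f m x - f (r k) x))\<^sup>2))"
          using Y
        proof eventually_elim
          case (elim x)
          then have "(\<lambda>k. ennreal ((norm (f m x - f (r k) x))\<^sup>2)) \<longlonglongrightarrow> ennreal ((norm (f m x - Y x))\<^sup>2)"
            by (intro tendsto_ennrealI tendsto_power tendsto_norm tendsto_diff tendsto_const)
          from lim_imp_Liminf[OF sequentially_bot this] show ?case by (rule sym)
        qed
      qed
      also have "\<dots> \<le> liminf (\<lambda>k. sq_dist M (f m) (f (r k)))"
        unfolding sq_dist_def by (rule nn_integral_liminf) simp
      also have "\<dots> \<le> ennreal e'"
      proof (rule Liminf_le)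
        show "\<forall>\<^sub>F k in sequentially. sq_dist M (f m) (f (r k)) \<le> ennreal e'"
          using eventually_ge_at_top[of n0]
        proof eventually_elim
          case (elim k)
          show ?case by (rule n0[OF m order_trans[OF elim rk]])
        qed
      qed simp
      finally show ?thesis .
    qed
    then show "\<forall>\<^sub>F m in sequentially. sq_dist M (f m) Y < e"
      using le_less_trans[OF _ e'(2)] by (intro eventually_sequentiallyI[of n0]) simp
  qed (simp add: not_less_zero)
  then show ?thesis using \<open>Y \<in> borel_measurable M\<close> by blast
qed

section \<open>The Ito isometry\<close>

lemma stepwise_mono:
  fixes \<tau> :: "nat \<Rightarrow> real"
  assumes "\<And>k. k < n \<Longrightarrow> \<tau> k \<le> \<tau> (Suc k)" "k \<le> l" "l \<le> n"
  shows "\<tau> k \<le> \<tau> l"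
  using assms(2,3)
proof (induction l)
  case (Suc l)
  then show ?case using assms(1)[of l] by (cases "k = Suc l") auto
qed simp

lemma bilinear_expand_sum:
  fixes v :: "'k \<Rightarrow> 'v::real_inner"
  shows "(norm (\<Sum>k\<in>K. v k))\<^sup>2 = (\<Sum>k\<in>K. \<Sum>l\<in>K. v k \<bullet> v l)"
  unfolding power2_norm_eq_inner inner_sum_left inner_sum_right by (rule sum.swap)

context brownian
begin

definition elementary :: "'k set \<Rightarrow> ('k \<Rightarrow> real) \<Rightarrow> ('k \<Rightarrow> real) \<Rightarrow> ('k \<Rightarrow> 'a \<Rightarrow> real ^ 'd) \<Rightarrow> bool" where
  "elementary K a b h \<longleftrightarrow> finite K \<and> (\<forall>k\<in>K. 0 \<le> a k \<and> a k \<le> b k \<and> b k \<le> T \<and> bdd_meas (a k) (h k))"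

text \<open>Both sides expand into the same double sum, weighted by the length \<open>ov\<close> of
  the overlap of two intervals: on the left by \<open>elementary_pair\<close>, on the right because
  the product of two interval indicators is the indicator of the intersection.\<close>

lemma elementary_isometry:
  assumes el: "elementary K a b h"
  shows "(\<integral>\<^sup>+\<omega>. ennreal ((\<Sum>k\<in>K. h k \<omega> \<bullet> inc (a k) (b k) \<omega>)\<^sup>2) \<partial>M) =
    (\<integral>\<^sup>+\<omega>. (\<integral>\<^sup>+t\<in>{0..T}. ennreal ((norm (\<Sum>k\<in>K. indicator {a k<..b k} t *\<^sub>R h k \<omega>))\<^sup>2) \<partial>lborel) \<partial>M)"
proof -
  have fin: "finite K" and ab: "\<And>k. k \<in> K \<Longrightarrow> 0 \<le> a k \<and> a k \<le> b k \<and> b k \<le> T"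
    and bm: "\<And>k. k \<in> K \<Longrightarrow> bdd_meas (a k) (h k)"
    using el by (auto simp: elementary_def)
  define ov where "ov k l = max 0 (min (b k) (b l) - max (a k) (a l))" for k l
  have hi: "integrable M (\<lambda>\<omega>. h k \<omega> \<bullet> h l \<omega>)" if "k \<in> K" "l \<in> K" for k l
  proof -
    have T: "bdd_meas T (h k)" "bdd_meas T (h l)"
      using bm[OF that(1)] bm[OF that(2)] ab[OF that(1)] ab[OF that(2)] by (auto elim!: bdd_meas_mono)
    have "integrable M (\<lambda>\<omega>. \<Sum>i\<in>UNIV. h k \<omega> $ i * h l \<omega> $ i)"
    proof (rule Bochner_Integration.integrable_sum)
      fix i show "integrable M (\<lambda>\<omega>. h k \<omega> $ i * h l \<omega> $ i)"
        using bdd_meas_integrable[OF bdd_meas_mult[OF bdd_meas_nth[OF T(1)] bdd_meas_nth[OF T(2)]], of "\<lambda>_. 1"]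
        by simp
    qed
    then show ?thesis by (simp add: inner_vec_def)
  qed
  have L: "has_bochner_integral M (\<lambda>\<omega>. (\<Sum>k\<in>K. h k \<omega> \<bullet> inc (a k) (b k) \<omega>)\<^sup>2)
      (\<Sum>k\<in>K. \<Sum>l\<in>K. ov k l * (\<integral>\<omega>. h k \<omega> \<bullet> h l \<omega> \<partial>M))"
    unfolding power2_eq_square sum_product ov_def
    by (intro has_bochner_integral_sum elementary_pair) (use ab bm in blast)+
  have R: "(\<integral>\<^sup>+t\<in>{0..T}. ennreal ((norm (\<Sum>k\<in>K. indicator {a k<..b k} t *\<^sub>R h k \<omega>))\<^sup>2) \<partial>lborel)
      = ennreal (\<Sum>k\<in>K. \<Sum>l\<in>K. ov k l * (h k \<omega> \<bullet> h l \<omega>))"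
    and R0: "0 \<le> (\<Sum>k\<in>K. \<Sum>l\<in>K. ov k l * (h k \<omega> \<bullet> h l \<omega>))" for \<omega>
  proof -
    let ?f = "\<lambda>t. (norm (\<Sum>k\<in>K. indicator {a k<..b k} t *\<^sub>R h k \<omega>))\<^sup>2 * indicator {0..T} t"
    have "?f t = (\<Sum>k\<in>K. \<Sum>l\<in>K. indicator {max (a k) (a l)<..min (b k) (b l)} t * (h k \<omega> \<bullet> h l \<omega>))" for t
    proof -
      have "(indicator {a k<..b k} t *\<^sub>R h k \<omega>) \<bullet> (indicator {a l<..b l} t *\<^sub>R h l \<omega>) * indicator {0..T} t =
        indicator {max (a k) (a l)<..min (b k) (b l)} t * (h k \<omega> \<bullet> h l \<omega>)" if "k \<in> K" "l \<in> K" for k l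
        using ab[OF that(1)] ab[OF that(2)] by (auto simp: indicator_def)
      then show ?thesis
        unfolding bilinear_expand_sum sum_distrib_right by (intro sum.cong) auto
    qed
    moreover have "has_bochner_integral lborel (\<lambda>t. \<Sum>k\<in>K. \<Sum>l\<in>K. indicator {max (a k) (a l)<..min (b k) (b l)} t * (h k \<omega> \<bullet> h l \<omega>))
      (\<Sum>k\<in>K. \<Sum>l\<in>K. ov k l * (h k \<omega> \<bullet> h l \<omega>))"
    proof (intro has_bochner_integral_sum has_bochner_integral_mult_left)
      fix k l assume "k \<in> K" "l \<in> K"
      have "measure lborel {max (a k) (a l)<..min (b k) (b l)} = ov k l"
        unfolding ov_def by (cases "max (a k) (a l) \<le> min (b k) (b l)") auto
      moreover have "has_bochner_integral lborel (indicator {max (a k) (a l)<..min (b k) (b l)} :: real \<Rightarrow> real)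
          (measure lborel {max (a k) (a l)<..min (b k) (b l)})"
      proof (rule has_bochner_integral_real_indicator)
        show "emeasure lborel {max (a k) (a l)<..min (b k) (b l)} < \<infinity>"
          by (cases "max (a k) (a l) \<le> min (b k) (b l)") auto
      qed simp
      ultimately show "has_bochner_integral lborel (indicator {max (a k) (a l)<..min (b k) (b l)} :: real \<Rightarrow> real) (ov k l)"
        by simp
    qed
    ultimately have f: "has_bochner_integral lborel ?f (\<Sum>k\<in>K. \<Sum>l\<in>K. ov k l * (h k \<omega> \<bullet> h l \<omega>))"
      by simp
    have "(\<integral>\<^sup>+t. ennreal (?f t) \<partial>lborel) = ennreal (\<Sum>k\<in>K. \<Sum>l\<in>K. ov k l * (h k \<omega> \<bullet> h l \<omega>))"
      using f by (subst nn_integral_eq_integral) (auto simp: has_bochner_integral_iff)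
    then show "(\<integral>\<^sup>+t\<in>{0..T}. ennreal ((norm (\<Sum>k\<in>K. indicator {a k<..b k} t *\<^sub>R h k \<omega>))\<^sup>2) \<partial>lborel)
      = ennreal (\<Sum>k\<in>K. \<Sum>l\<in>K. ov k l * (h k \<omega> \<bullet> h l \<omega>))"
      by (simp add: ennreal_mult' ennreal_indicator)
    show "0 \<le> (\<Sum>k\<in>K. \<Sum>l\<in>K. ov k l * (h k \<omega> \<bullet> h l \<omega>))"
      unfolding has_bochner_integral_integral_eq[OF f, symmetric] by (rule Bochner_Integration.integral_nonneg) simp
  qed
  have "(\<integral>\<^sup>+\<omega>. ennreal ((\<Sum>k\<in>K. h k \<omega> \<bullet> inc (a k) (b k) \<omega>)\<^sup>2) \<partial>M) =
      ennreal (\<Sum>k\<in>K. \<Sum>l\<in>K. ov k l * (\<integral>\<omega>. h k \<omega> \<bullet> h l \<omega> \<partial>M))"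
    using L by (subst nn_integral_eq_integral) (auto simp: has_bochner_integral_iff)
  also have "\<dots> = (\<integral>\<^sup>+\<omega>. ennreal (\<Sum>k\<in>K. \<Sum>l\<in>K. ov k l * (h k \<omega> \<bullet> h l \<omega>)) \<partial>M)"
    using hi R0 by (subst nn_integral_eq_integral) auto
  finally show ?thesis by (simp add: R)
qed

end

section \<open>Existence and uniqueness of the Ito integral\<close>

text \<open>The equidistant grid of \<open>[0, T]\<close> with \<open>m + 1\<close> cells, so that
  every \<open>m\<close>, including \<open>0\<close>, gives a partition.\<close>

definition riemann_step :: "real \<Rightarrow> nat \<Rightarrow> nat \<Rightarrow> real" where
  "riemann_step T m k = T * real k / real (Suc m)"

context brownian
begin

abbreviation dt_dP :: "(real \<times> 'a) measure" where
  "dt_dP \<equiv> restrict_space lborel {0..T} \<Otimes>\<^sub>M M"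

lemma sets_dt_dP: "sets dt_dP = sets (restrict_space borel {0..T} \<Otimes>\<^sub>M M)"
  by (intro sets_pair_measure_cong sets_restrict_space_cong) auto

lemma space_dt_dP: "space dt_dP = {0..T} \<times> space M"
  by (simp add: space_pair_measure space_restrict_space)

lemma measurable_dt_dP: "f \<in> borel_measurable dt_dP \<longleftrightarrow> f \<in> borel_measurable (restrict_space borel {0..T} \<Otimes>\<^sub>M M)"
  by (rule measurable_cong_sets[OF sets_dt_dP refl, THEN arg_cong2[where f = "(\<in>)", OF refl]])

lemma pair_sigma: "pair_sigma_finite (restrict_space lborel {0..T}) M"
  using sigma_finite_measure_restrict_space[OF sigma_finite_lborel, of "{0..T}"]
  by (simp add: pair_sigma_finite_def sigma_finite_measure_axioms)

text \<open>By Tonelli the iterated integral in \<open>has_ito_integral\<close> is an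
  \<open>L2\<close> distance on the product space, where the triangle inequality is at hand.\<close>

lemma sq_dist_dt_dP:
  fixes f g :: "real \<Rightarrow> 'a \<Rightarrow> real ^ 'd"
  assumes [measurable]: "case_prod f \<in> borel_measurable dt_dP" "case_prod g \<in> borel_measurable dt_dP"
  shows "sq_dist dt_dP (case_prod f) (case_prod g) =
    (\<integral>\<^sup>+\<omega>. (\<integral>\<^sup>+t\<in>{0..T}. ennreal ((norm (f t \<omega> - g t \<omega>))\<^sup>2) \<partial>lborel) \<partial>M)"
proof -
  interpret P: pair_sigma_finite "restrict_space lborel {0..T}" M by (rule pair_sigma)
  have "sq_dist dt_dP (case_prod f) (case_prod g) =
      (\<integral>\<^sup>+p. ennreal ((norm (case_prod f p - case_prod g p))\<^sup>2) \<partial>dt_dP)"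
    by (simp add: sq_dist_def)
  also have "\<dots> = (\<integral>\<^sup>+\<omega>. \<integral>\<^sup>+t. ennreal ((norm (f t \<omega> - g t \<omega>))\<^sup>2) \<partial>restrict_space lborel {0..T} \<partial>M)"
    by (subst P.nn_integral_snd[symmetric]) auto
  also have "\<dots> = (\<integral>\<^sup>+\<omega>. (\<integral>\<^sup>+t\<in>{0..T}. ennreal ((norm (f t \<omega> - g t \<omega>))\<^sup>2) \<partial>lborel) \<partial>M)"
    by (simp add: nn_integral_restrict_space)
  finally show ?thesis .
qed

lemma fst_measurable_dt_dP: "fst \<in> borel_measurable dt_dP"
proof -
  have "(\<lambda>x :: real. x) \<in> borel_measurable (restrict_space lborel {0..T})"
    by (intro measurable_restrict_space1) simp
  then show ?thesis by (rule measurable_compose[OF measurable_fst])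
qed

lemma simple_process_measurable:
  assumes "simple_integrand F T n \<tau> h"
  shows "case_prod (simple_process n \<tau> h) \<in> borel_measurable dt_dP"
proof -
  have [measurable]: "h k \<in> borel_measurable M" if "k < n" for k
    using assms that by (auto simp: simple_integrand_def intro: measurable_F)
  note [measurable] = fst_measurable_dt_dP
  have "(\<lambda>p. \<Sum>k<n. indicator {\<tau> k<..\<tau> (Suc k)} (fst p) *\<^sub>R h k (snd p)) \<in> borel_measurable dt_dP"
    by (intro borel_measurable_sum) measurable
  then show ?thesis by (simp add: simple_process_def split_beta')
qed

lemma simple_integrand_elementary:
  assumes "simple_integrand F T n \<tau> h"
  shows "elementary {..<n} \<tau> (\<lambda>k. \<tau> (Suc k)) h"
proof -
  have mono: "\<tau> k \<le> \<tau> l" if "k \<le> l" "l \<le> n" for k l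
    using assms stepwise_mono[OF _ that] by (simp add: simple_integrand_def)
  have "0 \<le> \<tau> k" "\<tau> (Suc k) \<le> T" if "k < n" for k
  proof -
    have "\<tau> 0 \<le> \<tau> k" "\<tau> (Suc k) \<le> \<tau> n" using mono that by simp_all
    then show "0 \<le> \<tau> k" "\<tau> (Suc k) \<le> T" using assms by (simp_all add: simple_integrand_def)
  qed
  then show ?thesis
    using assms by (auto simp: elementary_def simple_integrand_def bdd_meas_def)
qed

lemma simple_integral_measurable:
  assumes "simple_integrand F T n \<tau> h"
  shows "simple_integral W n \<tau> h \<in> borel_measurable M"
proof -
  have "h k \<in> borel_measurable M \<and> inc (\<tau> k) (\<tau> (Suc k)) \<in> borel_measurable M" if "k < n" for k
    using simple_integrand_elementary[OF assms] that
    by (auto simp: elementary_def bdd_meas_def intro!: inc_measurable intro: measurable_F)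
  then show ?thesis
    unfolding simple_integral_def[abs_def] by (intro borel_measurable_sum borel_measurable_inner) auto
qed

text \<open>The difference of two simple processes over different partitions is again a finite
  combination of elementary ones, over overlapping intervals.\<close>

lemma simple_isometry:
  assumes h: "simple_integrand F T n \<tau> h" and h': "simple_integrand F T n' \<tau>' h'"
  shows "sq_dist M (simple_integral W n \<tau> h) (simple_integral W n' \<tau>' h') =
    sq_dist dt_dP (case_prod (simple_process n \<tau> h)) (case_prod (simple_process n' \<tau>' h'))"
proof -
  define K where "K = {..<n} <+> {..<n'}"
  define a where "a = case_sum \<tau> \<tau>'"
  define b where "b = case_sum (\<lambda>k. \<tau> (Suc k)) (\<lambda>k. \<tau>' (Suc k))"
  define H where "H = case_sum h (\<lambda>k \<omega>. - h' k \<omega>)"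
  have el: "elementary K a b H"
    using simple_integrand_elementary[OF h] simple_integrand_elementary[OF h']
    by (auto simp: elementary_def K_def a_def b_def H_def bdd_meas_uminus)
  have 1: "(\<Sum>k\<in>K. H k \<omega> \<bullet> inc (a k) (b k) \<omega>) = simple_integral W n \<tau> h \<omega> - simple_integral W n' \<tau>' h' \<omega>" for \<omega>
    unfolding K_def by (subst sum.Plus) (auto simp: a_def b_def H_def simple_integral_def sum_negf)
  have 2: "(\<Sum>k\<in>K. indicator {a k<..b k} t *\<^sub>R H k \<omega>) = simple_process n \<tau> h t \<omega> - simple_process n' \<tau>' h' t \<omega>" for t \<omega>
    unfolding K_def by (subst sum.Plus) (auto simp: a_def b_def H_def simple_process_def sum_negf)
  have "sq_dist M (simple_integral W n \<tau> h) (simple_integral W n' \<tau>' h') =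
      (\<integral>\<^sup>+\<omega>. ennreal ((\<Sum>k\<in>K. H k \<omega> \<bullet> inc (a k) (b k) \<omega>)\<^sup>2) \<partial>M)"
    unfolding 1 sq_dist_def real_norm_def power2_abs ..
  also note elementary_isometry[OF el, unfolded 2]
  also note sq_dist_dt_dP[OF simple_process_measurable[OF h] simple_process_measurable[OF h'], symmetric]
  finally show ?thesis .
qed

lemma has_ito_integral_iff:
  "has_ito_integral M F T W \<xi> Y \<longleftrightarrow>
     (case_prod \<xi>) \<in> borel_measurable dt_dP \<and> Y \<in> borel_measurable M \<and>
     (\<exists>n \<tau> h. (\<forall>m. simple_integrand F T (n m) (\<tau> m) (h m)) \<and>
        (\<lambda>m. sq_dist dt_dP (case_prod \<xi>) (case_prod (simple_process (n m) (\<tau> m) (h m)))) \<longlonglongrightarrow> 0 \<and>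
        (\<lambda>m. sq_dist M Y (simple_integral W (n m) (\<tau> m) (h m))) \<longlonglongrightarrow> 0)"
proof -
  have 1: "(\<lambda>m. \<integral>\<^sup>+\<omega>. (\<integral>\<^sup>+t\<in>{0..T}.
            ennreal ((norm (\<xi> t \<omega> - simple_process (n m) (\<tau> m) (h m) t \<omega>))\<^sup>2) \<partial>lborel) \<partial>M) \<longlonglongrightarrow> 0 \<longleftrightarrow>
        (\<lambda>m. sq_dist dt_dP (case_prod \<xi>) (case_prod (simple_process (n m) (\<tau> m) (h m)))) \<longlonglongrightarrow> 0"
    if "case_prod \<xi> \<in> borel_measurable dt_dP" "\<forall>m. simple_integrand F T (n m) (\<tau> m) (h m)" for n \<tau> h
    unfolding sq_dist_dt_dP[OF that(1) simple_process_measurable[OF that(2)[rule_format]]] ..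
  have 2: "(\<lambda>m. \<integral>\<^sup>+\<omega>. ennreal ((Y \<omega> - simple_integral W (n m) (\<tau> m) (h m) \<omega>)\<^sup>2) \<partial>M) \<longlonglongrightarrow> 0 \<longleftrightarrow>
      (\<lambda>m. sq_dist M Y (simple_integral W (n m) (\<tau> m) (h m))) \<longlonglongrightarrow> 0" for n \<tau> h
    unfolding sq_dist_def real_norm_def power2_abs ..
  show ?thesis
    unfolding has_ito_integral_def measurable_dt_dP[symmetric]
  proof (intro conj_cong ex_cong1)
  qed (rule refl, rule refl, rule refl, erule 1, assumption, rule 2)
qed

text \<open>Two approximations of \<open>\<xi>\<close> by simple processes are eventually close to
  each other, hence by the isometry so are their integrals. Thus any version \<open>Y\<close>, in
  particular the one that \<open>SOME\<close> picks in \<open>ito_integral\<close>, is reached along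
  every approximating sequence.\<close>

lemma has_ito_integral_limit:
  assumes Y: "has_ito_integral M F T W \<xi> Y"
    and s: "\<And>m. simple_integrand F T (n m) (\<tau> m) (h m)"
    and lim: "(\<lambda>m. sq_dist dt_dP (case_prod \<xi>) (case_prod (simple_process (n m) (\<tau> m) (h m)))) \<longlonglongrightarrow> 0"
  shows "(\<lambda>m. sq_dist M (simple_integral W (n m) (\<tau> m) (h m)) Y) \<longlonglongrightarrow> 0"
proof -
  from Y obtain n' \<tau>' h' where [measurable]: "case_prod \<xi> \<in> borel_measurable dt_dP" "Y \<in> borel_measurable M"
    and s': "\<And>m. simple_integrand F T (n' m) (\<tau>' m) (h' m)"
    and \<xi>: "(\<lambda>m. sq_dist dt_dP (case_prod \<xi>) (case_prod (simple_process (n' m) (\<tau>' m) (h' m)))) \<longlonglongrightarrow> 0"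
    and Y': "(\<lambda>m. sq_dist M Y (simple_integral W (n' m) (\<tau>' m) (h' m))) \<longlonglongrightarrow> 0"
    unfolding has_ito_integral_iff by blast
  have "(\<lambda>m. sq_dist dt_dP (case_prod (simple_process (n m) (\<tau> m) (h m)))
      (case_prod (simple_process (n' m) (\<tau>' m) (h' m)))) \<longlonglongrightarrow> 0"
  proof (rule sq_dist_tendsto_triangle[where k = "\<lambda>_ (t, \<omega>). \<xi> t \<omega>"])
    show "(\<lambda>m. sq_dist dt_dP (case_prod (simple_process (n m) (\<tau> m) (h m))) (case_prod \<xi>)) \<longlonglongrightarrow> 0"
      using lim by (simp only: sq_dist_commute)
    show "(\<lambda>m. sq_dist dt_dP (case_prod \<xi>) (case_prod (simple_process (n' m) (\<tau>' m) (h' m)))) \<longlonglongrightarrow> 0"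
      by (rule \<xi>)
    show "case_prod \<xi> \<in> borel_measurable dt_dP" by fact
  qed (rule simple_process_measurable s s')+
  then have "(\<lambda>m. sq_dist M (simple_integral W (n m) (\<tau> m) (h m)) (simple_integral W (n' m) (\<tau>' m) (h' m))) \<longlonglongrightarrow> 0"
    unfolding simple_isometry[OF s s'] .
  then show ?thesis
  proof (rule sq_dist_tendsto_triangle[where k = "\<lambda>m. simple_integral W (n' m) (\<tau>' m) (h' m)" and g = "\<lambda>_. Y", rotated 3])
    show "(\<lambda>m. sq_dist M (simple_integral W (n' m) (\<tau>' m) (h' m)) Y) \<longlonglongrightarrow> 0"
      using Y' by (simp only: sq_dist_commute[of _ Y])
  qed (rule simple_integral_measurable s s' \<open>Y \<in> borel_measurable M\<close>)+
qed

end

section \<open>Left-endpoint Riemann sums of continuous integrands\<close>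

lemma riemann_step_mono: "0 \<le> T \<Longrightarrow> k \<le> l \<Longrightarrow> riemann_step T m k \<le> riemann_step T m l"
  unfolding riemann_step_def by (intro divide_right_mono mult_left_mono) auto

lemma riemann_step_ge_0: "0 \<le> T \<Longrightarrow> 0 \<le> riemann_step T m k"
  by (simp add: riemann_step_def)

lemma riemann_step_le: "0 \<le> T \<Longrightarrow> k \<le> Suc m \<Longrightarrow> riemann_step T m k \<le> T"
  using riemann_step_mono[of T k "Suc m" m] by (simp add: riemann_step_def)

lemma riemann_step_Suc_diff: "riemann_step T m (Suc k) - riemann_step T m k = T / real (Suc m)"
  by (simp add: riemann_step_def field_simps del: of_nat_Suc) (simp add: field_simps)

lemma riemann_cell:
  assumes "0 < T" "0 < t" "t \<le> T"
  shows "\<exists>k<Suc m. t \<in> {riemann_step T m k<..riemann_step T m (Suc k)}"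
proof -
  \<comment> \<open>The cell ends at the first grid point that is not before \<open>t\<close>. Cells
    are open on the left, so time \<open>0\<close> lies in none of them.\<close>
  define P where "P k \<longleftrightarrow> t \<le> riemann_step T m k" for k
  have "P (Suc m)" using assms by (simp add: P_def riemann_step_def)
  moreover have "\<not> P 0" using assms by (simp add: P_def riemann_step_def)
  ultimately have "\<exists>k<Suc m. \<not> P k \<and> P (Suc k)"
    using ex_least_nat_less[of P "Suc m"] by (auto simp: less_Suc_eq_le)
  then show ?thesis by (auto simp: P_def not_le)
qed

lemma simple_process_cell:
  assumes T: "0 \<le> T" and k: "k < Suc m" and t: "t \<in> {riemann_step T m k<..riemann_step T m (Suc k)}"
  shows "simple_process (Suc m) (riemann_step T m) h t \<omega> = h k \<omega>"
proof -
  have "indicator {riemann_step T m l<..riemann_step T m (Suc l)} t = (0 :: real)" if "l \<noteq> k" for l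
  proof (cases "l < k")
    case True
    then show ?thesis using riemann_step_mono[OF T, of "Suc l" k m] t by (auto simp: indicator_def)
  next
    case False
    then show ?thesis using riemann_step_mono[OF T, of "Suc k" l m] t that by (auto simp: indicator_def)
  qed
  then have "simple_process (Suc m) (riemann_step T m) h t \<omega> =
      (\<Sum>l<Suc m. if l = k then h k \<omega> else 0)"
    unfolding simple_process_def using t by (intro sum.cong) auto
  then show ?thesis using k by (simp add: sum.delta)
qed

definition riemann_sum :: "real \<Rightarrow> (real \<Rightarrow> 'a \<Rightarrow> real ^ 'd::finite) \<Rightarrow> (real \<Rightarrow> 'a \<Rightarrow> real ^ 'd) \<Rightarrow> nat \<Rightarrow> 'a \<Rightarrow> real" where
  "riemann_sum T W \<xi> m = simple_integral W (Suc m) (riemann_step T m) (\<lambda>k. \<xi> (riemann_step T m k))"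

context brownian
begin

definition riemann_process :: "(real \<Rightarrow> 'a \<Rightarrow> real ^ 'd) \<Rightarrow> nat \<Rightarrow> real \<Rightarrow> 'a \<Rightarrow> real ^ 'd" where
  "riemann_process \<xi> m = simple_process (Suc m) (riemann_step T m) (\<lambda>k. \<xi> (riemann_step T m k))"

lemma riemann_process_tendsto:
  assumes T: "0 < T" and c: "continuous_on {0..T} (\<lambda>t. \<xi> t \<omega>)" and t: "0 < t" "t \<le> T"
  shows "(\<lambda>m. riemann_process \<xi> m t \<omega>) \<longlonglongrightarrow> \<xi> t \<omega>"
proof -
  have "\<forall>m. \<exists>k<Suc m. t \<in> {riemann_step T m k<..riemann_step T m (Suc k)}"
    using riemann_cell[OF T t] by blast
  from choice[OF this] obtain k where k: "\<And>m. k m < Suc m"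
    and kt: "\<And>m. t \<in> {riemann_step T m (k m)<..riemann_step T m (Suc (k m))}" by blast
  have eq: "riemann_process \<xi> m t \<omega> = \<xi> (riemann_step T m (k m)) \<omega>" for m
    unfolding riemann_process_def using simple_process_cell[OF _ k kt] T by simp
  \<comment> \<open>The left end of the cell containing \<open>t\<close> lies at most one mesh width
    before \<open>t\<close>.\<close>
  have "(\<lambda>m. riemann_step T m (k m)) \<longlonglongrightarrow> t"
  proof (rule tendsto_sandwich[OF _ _ _ tendsto_const])
    show "(\<lambda>m. t - T / real (Suc m)) \<longlonglongrightarrow> t"
      using tendsto_diff[OF tendsto_const[of t] LIMSEQ_Suc[OF lim_const_over_n[of T]]] by simp
    have "t - T / real (Suc m) \<le> riemann_step T m (k m)" for m
      using kt[of m] riemann_step_Suc_diff[of T m "k m"] by simp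
    then show "\<forall>\<^sub>F m in sequentially. t - T / real (Suc m) \<le> riemann_step T m (k m)"
      by (intro always_eventually allI)
    show "\<forall>\<^sub>F m in sequentially. riemann_step T m (k m) \<le> t"
      using kt by (intro always_eventually allI) (simp add: less_imp_le)
  qed
  moreover have "riemann_step T m (k m) \<in> {0..T}" for m
    using k[of m] T by (auto intro!: riemann_step_ge_0 riemann_step_le)
  ultimately show ?thesis
    unfolding eq using t by (intro continuous_on_tendsto_compose[OF c]) auto
qed

end

text \<open>Path continuity makes the left-endpoint Riemann processes converge, adaptedness makes
  them simple integrands, and the uniform bound provides the dominating constant.\<close>

locale ito_integrand = brownian M F T W
  for M :: "'a measure" and F T and W :: "real \<Rightarrow> 'a \<Rightarrow> real ^ 'd::finite" +
  fixes \<xi> :: "real \<Rightarrow> 'a \<Rightarrow> real ^ 'd" and C :: real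
  assumes T: "0 < T"
    and adapted: "t \<in> {0..T} \<Longrightarrow> \<xi> t \<in> borel_measurable (F t)"
    and cont: "\<omega> \<in> space M \<Longrightarrow> continuous_on {0..T} (\<lambda>t. \<xi> t \<omega>)"
    and bound: "t \<in> {0..T} \<Longrightarrow> \<omega> \<in> space M \<Longrightarrow> norm (\<xi> t \<omega>) \<le> C"
begin

lemma riemann_simple: "simple_integrand F T (Suc m) (riemann_step T m) (\<lambda>k. \<xi> (riemann_step T m k))"
  unfolding simple_integrand_def
proof (intro conjI allI impI)
  show "0 \<le> riemann_step T m 0" "riemann_step T m (Suc m) \<le> T"
    using T by (simp_all add: riemann_step_ge_0 riemann_step_le)
  fix k assume k: "k < Suc m"
  show "riemann_step T m k \<le> riemann_step T m (Suc k)" using T by (intro riemann_step_mono) auto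
  have tk: "riemann_step T m k \<in> {0..T}" using T k by (simp add: riemann_step_ge_0 riemann_step_le)
  show "\<xi> (riemann_step T m k) \<in> borel_measurable (F (riemann_step T m k))" using tk by (rule adapted)
  show "bounded (\<xi> (riemann_step T m k) ` space (F (riemann_step T m k)))"
    using bound[OF tk] by (auto simp: bounded_iff)
qed

lemma riemann_process_measurable: "case_prod (riemann_process \<xi> m) \<in> borel_measurable dt_dP"
  unfolding riemann_process_def by (rule simple_process_measurable[OF riemann_simple])

lemma riemann_sum_measurable: "riemann_sum T W \<xi> m \<in> borel_measurable M"
  unfolding riemann_sum_def by (rule simple_integral_measurable[OF riemann_simple])

lemma C_nonneg: "0 \<le> C"
proof -
  obtain \<omega> where "\<omega> \<in> space M" using not_empty by blast
  then have "norm (\<xi> 0 \<omega>) \<le> C" using T by (intro bound) auto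
  then show ?thesis using norm_ge_zero[of "\<xi> 0 \<omega>"] by linarith
qed

text \<open>Time \<open>0\<close> belongs to no cell, so the Riemann processes miss
  \<open>\<xi> 0\<close>. This is why joint measurability needs a correction at \<open>0\<close> and
  why convergence is used only off a null set of times.\<close>

lemma riemann_process_0: "riemann_process \<xi> m 0 \<omega> = 0"
proof -
  have "0 \<notin> {riemann_step T m k<..riemann_step T m (Suc k)}" for k
    using riemann_step_ge_0[of T m k] T by simp
  then show ?thesis
    unfolding riemann_process_def simple_process_def by (intro sum.neutral) simp
qed

lemma riemann_process_bound:
  assumes "t \<in> {0..T}" "\<omega> \<in> space M"
  shows "norm (riemann_process \<xi> m t \<omega>) \<le> C"
proof (cases "t = 0")
  case True
  then show ?thesis using C_nonneg by (simp add: riemann_process_0)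
next
  case False
  then obtain k where k: "k < Suc m" "t \<in> {riemann_step T m k<..riemann_step T m (Suc k)}"
    using riemann_cell[OF T, of t m] assms by auto
  have "riemann_process \<xi> m t \<omega> = \<xi> (riemann_step T m k) \<omega>"
    unfolding riemann_process_def using simple_process_cell[OF _ k] T by simp
  moreover have "riemann_step T m k \<in> {0..T}"
    using k T by (simp add: riemann_step_ge_0 riemann_step_le)
  ultimately show ?thesis using bound assms by simp
qed

lemma jointly_measurable: "case_prod \<xi> \<in> borel_measurable dt_dP"
proof (rule borel_measurable_LIMSEQ_metric)
  fix m
  have [measurable]: "\<xi> 0 \<in> borel_measurable M" using adapted[of 0] T measurable_F by auto
  note [measurable] = fst_measurable_dt_dP
  \<comment> \<open>The correction at time \<open>0\<close> makes the approximations converge at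
    every point, as a measurable limit requires.\<close>
  have "(\<lambda>p. case_prod (riemann_process \<xi> m) p + indicator {0} (fst p) *\<^sub>R \<xi> 0 (snd p)) \<in> borel_measurable dt_dP"
    using riemann_process_measurable by measurable
  then show "(\<lambda>p. riemann_process \<xi> m (fst p) (snd p) + indicator {0} (fst p) *\<^sub>R \<xi> 0 (snd p)) \<in> borel_measurable dt_dP"
    by (simp add: split_beta')
next
  fix p assume p: "p \<in> space dt_dP"
  show "(\<lambda>m. riemann_process \<xi> m (fst p) (snd p) + indicator {0} (fst p) *\<^sub>R \<xi> 0 (snd p)) \<longlonglongrightarrow> case_prod \<xi> p"
  proof (cases "fst p = 0")
    case True
    then show ?thesis by (simp add: split_beta riemann_process_0)
  next
    case False
    then have "0 < fst p" "fst p \<le> T" "snd p \<in> space M" using p by (auto simp: space_dt_dP)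
    then have "(\<lambda>m. riemann_process \<xi> m (fst p) (snd p)) \<longlonglongrightarrow> \<xi> (fst p) (snd p)"
      by (intro riemann_process_tendsto[OF T cont])
    then show ?thesis using False by (simp add: split_beta)
  qed
qed

lemma AE_time_pos: "AE p in dt_dP. 0 < fst p"
proof (rule AE_I)
  show "{p \<in> space dt_dP. \<not> 0 < fst p} \<subseteq> {0} \<times> space M" by (auto simp: space_dt_dP)
  have 0: "{0} \<in> sets (restrict_space lborel {0..T})"
    using T by (simp add: sets_restrict_space_iff)
  then show "{0} \<times> space M \<in> sets dt_dP" by (rule pair_measureI) simp
  have "emeasure (restrict_space lborel {0..T}) {0} = 0"
    using T by (subst emeasure_restrict_space) auto
  then show "emeasure dt_dP ({0} \<times> space M) = 0"
    using 0 by (simp add: emeasure_pair_measure_Times)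
qed

lemma riemann_process_sq_dist:
  "(\<lambda>m. sq_dist dt_dP (case_prod \<xi>) (case_prod (riemann_process \<xi> m))) \<longlonglongrightarrow> 0"
proof -
  note [measurable] = jointly_measurable riemann_process_measurable
  let ?d = "\<lambda>m p. ennreal ((norm (case_prod \<xi> p - case_prod (riemann_process \<xi> m) p))\<^sup>2)"
  have "(\<lambda>m. \<integral>\<^sup>+p. ?d m p \<partial>dt_dP)
      \<longlonglongrightarrow> (\<integral>\<^sup>+p. 0 \<partial>dt_dP)"
  proof (rule nn_integral_dominated_convergence[where w = "\<lambda>_. ennreal ((2 * C)\<^sup>2)"])
    fix m
    show "AE p in dt_dP. ?d m p
        \<le> ennreal ((2 * C)\<^sup>2)"
    proof (rule AE_I2)
      fix p assume "p \<in> space dt_dP"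
      then have "norm (\<xi> (fst p) (snd p)) \<le> C" "norm (riemann_process \<xi> m (fst p) (snd p)) \<le> C"
        by (auto simp: space_dt_dP intro: bound riemann_process_bound)
      then have "norm (\<xi> (fst p) (snd p) - riemann_process \<xi> m (fst p) (snd p)) \<le> 2 * C"
        using norm_triangle_ineq4[of "\<xi> (fst p) (snd p)" "riemann_process \<xi> m (fst p) (snd p)"] by linarith
      then show "?d m p
        \<le> ennreal ((2 * C)\<^sup>2)"
        by (intro ennreal_leI power_mono) (auto simp: split_beta)
    qed
  next
    have "emeasure dt_dP (space dt_dP) = ennreal T"
      unfolding space_dt_dP using T
      by (subst emeasure_pair_measure_Times) (auto simp: sets_restrict_space_iff emeasure_restrict_space emeasure_space_1)
    then show "(\<integral>\<^sup>+p. ennreal ((2 * C)\<^sup>2) \<partial>dt_dP) < \<infinity>"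
      by (simp add: ennreal_mult_less_top)
  next
    show "AE p in dt_dP. (\<lambda>m. ?d m p) \<longlonglongrightarrow> 0"
      using AE_time_pos AE_space
    proof eventually_elim
      case (elim p)
      then have "0 < fst p" "fst p \<le> T" "snd p \<in> space M" by (auto simp: space_dt_dP)
      then have "(\<lambda>m. riemann_process \<xi> m (fst p) (snd p)) \<longlonglongrightarrow> \<xi> (fst p) (snd p)"
        by (intro riemann_process_tendsto[OF T cont])
      then have "(\<lambda>m. (norm (\<xi> (fst p) (snd p) - riemann_process \<xi> m (fst p) (snd p)))\<^sup>2) \<longlonglongrightarrow> (norm (\<xi> (fst p) (snd p) - \<xi> (fst p) (snd p)))\<^sup>2"
        by (intro tendsto_power tendsto_norm tendsto_diff tendsto_const)
      from tendsto_ennrealI[OF this] show ?case by (simp add: split_beta)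
    qed
  qed measurable
  then show ?thesis by (simp add: sq_dist_def)
qed

lemma has_ito_integral_exists: "\<exists>Y. has_ito_integral M F T W \<xi> Y"
proof -
  let ?R = "\<lambda>m. (case_prod (riemann_process \<xi> m))" and ?X = "\<lambda>(t, \<omega>). \<xi> t \<omega>"
  have "\<exists>Y\<in>borel_measurable M. (\<lambda>m. sq_dist M (riemann_sum T W \<xi> m) Y) \<longlonglongrightarrow> 0"
  proof (rule sq_dist_complete[OF riemann_sum_measurable])
    fix e :: real assume "0 < e"
    \<comment> \<open>\<open>sq_dist_triangle\<close> doubles the sum of two such errors, which
      gives \<open>e\<close>.\<close>
    then have "0 < ennreal (e / 4)" by (simp add: ennreal_less_zero_iff)
    from order_tendstoD(2)[OF riemann_process_sq_dist this]
    obtain n0 where n0: "\<And>m. m \<ge> n0 \<Longrightarrow> sq_dist dt_dP ?X (?R m) < ennreal (e / 4)"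
      unfolding eventually_sequentially by blast
    have "sq_dist M (riemann_sum T W \<xi> m) (riemann_sum T W \<xi> n) \<le> ennreal e" if "m \<ge> n0" "n \<ge> n0" for m n
    proof -
      have "sq_dist M (riemann_sum T W \<xi> m) (riemann_sum T W \<xi> n) = sq_dist dt_dP (?R m) (?R n)"
        unfolding riemann_sum_def riemann_process_def by (rule simple_isometry[OF riemann_simple riemann_simple])
      also have "\<dots> \<le> 2 * (sq_dist dt_dP (?R m) ?X + sq_dist dt_dP ?X (?R n))"
        by (rule sq_dist_triangle[OF riemann_process_measurable riemann_process_measurable jointly_measurable])
      also have "\<dots> \<le> 2 * (ennreal (e / 4) + ennreal (e / 4))"
        using n0[OF that(1)] n0[OF that(2)]
        by (intro mult_left_mono add_mono) (auto simp: sq_dist_commute[of _ _ ?X])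
      also have "ennreal (e / 4) + ennreal (e / 4) = ennreal (e / 2)"
        using \<open>0 < e\<close> by (subst ennreal_plus[symmetric]) auto
      also have "2 * ennreal (e / 2) = ennreal (2 * (e / 2))"
        using \<open>0 < e\<close> by (subst ennreal_mult) auto
      finally show ?thesis by simp
    qed
    then show "\<exists>n0. \<forall>m\<ge>n0. \<forall>n\<ge>n0. sq_dist M (riemann_sum T W \<xi> m) (riemann_sum T W \<xi> n) \<le> ennreal e" by blast
  qed
  then obtain Y where Y: "Y \<in> borel_measurable M" "(\<lambda>m. sq_dist M Y (riemann_sum T W \<xi> m)) \<longlonglongrightarrow> 0"
    by (auto simp only: sq_dist_commute[of _ "riemann_sum T W \<xi> _"])
  have "has_ito_integral M F T W \<xi> Y"
    unfolding has_ito_integral_iff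
    by (intro conjI exI[of _ Suc] exI[of _ "riemann_step T"] exI[of _ "\<lambda>m k. \<xi> (riemann_step T m k)"] allI
        jointly_measurable Y[unfolded riemann_sum_def] riemann_simple
        riemann_process_sq_dist[unfolded riemann_process_def])
  then show ?thesis by blast
qed

lemma has_ito_integral_ito: "has_ito_integral M F T W \<xi> (ito_integral M F T W \<xi>)"
  unfolding ito_integral_def using has_ito_integral_exists by (rule someI_ex)

lemma ito_integral_measurable: "ito_integral M F T W \<xi> \<in> borel_measurable M"
  using has_ito_integral_ito unfolding has_ito_integral_iff by blast

lemma riemann_sum_tendsto_ito:
  "(\<lambda>m. sq_dist M (riemann_sum T W \<xi> m) (ito_integral M F T W \<xi>)) \<longlonglongrightarrow> 0"
  unfolding riemann_sum_def
  by (rule has_ito_integral_limit[OF has_ito_integral_ito riemann_simple riemann_process_sq_dist[unfolded riemann_process_def]])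

end

section \<open>The Euler scheme\<close>

text \<open>The driving path \<open>w\<close> is a parameter: the scheme is a deterministic function
  of the starting point and finitely many noise increments, so solutions on different probability
  spaces can be compared through its law.\<close>

primrec euler :: "(real \<Rightarrow> 'd::finite torus \<Rightarrow> real ^ 'd) \<Rightarrow> (nat \<Rightarrow> real) \<Rightarrow> (real \<Rightarrow> real ^ 'd)
    \<Rightarrow> 'd torus \<Rightarrow> nat \<Rightarrow> 'd torus" where
  "euler \<beta> \<tau> w x 0 = x"
| "euler \<beta> \<tau> w x (Suc k) = euler \<beta> \<tau> w x k +
     to_torus ((\<tau> (Suc k) - \<tau> k) *\<^sub>R \<beta> (\<tau> k) (euler \<beta> \<tau> w x k) + (w (\<tau> (Suc k)) - w (\<tau> k)))"

context
  fixes T \<Lambda> :: real and \<beta> :: "real \<Rightarrow> 'd::finite torus \<Rightarrow> real ^ 'd" and x :: "real \<Rightarrow> 'd torus"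
    and w :: "real \<Rightarrow> real ^ 'd"
  assumes \<beta>_cont: "continuous_on ({0..T} \<times> UNIV) (\<lambda>(t, x). \<beta> t x)"
    and \<beta>_lip: "\<And>t x y. t \<in> {0..T} \<Longrightarrow> norm (\<beta> t x - \<beta> t y) \<le> \<Lambda> * dist x y"
    and \<Lambda>: "0 \<le> \<Lambda>"
    and x_cont: "continuous_on {0..T} x"
    and x_eq: "\<And>t. t \<in> {0..T} \<Longrightarrow> x t = x 0 + to_torus (integral {0..t} (\<lambda>s. \<beta> s (x s)) + w t)"
begin

lemma drift_along_path_continuous: "continuous_on {0..T} (\<lambda>s. \<beta> s (x s))"
proof -
  have "continuous_on {0..T} (\<lambda>s. (\<lambda>(t, x). \<beta> t x) (s, x s))"
    by (rule continuous_on_compose2[OF \<beta>_cont]) (auto intro!: continuous_intros x_cont)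
  then show ?thesis by simp
qed

text \<open>The noise is additive and cancels, so only the drift produces an error: \<open>e\<close>
  bounds its oscillation along the true path, and the Lipschitz term accounts for the distance
  accumulated before.\<close>

lemma euler_one_step:
  assumes st: "0 \<le> s" "s \<le> t" "t \<le> T"
    and osc: "\<And>r. r \<in> {s..t} \<Longrightarrow> norm (\<beta> r (x r) - \<beta> s (x s)) \<le> e"
  shows "dist (y + to_torus ((t - s) *\<^sub>R \<beta> s y + (w t - w s))) (x t) \<le> dist y (x s) + (t - s) * (e + \<Lambda> * dist y (x s))"
proof -
  let ?b = "\<lambda>r. \<beta> r (x r)"
  have int: "?b integrable_on {0..t}" "?b integrable_on {s..t}"
    using st by (auto intro!: integrable_continuous_interval continuous_on_subset[OF drift_along_path_continuous])
  have split: "integral {0..t} ?b = integral {0..s} ?b + integral {s..t} ?b"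
    using Henstock_Kurzweil_Integration.integral_combine[of 0 s t ?b] st int by simp
  have "x t = x s + to_torus (integral {s..t} ?b + (w t - w s))"
    using st by (subst (1 2) x_eq) (auto simp: split to_torus_add to_torus_diff)
  then have "dist (y + to_torus ((t - s) *\<^sub>R \<beta> s y + (w t - w s))) (x t) \<le>
      dist y (x s) + dist (to_torus ((t - s) *\<^sub>R \<beta> s y + (w t - w s))) (to_torus (integral {s..t} ?b + (w t - w s)))"
    by (simp add: dist_torus_add_le)
  also have "dist (to_torus ((t - s) *\<^sub>R \<beta> s y + (w t - w s))) (to_torus (integral {s..t} ?b + (w t - w s)))
      \<le> norm (integral {s..t} ?b - (t - s) *\<^sub>R \<beta> s y)"
    using dist_to_torus_le[of "(t - s) *\<^sub>R \<beta> s y + (w t - w s)" "integral {s..t} ?b + (w t - w s)"]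
    by (simp add: dist_norm norm_minus_commute)
  also have "\<dots> \<le> (e + \<Lambda> * dist y (x s)) * measure lborel (cbox s t)"
  proof (rule has_integral_bound)
    have e: "0 \<le> e" using osc[of s] st norm_ge_zero order_trans by force
    then show "0 \<le> e + \<Lambda> * dist y (x s)" using \<Lambda> by simp
    have "((\<lambda>r. ?b r - \<beta> s y) has_integral (integral {s..t} ?b - (t - s) *\<^sub>R \<beta> s y)) {s..t}"
      using int(2) st has_integral_const_real[of "\<beta> s y" s t]
      by (intro has_integral_diff) (auto simp: has_integral_integral)
    then show "((\<lambda>r. ?b r - \<beta> s y) has_integral (integral {s..t} ?b - (t - s) *\<^sub>R \<beta> s y)) (cbox s t)"
      by simp
    fix r assume "r \<in> cbox s t"
    then have r: "r \<in> {s..t}" by simp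
    have "norm (?b r - \<beta> s y) \<le> norm (?b r - ?b s) + norm (\<beta> s (x s) - \<beta> s y)"
      using norm_triangle_ineq[of "?b r - ?b s" "\<beta> s (x s) - \<beta> s y"] by simp
    also have "\<dots> \<le> e + \<Lambda> * dist y (x s)"
      using osc[OF r] \<beta>_lip[of s "x s" y] st by (auto simp: dist_commute intro!: add_mono)
    finally show "norm (?b r - \<beta> s y) \<le> e + \<Lambda> * dist y (x s)" .
  qed
  finally show ?thesis using st by (simp add: mult.commute)
qed

text \<open>A discrete Gronwall argument. The grid divides \<open>[0, t]\<close>, not
  \<open>[0, T]\<close>, so that its last point is \<open>t\<close> itself.\<close>

lemma euler_tendsto:
  assumes t: "0 < t" "t \<le> T"
  shows "(\<lambda>m. euler \<beta> (riemann_step t m) w (x 0) (Suc m)) \<longlonglongrightarrow> x t"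
proof (rule tendsto_dist_iff[THEN iffD2], rule tendstoI)
  fix \<epsilon> :: real assume \<epsilon>: "0 < \<epsilon>"
  \<comment> \<open>Chosen so that the final bound \<open>e * t * exp (\<Lambda> * t)\<close> equals
    half of \<open>\<epsilon>\<close>.\<close>
  define e where "e = \<epsilon> / (2 * t * exp (\<Lambda> * t))"
  have e: "0 < e" using \<epsilon> t by (simp add: e_def)
  have "uniformly_continuous_on {0..T} (\<lambda>s. \<beta> s (x s))"
    by (rule compact_uniformly_continuous[OF drift_along_path_continuous]) simp
  then obtain \<delta> where \<delta>: "0 < \<delta>"
    "\<And>s r. s \<in> {0..T} \<Longrightarrow> r \<in> {0..T} \<Longrightarrow> dist r s < \<delta> \<Longrightarrow> dist (\<beta> r (x r)) (\<beta> s (x s)) < e"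
    unfolding uniformly_continuous_on_def using e by metis
  have main: "dist (euler \<beta> (riemann_step t m) w (x 0) (Suc m)) (x t) < \<epsilon>" if m: "t / real (Suc m) < \<delta>" for m
  proof -
    let ?\<tau> = "riemann_step t m" and ?E = "euler \<beta> (riemann_step t m) w (x 0)"
    \<comment> \<open>The factor \<open>?\<tau> k\<close> adds up the local errors and the
      exponential their amplification; the inequality
      \<open>1 + \<Lambda> * h \<le> exp (\<Lambda> * h)\<close> reproduces this form in the next
      step.\<close>
    have "k \<le> Suc m \<longrightarrow> dist (?E k) (x (?\<tau> k)) \<le> e * ?\<tau> k * exp (\<Lambda> * ?\<tau> k)" for k
    proof (induction k)
      case 0
      show ?case by (simp add: riemann_step_def)
    next
      case (Suc k)
      show ?case
      proof
        assume k: "Suc k \<le> Suc m"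
        define D where "D = dist (?E k) (x (?\<tau> k))"
        define h where "h = ?\<tau> (Suc k) - ?\<tau> k"
        have h: "h = t / real (Suc m)" unfolding h_def by (rule riemann_step_Suc_diff)
        have h0: "0 \<le> h" using t by (simp add: h)
        have \<tau>: "0 \<le> ?\<tau> k" "?\<tau> k \<le> ?\<tau> (Suc k)" "?\<tau> (Suc k) \<le> T"
          using t k riemann_step_le[of t "Suc k" m] by (auto simp: riemann_step_ge_0 intro!: riemann_step_mono)
        have D: "D \<le> e * ?\<tau> k * exp (\<Lambda> * ?\<tau> k)" using Suc k by (simp add: D_def)
        have "dist (?E (Suc k)) (x (?\<tau> (Suc k))) \<le> D + h * (e + \<Lambda> * D)"
          unfolding D_def h_def euler.simps
        proof (rule euler_one_step[OF \<tau>])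
          fix r assume r: "r \<in> {?\<tau> k..?\<tau> (Suc k)}"
          then have "dist r (?\<tau> k) < \<delta>" using m h by (simp add: dist_real_def h_def)
          then have "dist (\<beta> r (x r)) (\<beta> (?\<tau> k) (x (?\<tau> k))) < e" using r \<tau> by (intro \<delta>) auto
          then show "norm (\<beta> r (x r) - \<beta> (?\<tau> k) (x (?\<tau> k))) \<le> e" by (simp add: dist_norm)
        qed
        also have "\<dots> = (1 + \<Lambda> * h) * D + e * h" by (simp add: algebra_simps)
        also have "\<dots> \<le> exp (\<Lambda> * h) * (e * ?\<tau> k * exp (\<Lambda> * ?\<tau> k)) + e * h * exp (\<Lambda> * ?\<tau> (Suc k))"
        proof (rule add_mono)
          show "(1 + \<Lambda> * h) * D \<le> exp (\<Lambda> * h) * (e * ?\<tau> k * exp (\<Lambda> * ?\<tau> k))"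
            using D h0 \<Lambda> exp_ge_add_one_self[of "\<Lambda> * h"] by (intro mult_mono) (auto simp: D_def)
          have "1 \<le> exp (\<Lambda> * ?\<tau> (Suc k))" using \<Lambda> \<tau> by simp
          then show "e * h \<le> e * h * exp (\<Lambda> * ?\<tau> (Suc k))"
            using mult_left_mono[of 1 "exp (\<Lambda> * ?\<tau> (Suc k))" "e * h"] e h0 by simp
        qed
        also have "\<dots> = e * ?\<tau> (Suc k) * exp (\<Lambda> * ?\<tau> (Suc k))"
        proof -
          have \<tau>': "?\<tau> (Suc k) = ?\<tau> k + h" by (simp add: h_def)
          show ?thesis unfolding \<tau>' distrib_left exp_add by (simp add: algebra_simps)
        qed
        finally show "dist (?E (Suc k)) (x (?\<tau> (Suc k))) \<le> e * ?\<tau> (Suc k) * exp (\<Lambda> * ?\<tau> (Suc k))" .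
      qed
    qed
    from this[of "Suc m"] have "dist (?E (Suc m)) (x t) \<le> e * t * exp (\<Lambda> * t)"
      by (simp add: riemann_step_def del: euler.simps)
    also have "\<dots> = \<epsilon> / 2" using t by (simp add: e_def)
    finally show ?thesis using \<epsilon> by simp
  qed
  have "\<forall>\<^sub>F m in sequentially. t / real (Suc m) < \<delta>"
    using order_tendstoD(2)[OF LIMSEQ_Suc[OF lim_const_over_n[of t]] \<delta>(1)] by simp
  then show "\<forall>\<^sub>F m in sequentially. dist (dist (euler \<beta> (riemann_step t m) w (x 0) (Suc m)) (x t)) 0 < \<epsilon>"
    by eventually_elim (simp add: main del: euler.simps)
qed

end

section \<open>Uniqueness in law for equations with additive noise\<close>

abbreviation euler_process :: "(real \<Rightarrow> 'd::finite torus \<Rightarrow> real ^ 'd) \<Rightarrow> real \<Rightarrow> nat \<Rightarrow> (real \<Rightarrow> 'a \<Rightarrow> real ^ 'd)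
    \<Rightarrow> ('a \<Rightarrow> 'd torus) \<Rightarrow> nat \<Rightarrow> 'a \<Rightarrow> 'd torus" where
  "euler_process \<beta> t m W X k \<equiv> \<lambda>\<omega>. euler \<beta> (riemann_step t m) (\<lambda>s. W s \<omega>) (X \<omega>) k"

lemma (in brownian) euler_measurable:
  assumes \<beta>: "\<forall>t\<in>{0..T}. \<beta> t \<in> borel_measurable borel"
    and X: "X \<in> borel_measurable (F 0)" and t: "0 \<le> t" "t \<le> T" and k: "k \<le> Suc m"
  shows "euler_process \<beta> t m W X k \<in> borel_measurable (F (riemann_step t m k))"
  using k
proof (induction k)
  case 0
  show ?case using X by (simp add: riemann_step_def)
next
  case (Suc k)
  let ?\<tau> = "riemann_step t m" and ?E = "euler_process \<beta> t m W X"
  have \<tau>: "0 \<le> ?\<tau> k" "?\<tau> k \<le> ?\<tau> (Suc k)" "?\<tau> (Suc k) \<le> T"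
    using t Suc riemann_step_le[of t "Suc k" m] by (auto simp: riemann_step_ge_0 intro!: riemann_step_mono)
  have [measurable]: "?E k \<in> borel_measurable (F (?\<tau> (Suc k)))"
    using Suc \<tau> by (auto intro: measurable_F_mono)
  have [measurable]: "W (?\<tau> k) \<in> borel_measurable (F (?\<tau> (Suc k)))" "W (?\<tau> (Suc k)) \<in> borel_measurable (F (?\<tau> (Suc k)))"
    using \<tau> by (auto intro!: W_measurable_F)
  have [measurable]: "\<beta> (?\<tau> k) \<in> borel_measurable borel" using \<tau> \<beta> by auto
  show ?case by simp
qed

text \<open>Given the current state, the next increment is an independent Gaussian vector. The
  kernel on the right depends only on the drift and the grid, so the probability space enters
  through the previous law alone and \<open>euler_law\<close> becomes an induction.\<close>

lemma (in brownian) euler_transition: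
  assumes \<beta>: "\<forall>t\<in>{0..T}. \<beta> t \<in> borel_measurable borel"
    and X: "X \<in> borel_measurable (F 0)" and t: "0 < t" "t \<le> T" and k: "k < Suc m"
    and A: "A \<in> sets borel"
  shows "emeasure (distr M borel (euler_process \<beta> t m W X (Suc k))) A =
    (\<integral>\<^sup>+y. \<integral>\<^sup>+v. indicator A (y + to_torus ((t / real (Suc m)) *\<^sub>R \<beta> (riemann_step t m k) y + v)) \<partial>gauss (t / real (Suc m))
      \<partial>distr M borel (euler_process \<beta> t m W X k))"
proof -
  let ?\<tau> = "riemann_step t m" and ?E = "euler_process \<beta> t m W X"
  define h where "h = t / real (Suc m)"
  have h: "?\<tau> (Suc k) - ?\<tau> k = h" unfolding h_def by (rule riemann_step_Suc_diff)
  have h0: "0 < h" using t by (simp add: h_def)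
  have \<tau>: "0 \<le> ?\<tau> k" "?\<tau> k < ?\<tau> (Suc k)" "?\<tau> (Suc k) \<le> T"
    using t k riemann_step_le[of t "Suc k" m] h h0 by (auto simp: riemann_step_ge_0)
  have EF[measurable]: "?E k \<in> borel_measurable (F (?\<tau> k))"
    using euler_measurable[OF \<beta> X, of t k m] t k by simp
  have [measurable]: "?E k \<in> borel_measurable M" using EF by (rule measurable_F)
  have ES[measurable]: "?E (Suc k) \<in> borel_measurable M"
    using euler_measurable[OF \<beta> X, of t "Suc k" m] t k by (auto intro: measurable_F simp del: euler.simps)
  have [measurable]: "inc (?\<tau> k) (?\<tau> (Suc k)) \<in> borel_measurable M" using \<tau> by (intro inc_measurable) auto
  have b[measurable]: "\<beta> (?\<tau> k) \<in> borel_measurable borel" using \<tau> \<beta> by auto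
  interpret g: prob_space "gauss h :: (real ^ 'd) measure" using h0 by (rule prob_space_gauss)
  define f where "f y v = (indicator A (y + to_torus (h *\<^sub>R \<beta> (?\<tau> k) y + v)) :: ennreal)" for y v
  have fm[measurable]: "(\<lambda>(y, v). f y v) \<in> borel_measurable (borel \<Otimes>\<^sub>M borel)"
    unfolding f_def using A by measurable
  have "emeasure (distr M borel (?E (Suc k))) A = (\<integral>\<^sup>+\<omega>. indicator A (?E (Suc k) \<omega>) \<partial>M)"
    using A by (simp del: euler.simps add: nn_integral_indicator[symmetric] nn_integral_distr flip: nn_integral_indicator)
  also have "\<dots> = (\<integral>\<^sup>+\<omega>. (\<lambda>(\<omega>, v). f (?E k \<omega>) v) (\<omega>, inc (?\<tau> k) (?\<tau> (Suc k)) \<omega>) \<partial>M)"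
    by (simp add: f_def h)
  also have "\<dots> = (\<integral>\<^sup>+\<omega>. \<integral>\<^sup>+v. (\<lambda>(\<omega>, v). f (?E k \<omega>) v) (\<omega>, v) \<partial>distr M borel (inc (?\<tau> k) (?\<tau> (Suc k))) \<partial>M)"
  proof (rule nn_integral_indep_subalgebra[OF subalg])
    show "indep_set (sets (F (?\<tau> k))) (sets (vimage_algebra (space M) (inc (?\<tau> k) (?\<tau> (Suc k))) borel))"
      using \<tau> by (intro inc_indep)
  qed measurable
  also have "\<dots> = (\<integral>\<^sup>+\<omega>. \<integral>\<^sup>+v. f (?E k \<omega>) v \<partial>gauss h \<partial>M)"
    using \<tau> by (simp add: distr_inc h)
  also have "\<dots> = (\<integral>\<^sup>+y. \<integral>\<^sup>+v. f y v \<partial>gauss h \<partial>distr M borel (?E k))"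
    by (subst nn_integral_distr) (use g.borel_measurable_nn_integral_fst[of "\<lambda>(y, v). f y v" borel] in \<open>auto cong: measurable_cong_sets sets_pair_measure_cong\<close>)
  finally show ?thesis by (simp only: f_def h_def)
qed

lemma (in brownian) euler_expectation_tendsto:
  fixes f :: "'d torus \<Rightarrow> 'c::{banach, second_countable_topology}"
  assumes \<beta>: "continuous_on ({0..T} \<times> UNIV) (\<lambda>(t, x). \<beta> t x)" "\<forall>t\<in>{0..T}. \<beta> t \<in> borel_measurable borel"
      "\<And>t x y. t \<in> {0..T} \<Longrightarrow> norm (\<beta> t x - \<beta> t y) \<le> \<Lambda> * dist x y" "0 \<le> \<Lambda>"
    and X: "\<And>t. t \<in> {0..T} \<Longrightarrow> X t \<in> borel_measurable (F t)"
      "\<And>\<omega>. \<omega> \<in> space M \<Longrightarrow> continuous_on {0..T} (\<lambda>t. X t \<omega>)"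
      "AE \<omega> in M. \<forall>t\<in>{0..T}. X t \<omega> = X 0 \<omega> + to_torus (integral {0..t} (\<lambda>s. \<beta> s (X s \<omega>)) + W t \<omega>)"
    and f: "continuous_on UNIV f" "\<And>x. norm (f x) \<le> C" and t: "0 < t" "t \<le> T"
  shows "(\<lambda>m. \<integral>\<omega>. f (euler_process \<beta> t m W (X 0) (Suc m) \<omega>) \<partial>M) \<longlonglongrightarrow> (\<integral>\<omega>. f (X t \<omega>) \<partial>M)"
proof (rule integral_dominated_convergence[where w = "\<lambda>_. C"])
  have [measurable]: "f \<in> borel_measurable borel" using f(1) by (rule borel_measurable_continuous_onI)
  have [measurable]: "X t \<in> borel_measurable M" using X(1)[of t] t by (auto intro: measurable_F)
  show "(\<lambda>\<omega>. f (X t \<omega>)) \<in> borel_measurable M" by measurable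
  fix m
  have [measurable]: "euler_process \<beta> t m W (X 0) (Suc m) \<in> borel_measurable M"
    using t by (intro measurable_F[OF euler_measurable[OF \<beta>(2) X(1)]]) auto
  show "(\<lambda>\<omega>. f (euler_process \<beta> t m W (X 0) (Suc m) \<omega>)) \<in> borel_measurable M" by measurable
next
  show "AE \<omega> in M. (\<lambda>m. f (euler_process \<beta> t m W (X 0) (Suc m) \<omega>)) \<longlonglongrightarrow> f (X t \<omega>)"
    using X(3) AE_space
  proof eventually_elim
    case (elim \<omega>)
    have "(\<lambda>m. euler_process \<beta> t m W (X 0) (Suc m) \<omega>) \<longlonglongrightarrow> X t \<omega>"
      by (rule euler_tendsto[OF \<beta>(1,3,4) X(2)[OF elim(2)] bspec[OF elim(1)] t])
    from continuous_on_tendsto_compose[OF f(1) this] show ?case by simp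
  qed
qed (use f(2) in simp_all)

lemma euler_law:
  assumes 1: "brownian M F T W" and 2: "brownian M' F' T W'"
    and \<beta>: "\<forall>t\<in>{0..T}. \<beta> t \<in> borel_measurable borel"
    and X: "X \<in> borel_measurable (F 0)" and X': "X' \<in> borel_measurable (F' 0)"
    and law: "distr M borel X = distr M' borel X'" and t: "0 < t" "t \<le> T" and k: "k \<le> Suc m"
  shows "distr M borel (euler_process \<beta> t m W X k) =
    distr M' borel (euler_process \<beta> t m W' X' k)"
  using k
proof (induction k)
  case 0
  then show ?case using law by simp
next
  case (Suc k)
  then show ?case
    using brownian.euler_transition[OF 1 \<beta> X t, of k m] brownian.euler_transition[OF 2 \<beta> X' t, of k m]
    by (intro measure_eqI) (simp_all del: euler.simps)
qed

text \<open>Regularity in time of the averages over the marginal laws comes from the continuity of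
  the paths, by dominated convergence. It is used for the drift along the marginals and for the
  centring term of \<open>\<xi>\<close>.\<close>

lemma (in prob_space) mean_kernel_continuous:
  fixes K :: "'d::finite torus \<Rightarrow> real ^ 'd" and X :: "real \<Rightarrow> 'a \<Rightarrow> 'd torus"
  assumes X[measurable]: "\<And>t. t \<in> S \<Longrightarrow> X t \<in> borel_measurable M"
    and X_cont: "\<And>\<omega>. \<omega> \<in> space M \<Longrightarrow> continuous_on S (\<lambda>t. X t \<omega>)"
    and K: "continuous_on UNIV K" "\<And>x. norm (K x) \<le> B"
  shows "continuous_on (S \<times> UNIV) (\<lambda>(t, x). \<integral>\<omega>. K (x - X t \<omega>) \<partial>M)"
proof -
  have [measurable]: "K \<in> borel_measurable borel" using K(1) by (rule borel_measurable_continuous_onI)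
  have "(\<lambda>n. \<integral>\<omega>. K (x n - X (t n) \<omega>) \<partial>M) \<longlonglongrightarrow> (\<integral>\<omega>. K (y - X s \<omega>) \<partial>M)"
    if t: "t \<longlonglongrightarrow> s" "\<And>n. t n \<in> S" "s \<in> S" and x: "x \<longlonglongrightarrow> y" for t s x y
  proof (rule integral_dominated_convergence[where w = "\<lambda>_. B"])
    show "AE \<omega> in M. (\<lambda>n. K (x n - X (t n) \<omega>)) \<longlonglongrightarrow> K (y - X s \<omega>)"
    proof (rule AE_I2)
      fix \<omega> assume "\<omega> \<in> space M"
      from continuous_on_tendsto_compose[OF X_cont[OF this] t(1) t(3)] t(2)
      have "(\<lambda>n. X (t n) \<omega>) \<longlonglongrightarrow> X s \<omega>" by simp
      from continuous_on_tendsto_compose[OF K(1) tendsto_diff[OF x this]]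
      show "(\<lambda>n. K (x n - X (t n) \<omega>)) \<longlonglongrightarrow> K (y - X s \<omega>)" by simp
    qed
  qed (use t K(2) in auto)
  note * = this
  show ?thesis
    unfolding continuous_on_sequentially
  proof safe
    fix p s y assume p: "\<forall>n. p n \<in> S \<times> (UNIV :: 'd torus set)" "s \<in> S" and lim: "p \<longlonglongrightarrow> (s, y)"
    have 1: "(\<lambda>n. fst (p n)) \<longlonglongrightarrow> s" "(\<lambda>n. snd (p n)) \<longlonglongrightarrow> y"
      using tendsto_fst[OF lim] tendsto_snd[OF lim] by simp_all
    have 2: "fst (p n) \<in> S" for n using p(1) by (metis mem_Times_iff)
    show "((\<lambda>(t, x). \<integral>\<omega>. K (x - X t \<omega>) \<partial>M) \<circ> p) \<longlonglongrightarrow> (\<integral>\<omega>. K (y - X s \<omega>) \<partial>M)"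
      using *[OF 1(1) 2 p(2) 1(2)] by (simp add: o_def split_beta)
  qed
qed

lemma (in prob_space) mean_kernel_bound:
  fixes h :: "'a \<Rightarrow> real ^ 'd::finite"
  assumes "h \<in> borel_measurable M" "\<And>\<omega>. norm (h \<omega>) \<le> B"
  shows "norm (\<integral>\<omega>. h \<omega> \<partial>M) \<le> B"
proof -
  have "norm (\<integral>\<omega>. h \<omega> \<partial>M) \<le> (\<integral>\<omega>. norm (h \<omega>) \<partial>M)" by (rule integral_norm_bound)
  also have "\<dots> \<le> (\<integral>\<omega>. B \<partial>M)"
    using assms by (intro integral_mono) (auto intro!: integrable_const_bound[where B = B])
  finally have "norm (\<integral>\<omega>. h \<omega> \<partial>M) \<le> (\<integral>\<omega>. B \<partial>M)" .
  then show ?thesis by (simp add: prob_space)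
qed

lemma drift_at_law:
  fixes F G :: "'d::finite torus \<Rightarrow> real ^ 'd"
  assumes b: "\<forall>\<nu>\<in>space (prob_algebra borel). \<forall>x. b \<nu> x = G x + (LINT y|\<nu>. F (x - y))"
    and M: "prob_space M" and X[measurable]: "X \<in> borel_measurable M" and F[measurable]: "F \<in> borel_measurable borel"
  shows "b (distr M borel X) x = G x + (\<integral>\<omega>. F (x - X \<omega>) \<partial>M)"
proof -
  \<comment> \<open>The form of \<open>b\<close> is prescribed at probability measures only.\<close>
  have "distr M borel X \<in> space (prob_algebra borel)"
    using prob_space.prob_space_distr[OF M X] by (simp add: space_prob_algebra)
  moreover have "(LINT y|distr M borel X. F (x - y)) = (\<integral>\<omega>. F (x - X \<omega>) \<partial>M)"
    by (rule integral_distr) measurable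
  ultimately show ?thesis using b by simp
qed

lemma mckean_vlasov_brownian: "mckean_vlasov_solution M F T b W X \<Longrightarrow> brownian M F T W"
  by (auto simp: mckean_vlasov_solution_def brownian_def brownian_axioms_def filtered_def
      filtered_axioms_def filtered_prob_space_def)

text \<open>Inserting the law of \<open>X0 t\<close> turns the McKean-Vlasov equation into an
  ordinary one with a time-dependent Lipschitz drift \<open>\<beta>\<close>, shared by both
  processes. The conclusion is phrased with vector-valued test functions because it is applied to
  the interaction kernel itself.\<close>

lemma sde_law_unique:
  fixes f :: "'d::finite torus \<Rightarrow> 'c::{banach, second_countable_topology}"
  assumes T: "0 < T"
    and HH: "\<And>f. f \<in> HH \<Longrightarrow> (\<forall>x. norm (f x) \<le> B) \<and> L-lipschitz_on UNIV f"
    and b: "b \<in> drift_class HH"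
    and mv: "mckean_vlasov_solution M0 F0 T b W0 X0"
    and \<mu>: "\<And>t. t \<in> {0..T} \<Longrightarrow> \<mu> t = distr M0 borel (X0 t)"
    and br: "brownian M F T W" and sde: "sde_solution M F T b \<mu> W X"
    and init: "distr M borel (X 0) = distr M0 borel (X0 0)"
    and f: "continuous_on UNIV f" "\<And>x. norm (f x) \<le> C" and t: "t \<in> {0..T}"
  shows "(\<integral>\<omega>. f (X t \<omega>) \<partial>M) = (\<integral>\<omega>. f (X0 t \<omega>) \<partial>M0)"
proof -
  have br0: "brownian M0 F0 T W0" and sde0: "sde_solution M0 F0 T b (\<lambda>t. distr M0 borel (X0 t)) W0 X0"
    using mckean_vlasov_brownian[OF mv] mv by (simp_all add: mckean_vlasov_solution_def)
  interpret B: brownian M F T W by (rule br)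
  interpret B0: brownian M0 F0 T W0 by (rule br0)
  obtain Fb Gb where FG: "Fb \<in> HH" "Gb \<in> HH"
    and b_eq: "\<forall>\<nu>\<in>space (prob_algebra borel). \<forall>x. b \<nu> x = Gb x + (LINT y|\<nu>. Fb (x - y))"
    using b by (auto simp: drift_class_def)
  have L: "L-lipschitz_on UNIV Fb" "L-lipschitz_on UNIV Gb" using FG HH by auto
  have cont: "continuous_on UNIV Fb" "continuous_on UNIV Gb" using L by (auto intro: lipschitz_on_continuous_on)
  have [measurable]: "Fb \<in> borel_measurable borel" "f \<in> borel_measurable borel"
    using cont f by (auto intro: borel_measurable_continuous_onI)
  have X0m: "X0 t \<in> borel_measurable M0" if "t \<in> {0..T}" for t
    using sde0 that by (auto simp: sde_solution_def intro: B0.measurable_F)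
  have Xm: "X t \<in> borel_measurable M" if "t \<in> {0..T}" for t
    using sde that by (auto simp: sde_solution_def intro: B.measurable_F)
  define \<beta> where "\<beta> t x = b (distr M0 borel (X0 t)) x" for t x
  have \<beta>: "\<beta> t x = Gb x + (\<integral>\<omega>. Fb (x - X0 t \<omega>) \<partial>M0)" if "t \<in> {0..T}" for t x
    unfolding \<beta>_def by (rule drift_at_law[OF b_eq B0.prob_space_axioms X0m[OF that]]) measurable
  have "continuous_on ({0..T} \<times> UNIV) (\<lambda>p. Gb (snd p) + (\<lambda>(t, x). \<integral>\<omega>. Fb (x - X0 t \<omega>) \<partial>M0) p)"
  proof (intro continuous_on_add B0.mean_kernel_continuous)
    show "continuous_on ({0..T} \<times> UNIV) (\<lambda>p :: real \<times> 'd torus. Gb (snd p))"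
      by (rule continuous_on_compose2[OF cont(2)]) (auto intro!: continuous_intros)
  qed (use sde0 X0m cont HH[OF FG(1)] in \<open>auto simp: sde_solution_def\<close>)
  then have \<beta>_cont: "continuous_on ({0..T} \<times> UNIV) (\<lambda>(t, x). \<beta> t x)"
    by (rule continuous_on_eq) (auto simp: \<beta>)
  \<comment> \<open>One \<open>L\<close> comes from \<open>Gb\<close>, the other from averaging
    translates of \<open>Fb\<close>.\<close>
  have \<beta>_lip: "norm (\<beta> t x - \<beta> t y) \<le> (2 * L) * dist x y" if t: "t \<in> {0..T}" for t x y
  proof -
    have [measurable]: "X0 t \<in> borel_measurable M0" using t by (rule X0m)
    have int: "integrable M0 (\<lambda>\<omega>. Fb (z - X0 t \<omega>))" for z
      using HH[OF FG(1)] by (intro B0.integrable_const_bound[where B = B]) auto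
    have "norm (\<integral>\<omega>. Fb (x - X0 t \<omega>) - Fb (y - X0 t \<omega>) \<partial>M0) \<le> L * dist x y"
    proof (rule B0.mean_kernel_bound)
      fix \<omega>
      show "norm (Fb (x - X0 t \<omega>) - Fb (y - X0 t \<omega>)) \<le> L * dist x y"
        using lipschitz_onD[OF L(1), of "x - X0 t \<omega>" "y - X0 t \<omega>"] by (simp add: dist_norm[of "Fb _"])
    qed measurable
    moreover have "\<beta> t x - \<beta> t y = (Gb x - Gb y) + (\<integral>\<omega>. Fb (x - X0 t \<omega>) - Fb (y - X0 t \<omega>) \<partial>M0)"
      using int by (simp add: \<beta>[OF t])
    moreover have "norm (Gb x - Gb y) \<le> L * dist x y"
      using lipschitz_onD[OF L(2), of x y] by (simp add: dist_norm)
    ultimately show ?thesis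
      using norm_triangle_ineq[of "Gb x - Gb y" "\<integral>\<omega>. Fb (x - X0 t \<omega>) - Fb (y - X0 t \<omega>) \<partial>M0"] by simp
  qed
  have L0: "0 \<le> 2 * L" using lipschitz_on_nonneg[OF L(1)] by simp
  have \<beta>_meas: "\<forall>t\<in>{0..T}. \<beta> t \<in> borel_measurable borel"
  proof
    fix t assume t: "t \<in> {0..T}"
    have "continuous_on UNIV (\<lambda>x. (\<lambda>(t, x). \<beta> t x) (t, x))"
      using t by (intro continuous_on_compose2[OF \<beta>_cont]) (auto intro!: continuous_intros)
    then show "\<beta> t \<in> borel_measurable borel" by (simp add: borel_measurable_continuous_onI)
  qed
  show ?thesis
  \<comment> \<open>The Euler grid needs \<open>0 < t\<close>; at time \<open>0\<close> the claim is
    the equality of the initial laws.\<close>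
  proof (cases "t = 0")
    case True
    have "(\<integral>\<omega>. f (X 0 \<omega>) \<partial>M) = integral\<^sup>L (distr M borel (X 0)) f"
      using Xm[of 0] T by (subst integral_distr) auto
    also have "\<dots> = (\<integral>\<omega>. f (X0 0 \<omega>) \<partial>M0)"
      unfolding init using X0m[of 0] T by (subst integral_distr) auto
    finally show ?thesis using True by simp
  next
    case False
    then have t: "0 < t" "t \<le> T" using t by auto
    define e where "e m \<omega> = euler_process \<beta> t m W (X 0) (Suc m) \<omega>" for m \<omega>
    define e0 where "e0 m \<omega> = euler_process \<beta> t m W0 (X0 0) (Suc m) \<omega>" for m \<omega>
    have init_F: "X 0 \<in> borel_measurable (F 0)" "X0 0 \<in> borel_measurable (F0 0)"
      using sde sde0 T by (auto simp: sde_solution_def)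
    have em: "e m \<in> borel_measurable M" for m
      unfolding e_def using t by (intro B.measurable_F[OF B.euler_measurable[OF \<beta>_meas init_F(1)]]) auto
    have e0m: "e0 m \<in> borel_measurable M0" for m
      unfolding e0_def using t by (intro B0.measurable_F[OF B0.euler_measurable[OF \<beta>_meas init_F(2)]]) auto
    have "distr M borel (e m) = distr M0 borel (e0 m)" for m
      unfolding e_def e0_def by (rule euler_law[OF br br0 \<beta>_meas init_F init t order_refl])
    then have eq: "(\<integral>\<omega>. f (e m \<omega>) \<partial>M) = (\<integral>\<omega>. f (e0 m \<omega>) \<partial>M0)" for m
      using integral_distr[OF em, of f m] integral_distr[OF e0m, of f m] by simp
    have "AE \<omega> in M. \<forall>t\<in>{0..T}. X t \<omega> = X 0 \<omega> + to_torus (integral {0..t} (\<lambda>s. b (\<mu> s) (X s \<omega>)) + W t \<omega>)"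
      using sde unfolding sde_solution_def by blast
    moreover have "integral {0..t} (\<lambda>s. b (\<mu> s) (X s \<omega>)) = integral {0..t} (\<lambda>s. \<beta> s (X s \<omega>))" if "t \<in> {0..T}" for t \<omega>
      using that by (intro Henstock_Kurzweil_Integration.integral_cong) (auto simp: \<mu> \<beta>_def)
    ultimately have eqX: "AE \<omega> in M. \<forall>t\<in>{0..T}. X t \<omega> = X 0 \<omega> + to_torus (integral {0..t} (\<lambda>s. \<beta> s (X s \<omega>)) + W t \<omega>)"
      by (simp only: cong: ball_cong)
    have "(\<lambda>m. \<integral>\<omega>. f (e m \<omega>) \<partial>M) \<longlonglongrightarrow> (\<integral>\<omega>. f (X t \<omega>) \<partial>M)"
      unfolding e_def
      by (rule B.euler_expectation_tendsto[OF \<beta>_cont \<beta>_meas \<beta>_lip L0 _ _ eqX f t]) (use sde in \<open>auto simp: sde_solution_def\<close>)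
    then have lim: "(\<lambda>m. \<integral>\<omega>. f (e0 m \<omega>) \<partial>M0) \<longlonglongrightarrow> (\<integral>\<omega>. f (X t \<omega>) \<partial>M)"
      unfolding eq .
    have eqX0: "AE \<omega> in M0. \<forall>t\<in>{0..T}. X0 t \<omega> = X0 0 \<omega> + to_torus (integral {0..t} (\<lambda>s. \<beta> s (X0 s \<omega>)) + W0 t \<omega>)"
      using sde0 unfolding sde_solution_def \<beta>_def by blast
    have "(\<lambda>m. \<integral>\<omega>. f (e0 m \<omega>) \<partial>M0) \<longlonglongrightarrow> (\<integral>\<omega>. f (X0 t \<omega>) \<partial>M0)"
      unfolding e0_def
      by (rule B0.euler_expectation_tendsto[OF \<beta>_cont \<beta>_meas \<beta>_lip L0 _ _ eqX0 f t]) (use sde0 in \<open>auto simp: sde_solution_def\<close>)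
    with lim show ?thesis by (rule LIMSEQ_unique)
  qed
qed

section \<open>Sub-Gaussian sums\<close>

abbreviation exp_moment :: "'a measure \<Rightarrow> ('a \<Rightarrow> real) \<Rightarrow> ennreal" where
  "exp_moment M Z \<equiv> \<integral>\<^sup>+\<omega>. ennreal (exp (Z \<omega>)) \<partial>M"

text \<open>Hoeffding's lemma for an interval of length \<open>2 * c\<close>; a negative
  \<open>s\<close> is reduced to a positive one by passing to \<open>- f\<close>.\<close>

lemma (in prob_space) Hoeffding_symmetric:
  assumes f[measurable]: "f \<in> borel_measurable M" and b: "\<And>x. x \<in> space M \<Longrightarrow> \<bar>f x\<bar> \<le> (c :: real)"
    and 0: "expectation f = 0"
  shows "(\<integral>\<^sup>+x. ennreal (exp (s * f x)) \<partial>M) \<le> ennreal (exp (s\<^sup>2 * c\<^sup>2 / 2))"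
proof -
  have pos: "(\<integral>\<^sup>+x. ennreal (exp (l * g x)) \<partial>M) \<le> ennreal (exp (l\<^sup>2 * c\<^sup>2 / 2))"
    if "0 < l" "g \<in> borel_measurable M" "\<And>x. x \<in> space M \<Longrightarrow> \<bar>g x\<bar> \<le> c" "expectation g = 0" for l and g :: "'a \<Rightarrow> real"
  proof -
    interpret interval_bounded_random_variable M g "- c" c
    proof unfold_locales
      show "g \<in> borel_measurable M" by (rule that(2))
      show "AE x in M. g x \<in> {- c..c}"
      proof (rule AE_I2)
        fix x assume "x \<in> space M"
        from that(3)[OF this] show "g x \<in> {- c..c}" by (simp add: abs_le_iff)
      qed
    qed
    have "l\<^sup>2 * (c - - c)\<^sup>2 / 8 = l\<^sup>2 * c\<^sup>2 / 2" by (simp add: power2_eq_square)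
    with Hoeffdings_lemma_nn_integral_0[OF that(1,4)] show ?thesis by (simp only:)
  qed
  consider "s = 0" | "s > 0" | "s < 0" by linarith
  then show ?thesis
  proof cases
    case 1
    then show ?thesis by (simp add: emeasure_space_1)
  next
    case 2
    then show ?thesis using pos[of s f] b 0 by simp
  next
    case 3
    then show ?thesis using pos[of "- s" "\<lambda>x. - f x"] b 0 by simp
  qed
qed

text \<open>In the product law the coordinate \<open>i\<close> is integrated last. For each frozen
  value \<open>y\<close> of \<open>Y i\<close> the summands are independent and centred, so the
  moment factorises and Hoeffding's lemma bounds every factor.\<close>

lemma (in prob_space) exp_sum_conditionally_centred:
  fixes Y :: "'i \<Rightarrow> 'a \<Rightarrow> 'b::second_countable_topology" and \<kappa> :: "'b \<Rightarrow> 'b \<Rightarrow> real"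
  assumes J: "finite J" "i \<notin> J"
    and ind: "indep_vars (\<lambda>_. borel) Y (insert i J)"
    and \<kappa>[measurable]: "(\<lambda>(x, y). \<kappa> x y) \<in> borel_measurable (borel \<Otimes>\<^sub>M borel)"
    and b: "\<And>x y. \<bar>\<kappa> x y\<bar> \<le> c"
    and 0: "\<And>x j. j \<in> J \<Longrightarrow> (\<integral>\<omega>. \<kappa> x (Y j \<omega>) \<partial>M) = 0"
  shows "exp_moment M (\<lambda>\<omega>. s * (\<Sum>j\<in>J. \<kappa> (Y i \<omega>) (Y j \<omega>))) \<le> ennreal (exp (real (card J) * (s\<^sup>2 * c\<^sup>2 / 2)))"
proof -
  let ?I = "insert i J"
  have Y[measurable]: "Y j \<in> borel_measurable M" if "j \<in> ?I" for j
    using ind that by (auto simp: indep_vars_def)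
  \<comment> \<open>Outside the index set an arbitrary Dirac law is filled in, since
    \<open>product_sigma_finite\<close> speaks about every index.\<close>
  define \<nu> where "\<nu> j = (if j \<in> ?I then distr M borel (Y j) else return borel undefined)" for j
  have ps: "prob_space (\<nu> j)" for j
    by (auto simp: \<nu>_def intro!: prob_space_distr prob_space_return Y)
  interpret P: product_sigma_finite \<nu>
    using prob_space_imp_sigma_finite[OF ps] by (simp add: product_sigma_finite_def)
  have sets_\<nu>[measurable_cong, simp]: "sets (\<nu> j) = sets borel" for j by (simp add: \<nu>_def)
  have law: "distr M (\<Pi>\<^sub>M j\<in>?I. borel) (\<lambda>\<omega>. \<lambda>j\<in>?I. Y j \<omega>) = Pi\<^sub>M ?I \<nu>"
    using indep_vars_iff_distr_eq_PiM'[of ?I Y "\<lambda>_. borel"] ind Y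
    by (auto simp: \<nu>_def intro!: PiM_cong)
  define g where "g x = ennreal (exp (s * (\<Sum>j\<in>J. \<kappa> (x i) (x j))))" for x
  have \<kappa>': "(\<lambda>x. \<kappa> (x i) (x j)) \<in> borel_measurable (Pi\<^sub>M ?I (\<lambda>_. borel))" if "j \<in> J" for j
  proof -
    have "(\<lambda>x. (x i, x j)) \<in> measurable (Pi\<^sub>M ?I (\<lambda>_. borel)) (borel \<Otimes>\<^sub>M borel)"
      using that by (intro measurable_Pair measurable_component_singleton) auto
    from measurable_compose[OF this \<kappa>] show ?thesis by simp
  qed
  have g: "g \<in> borel_measurable (Pi\<^sub>M ?I (\<lambda>_. borel))"
    unfolding g_def using \<kappa>' by measurable
  have g': "g \<in> borel_measurable (Pi\<^sub>M ?I \<nu>)"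
    using g by (simp cong: measurable_cong_sets sets_PiM_cong)
  have "exp_moment M (\<lambda>\<omega>. s * (\<Sum>j\<in>J. \<kappa> (Y i \<omega>) (Y j \<omega>))) = (\<integral>\<^sup>+\<omega>. g (\<lambda>j\<in>?I. Y j \<omega>) \<partial>M)"
    by (simp add: g_def)
  also have "\<dots> = (\<integral>\<^sup>+x. g x \<partial>Pi\<^sub>M ?I \<nu>)"
    unfolding law[symmetric] using g by (subst nn_integral_distr) (auto intro!: measurable_restrict Y)
  also have "\<dots> = (\<integral>\<^sup>+y. \<integral>\<^sup>+x. g (x(i := y)) \<partial>Pi\<^sub>M J \<nu> \<partial>\<nu> i)"
    by (rule P.product_nn_integral_insert_rev[OF J g'])
  also have "\<dots> \<le> (\<integral>\<^sup>+y. ennreal (exp (real (card J) * (s\<^sup>2 * c\<^sup>2 / 2))) \<partial>\<nu> i)"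
  proof (rule nn_integral_mono)
    fix y
    have \<kappa>y[measurable]: "\<kappa> y \<in> borel_measurable borel"
      using measurable_compose[OF measurable_Pair1'[of y borel borel] \<kappa>] by simp
    have "(\<integral>\<^sup>+x. g (x(i := y)) \<partial>Pi\<^sub>M J \<nu>) = (\<integral>\<^sup>+x. (\<Prod>j\<in>J. ennreal (exp (s * \<kappa> y (x j)))) \<partial>Pi\<^sub>M J \<nu>)"
    proof (rule nn_integral_cong)
      fix x
      have "(\<Sum>j\<in>J. \<kappa> y ((x(i := y)) j)) = (\<Sum>j\<in>J. \<kappa> y (x j))"
        using J by (intro sum.cong) auto
      then show "g (x(i := y)) = (\<Prod>j\<in>J. ennreal (exp (s * \<kappa> y (x j))))"
        using J by (simp add: g_def prod_ennreal exp_sum sum_distrib_left)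
    qed
    also have "\<dots> = (\<Prod>j\<in>J. \<integral>\<^sup>+z. ennreal (exp (s * \<kappa> y z)) \<partial>\<nu> j)"
      by (rule P.product_nn_integral_prod[OF J(1)]) measurable
    also have "\<dots> \<le> (\<Prod>j\<in>J. ennreal (exp (s\<^sup>2 * c\<^sup>2 / 2)))"
    proof (rule prod_mono_ennreal)
      fix j assume j: "j \<in> J"
      have "(\<integral>\<^sup>+z. ennreal (exp (s * \<kappa> y z)) \<partial>\<nu> j) = exp_moment M (\<lambda>\<omega>. s * \<kappa> y (Y j \<omega>))"
        using j by (simp add: \<nu>_def nn_integral_distr)
      also have "\<dots> \<le> ennreal (exp (s\<^sup>2 * c\<^sup>2 / 2))"
        using j b by (intro Hoeffding_symmetric 0) auto
      finally show "(\<integral>\<^sup>+z. ennreal (exp (s * \<kappa> y z)) \<partial>\<nu> j) \<le> ennreal (exp (s\<^sup>2 * c\<^sup>2 / 2))" .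
    qed
    also have "\<dots> = ennreal (exp (real (card J) * (s\<^sup>2 * c\<^sup>2 / 2)))"
      unfolding exp_of_nat_mult by (simp add: ennreal_power)
    finally show "(\<integral>\<^sup>+x. g (x(i := y)) \<partial>Pi\<^sub>M J \<nu>) \<le> ennreal (exp (real (card J) * (s\<^sup>2 * c\<^sup>2 / 2)))" .
  qed
  also have "\<dots> = ennreal (exp (real (card J) * (s\<^sup>2 * c\<^sup>2 / 2)))"
    using prob_space.emeasure_space_1[OF ps[of i]] by simp
  finally show ?thesis .
qed

text \<open>Linearising the square with an auxiliary Gaussian variable turns the bound on the
  exponential moments into a bound on the square.\<close>

lemma (in prob_space) exp_square_of_sub_gaussian:
  assumes D[measurable]: "D \<in> borel_measurable M" and v: "0 < v"
    and sub: "\<And>s. exp_moment M (\<lambda>\<omega>. s * D \<omega>) \<le> ennreal (exp (s\<^sup>2 * v / 2))"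
  shows "exp_moment M (\<lambda>\<omega>. (D \<omega>)\<^sup>2 / (4 * v)) \<le> ennreal (sqrt 2)"
proof -
  \<comment> \<open>With this \<open>a\<close> the wanted exponent is
    \<open>(a * D \<omega>)\<^sup>2 / 2\<close>, while \<open>a\<^sup>2 * v = 1 / 2\<close> leaves
    \<open>exp (z\<^sup>2 / 4)\<close>, which is still integrable against the Gaussian.\<close>
  define a where "a = 1 / sqrt (2 * v)"
  have a2: "a\<^sup>2 = 1 / (2 * v)" using v by (simp add: a_def power_divide)
  interpret P: pair_sigma_finite lborel M ..
  have "exp_moment M (\<lambda>\<omega>. (D \<omega>)\<^sup>2 / (4 * v)) =
      (\<integral>\<^sup>+\<omega>. \<integral>\<^sup>+z. ennreal (std_normal_density z * exp ((a * D \<omega>) * z)) \<partial>lborel \<partial>M)"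
    using nn_integral_exp_normal[of 1] by (simp add: power_mult_distrib a2)
  also have "\<dots> = (\<integral>\<^sup>+z. \<integral>\<^sup>+\<omega>. ennreal (std_normal_density z * exp ((a * D \<omega>) * z)) \<partial>M \<partial>lborel)"
    by (rule P.Fubini') measurable
  also have "\<dots> = (\<integral>\<^sup>+z. ennreal (std_normal_density z) * exp_moment M (\<lambda>\<omega>. (a * z) * D \<omega>) \<partial>lborel)"
    by (subst nn_integral_cmult[symmetric]) (auto simp: ennreal_mult' mult_ac)
  also have "\<dots> \<le> (\<integral>\<^sup>+z. ennreal (std_normal_density z * exp (z\<^sup>2 / 4)) \<partial>lborel)"
  proof (rule nn_integral_mono)
    fix z
    have "exp_moment M (\<lambda>\<omega>. (a * z) * D \<omega>) \<le> ennreal (exp ((a * z)\<^sup>2 * v / 2))" by (rule sub)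
    also have "(a * z)\<^sup>2 * v / 2 = z\<^sup>2 / 4" using v by (simp add: power_mult_distrib a2)
    finally show "ennreal (std_normal_density z) * exp_moment M (\<lambda>\<omega>. (a * z) * D \<omega>)
        \<le> ennreal (std_normal_density z * exp (z\<^sup>2 / 4))"
      by (simp add: ennreal_mult' mult_left_mono)
  qed
  also have "\<dots> = ennreal (sqrt 2)" by (rule nn_integral_exp_square_normal)
  finally show ?thesis .
qed

lemma exp_sum_le_mean:
  fixes x :: "'k \<Rightarrow> real"
  assumes "finite K" "K \<noteq> {}"
  shows "exp (\<Sum>k\<in>K. x k) \<le> (\<Sum>k\<in>K. exp (real (card K) * x k)) / real (card K)"
proof -
  have c: "0 < real (card K)" using assms by (simp add: card_gt_0_iff)
  have "exp (\<Sum>k\<in>K. (1 / real (card K)) *\<^sub>R (real (card K) * x k)) \<le> (\<Sum>k\<in>K. (1 / real (card K)) * exp (real (card K) * x k))"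
    by (rule convex_on_sum[OF assms exp_convex]) (use c in auto)
  then show ?thesis using c by (simp add: sum_divide_distrib)
qed

text \<open>Jensen's inequality for the average of the variables \<open>card K * x k\<close>. The
  summands may depend on each other in any way; the price is the factor \<open>card K\<close> in the
  exponents.\<close>

lemma (in prob_space) nn_integral_exp_sum_le:
  fixes x :: "'k \<Rightarrow> 'a \<Rightarrow> real"
  assumes K: "finite K" "K \<noteq> {}" and [measurable]: "\<And>k. k \<in> K \<Longrightarrow> x k \<in> borel_measurable M"
    and le: "\<And>k. k \<in> K \<Longrightarrow> exp_moment M (\<lambda>\<omega>. real (card K) * x k \<omega>) \<le> ennreal c"
  shows "exp_moment M (\<lambda>\<omega>. \<Sum>k\<in>K. x k \<omega>) \<le> ennreal c"
proof -
  have c: "0 < real (card K)" using K by (simp add: card_gt_0_iff)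
  obtain k where "k \<in> K" using K by blast
  have "exp_moment M (\<lambda>\<omega>. \<Sum>k\<in>K. x k \<omega>) \<le>
      (\<integral>\<^sup>+\<omega>. ennreal (1 / real (card K)) * (\<Sum>k\<in>K. ennreal (exp (real (card K) * x k \<omega>))) \<partial>M)"
  proof (rule nn_integral_mono)
    fix \<omega>
    have "ennreal (exp (\<Sum>k\<in>K. x k \<omega>)) \<le> ennreal (1 / real (card K) * (\<Sum>k\<in>K. exp (real (card K) * x k \<omega>)))"
      using exp_sum_le_mean[OF K, of "\<lambda>k. x k \<omega>"] by (intro ennreal_leI) simp
    also have "\<dots> = ennreal (1 / real (card K)) * ennreal (\<Sum>k\<in>K. exp (real (card K) * x k \<omega>))"
      by (rule ennreal_mult) (auto intro: sum_nonneg)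
    finally show "ennreal (exp (\<Sum>k\<in>K. x k \<omega>)) \<le>
        ennreal (1 / real (card K)) * (\<Sum>k\<in>K. ennreal (exp (real (card K) * x k \<omega>)))"
      by (simp add: sum_ennreal)
  qed
  also have "\<dots> = ennreal (1 / real (card K)) * (\<Sum>k\<in>K. \<integral>\<^sup>+\<omega>. ennreal (exp (real (card K) * x k \<omega>)) \<partial>M)"
    by (subst nn_integral_cmult) (auto intro!: borel_measurable_sum simp: nn_integral_sum simp del: sum_ennreal)
  also have "\<dots> \<le> ennreal (1 / real (card K)) * (\<Sum>k\<in>K. ennreal c)"
    by (intro mult_left_mono sum_mono le) auto
  also have "\<dots> = ennreal c"
    using c by (simp add: ennreal_of_nat_eq_real_of_nat mult.assoc[symmetric] ennreal_mult'[symmetric])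
  finally show ?thesis .
qed

text \<open>Each coordinate is sub-Gaussian by \<open>exp_sum_conditionally_centred\<close>;
  Jensen's inequality over the coordinates combines them and produces the factor
  \<open>CARD('d)\<close>. The number \<open>n\<close> is an upper bound for \<open>card J\<close>,
  so that \<open>N\<close> can stand in for \<open>N - 1\<close> summands.\<close>

lemma (in prob_space) exp_norm_square_conditionally_centred:
  fixes Y :: "'i \<Rightarrow> 'a \<Rightarrow> 'b::second_countable_topology" and \<kappa> :: "'b \<Rightarrow> 'b \<Rightarrow> real ^ 'd::finite"
  assumes J: "finite J" "i \<notin> J" "card J \<le> n" "0 < n"
    and ind: "indep_vars (\<lambda>_. borel) Y (insert i J)"
    and \<kappa>[measurable]: "(\<lambda>(x, y). \<kappa> x y) \<in> borel_measurable (borel \<Otimes>\<^sub>M borel)"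
    and b: "\<And>x y. norm (\<kappa> x y) \<le> c" and c: "0 < c"
    and 0: "\<And>x j. j \<in> J \<Longrightarrow> (\<integral>\<omega>. \<kappa> x (Y j \<omega>) \<partial>M) = 0"
  shows "exp_moment M (\<lambda>\<omega>. (norm (\<Sum>j\<in>J. \<kappa> (Y i \<omega>) (Y j \<omega>)))\<^sup>2 / (4 * real CARD('d) * real n * c\<^sup>2))
    \<le> ennreal (sqrt 2)"
proof -
  have Y[measurable]: "Y j \<in> borel_measurable M" if "j \<in> insert i J" for j
    using ind that by (auto simp: indep_vars_def)
  define D where "D \<omega> = (\<Sum>j\<in>J. \<kappa> (Y i \<omega>) (Y j \<omega>))" for \<omega>
  have \<kappa>': "(\<lambda>\<omega>. \<kappa> (Y i \<omega>) (Y j \<omega>)) \<in> borel_measurable M" if "j \<in> J" for j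
  proof -
    have "(\<lambda>\<omega>. (Y i \<omega>, Y j \<omega>)) \<in> measurable M (borel \<Otimes>\<^sub>M borel)"
      using Y[of i] Y[of j] that by (intro measurable_Pair) auto
    from measurable_compose[OF this \<kappa>] show ?thesis by simp
  qed
  have D[measurable]: "D \<in> borel_measurable M"
    unfolding D_def using \<kappa>' by measurable
  have \<kappa>x[measurable]: "\<kappa> x \<in> borel_measurable borel" for x
    using measurable_compose[OF measurable_Pair1'[of x borel borel] \<kappa>] by simp
  have comp: "exp_moment M (\<lambda>\<omega>. (D \<omega> $ a)\<^sup>2 / (4 * (real n * c\<^sup>2))) \<le> ennreal (sqrt 2)" for a
  proof (rule exp_square_of_sub_gaussian)
    show "(\<lambda>\<omega>. D \<omega> $ a) \<in> borel_measurable M" by (rule measurable_compose[OF D]) simp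
    show "0 < real n * c\<^sup>2" using J c by simp
    fix s
    have "exp_moment M (\<lambda>\<omega>. s * (\<Sum>j\<in>J. (\<lambda>x y. \<kappa> x y $ a) (Y i \<omega>) (Y j \<omega>))) \<le> ennreal (exp (real (card J) * (s\<^sup>2 * c\<^sup>2 / 2)))"
    proof (rule exp_sum_conditionally_centred[OF J(1,2) ind])
      show "(\<lambda>(x, y). \<kappa> x y $ a) \<in> borel_measurable (borel \<Otimes>\<^sub>M borel)"
        using measurable_compose[OF \<kappa>, of "\<lambda>v. v $ a" borel] by (simp add: split_beta')
      show "\<bar>\<kappa> x y $ a\<bar> \<le> c" for x y
        using component_le_norm_cart[of "\<kappa> x y" a] b[of x y] by linarith
      fix x j assume j: "j \<in> J"
      have [measurable]: "Y j \<in> borel_measurable M" using j by (intro Y) simp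
      have "integrable M (\<lambda>\<omega>. \<kappa> x (Y j \<omega>))"
        using b by (intro integrable_const_bound[where B = c]) auto
      from integral_bounded_linear[OF bounded_linear_vec_nth this, of a]
      show "(\<integral>\<omega>. \<kappa> x (Y j \<omega>) $ a \<partial>M) = 0" using 0[OF j, of x] by simp
    qed
    also have "\<dots> \<le> ennreal (exp (s\<^sup>2 * (real n * c\<^sup>2) / 2))"
    proof -
      have "real (card J) * (s\<^sup>2 * c\<^sup>2 / 2) \<le> real n * (s\<^sup>2 * c\<^sup>2 / 2)"
        using J(3) by (intro mult_right_mono) auto
      then show ?thesis by (intro ennreal_leI) (simp add: mult_ac)
    qed
    finally show "exp_moment M (\<lambda>\<omega>. s * D \<omega> $ a) \<le> ennreal (exp (s\<^sup>2 * (real n * c\<^sup>2) / 2))"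
      by (simp add: D_def sum_component)
  qed
  have sq: "(norm (D \<omega>))\<^sup>2 / (4 * real CARD('d) * real n * c\<^sup>2) = (\<Sum>a\<in>UNIV. (D \<omega> $ a)\<^sup>2 / (4 * real CARD('d) * real n * c\<^sup>2))" for \<omega>
    by (simp add: norm_vec_def L2_set_def sum_nonneg sum_divide_distrib)
  have "exp_moment M (\<lambda>\<omega>. \<Sum>a\<in>UNIV. (D \<omega> $ a)\<^sup>2 / (4 * real CARD('d) * real n * c\<^sup>2)) \<le> ennreal (sqrt 2)"
  proof (rule nn_integral_exp_sum_le)
    fix a :: 'd
    have "real CARD('d) * ((D \<omega> $ a)\<^sup>2 / (4 * real CARD('d) * real n * c\<^sup>2)) = (D \<omega> $ a)\<^sup>2 / (4 * (real n * c\<^sup>2))" for \<omega>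
      by simp
    then show "exp_moment M (\<lambda>\<omega>. real CARD('d) * ((D \<omega> $ a)\<^sup>2 / (4 * real CARD('d) * real n * c\<^sup>2))) \<le> ennreal (sqrt 2)"
      using comp[of a] by (simp only:)
    show "(\<lambda>\<omega>. (D \<omega> $ a)\<^sup>2 / (4 * real CARD('d) * real n * c\<^sup>2)) \<in> borel_measurable M"
      by (intro borel_measurable_divide borel_measurable_power borel_measurable_const measurable_compose[OF D]) simp
  qed simp_all
  then show ?thesis unfolding sq[symmetric] by (simp only: D_def)
qed

section \<open>The exponential martingale of a family of Brownian motions\<close>

locale brownian_family = filtered M F for M :: "'a measure" and F +
  fixes T :: real and I :: "'i set" and W :: "'i \<Rightarrow> real \<Rightarrow> 'a \<Rightarrow> real ^ 'd::finite"
  assumes ibm: "independent_brownian_motions M F T I W"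
    and fin: "finite I" and ne: "I \<noteq> {}"
begin

lemma brownian_component: "i \<in> I \<Longrightarrow> brownian M F T (W i)"
  using ibm by (simp add: brownian_def brownian_axioms_def filtered_axioms independent_brownian_motions_def)

text \<open>The joint increment vector is independent of \<open>F s\<close> and its law is a product
  of Gaussians. With \<open>Z\<close> and all \<open>D i\<close> frozen, the integral factorises
  into Gaussian exponential moments.\<close>

lemma exp_increment:
  assumes st: "0 \<le> s" "s < t" "t \<le> T"
    and Z: "Z \<in> borel_measurable (F s)" and D: "\<And>i. i \<in> I \<Longrightarrow> D i \<in> borel_measurable (F s)"
  shows "(\<integral>\<^sup>+\<omega>. Z \<omega> * ennreal (exp (\<Sum>i\<in>I. D i \<omega> \<bullet> (W i t \<omega> - W i s \<omega>))) \<partial>M) =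
    (\<integral>\<^sup>+\<omega>. Z \<omega> * ennreal (exp (\<Sum>i\<in>I. (t - s) * (norm (D i \<omega>))\<^sup>2 / 2)) \<partial>M)"
proof -
  define N where "N = (\<Pi>\<^sub>M i\<in>I. (borel :: (real ^ 'd) measure))"
  define V where "V \<omega> = (\<lambda>i\<in>I. W i t \<omega> - W i s \<omega>)" for \<omega>
  define f where "f = (\<lambda>(\<omega>, v). Z \<omega> * ennreal (exp (\<Sum>i\<in>I. D i \<omega> \<bullet> v i)))"
  have inc: "(\<lambda>\<omega>. W i t \<omega> - W i s \<omega>) \<in> borel_measurable M" if "i \<in> I" for i
    using brownian.inc_measurable[OF brownian_component[OF that], of s t] st by simp
  have V: "V \<in> measurable M N"
    unfolding V_def N_def by (intro measurable_restrict inc)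
  have ind: "indep_vars (\<lambda>_. borel) (\<lambda>i \<omega>. W i t \<omega> - W i s \<omega>) I"
    and indF: "indep_set (sets (F s)) (sets (vimage_algebra (space M) V N))"
    using ibm st unfolding independent_brownian_motions_def V_def N_def by blast+
  have "distr M N V = (\<Pi>\<^sub>M i\<in>I. distr M borel (\<lambda>\<omega>. W i t \<omega> - W i s \<omega>))"
    unfolding N_def V_def using indep_vars_iff_distr_eq_PiM'[where M' = "\<lambda>_. borel" and X = "\<lambda>i \<omega>. W i t \<omega> - W i s \<omega>", OF ne inc] ind by simp
  also have "\<dots> = (\<Pi>\<^sub>M i\<in>I. gauss (t - s))"
    using brownian.distr_inc[OF brownian_component st] by (intro PiM_cong) auto
  finally have law: "distr M N V = (\<Pi>\<^sub>M i\<in>I. gauss (t - s))" .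
  have g: "prob_space (gauss (t - s) :: (real ^ 'd) measure)" using st by (intro prob_space_gauss) simp
  interpret P: product_sigma_finite "\<lambda>_ :: 'i. gauss (t - s) :: (real ^ 'd) measure"
    using prob_space_imp_sigma_finite[OF g] by (simp add: product_sigma_finite_def)
  have f: "f \<in> borel_measurable (F s \<Otimes>\<^sub>M N)"
  proof -
    have "(\<lambda>p. D i (fst p)) \<in> borel_measurable (F s \<Otimes>\<^sub>M N)" "(\<lambda>p. snd p i) \<in> borel_measurable (F s \<Otimes>\<^sub>M N)" if "i \<in> I" for i
      unfolding N_def by (rule measurable_compose[OF measurable_fst D[OF that]]
          measurable_compose[OF measurable_snd measurable_component_singleton[OF that]])+
    moreover have "(\<lambda>p. Z (fst p)) \<in> borel_measurable (F s \<Otimes>\<^sub>M N)"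
      by (rule measurable_compose[OF measurable_fst Z])
    ultimately have "(\<lambda>p. Z (fst p) * ennreal (exp (\<Sum>i\<in>I. D i (fst p) \<bullet> snd p i))) \<in> borel_measurable (F s \<Otimes>\<^sub>M N)"
      by measurable
    then show ?thesis by (simp add: f_def split_beta')
  qed
  have "(\<integral>\<^sup>+\<omega>. Z \<omega> * ennreal (exp (\<Sum>i\<in>I. D i \<omega> \<bullet> (W i t \<omega> - W i s \<omega>))) \<partial>M) = (\<integral>\<^sup>+\<omega>. f (\<omega>, V \<omega>) \<partial>M)"
    by (simp add: f_def V_def)
  also have "\<dots> = (\<integral>\<^sup>+\<omega>. \<integral>\<^sup>+v. f (\<omega>, v) \<partial>distr M N V \<partial>M)"
    by (rule nn_integral_indep_subalgebra[OF subalg V indF f])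
  also have "\<dots> = (\<integral>\<^sup>+\<omega>. Z \<omega> * ennreal (exp (\<Sum>i\<in>I. (t - s) * (norm (D i \<omega>))\<^sup>2 / 2)) \<partial>M)"
  proof (rule nn_integral_cong)
    fix \<omega>
    have "(\<integral>\<^sup>+v. f (\<omega>, v) \<partial>distr M N V) = (\<integral>\<^sup>+v. Z \<omega> * (\<Prod>i\<in>I. ennreal (exp (D i \<omega> \<bullet> v i))) \<partial>(\<Pi>\<^sub>M i\<in>I. gauss (t - s)))"
      unfolding law f_def by (simp add: exp_sum[OF fin] prod_ennreal)
    also have "\<dots> = Z \<omega> * (\<integral>\<^sup>+v. (\<Prod>i\<in>I. ennreal (exp (D i \<omega> \<bullet> v i))) \<partial>(\<Pi>\<^sub>M i\<in>I. gauss (t - s)))"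
    proof (rule nn_integral_cmult)
      have "(\<lambda>v. D i \<omega> \<bullet> v i) \<in> borel_measurable (\<Pi>\<^sub>M i\<in>I. gauss (t - s))" if "i \<in> I" for i
        by (intro borel_measurable_inner borel_measurable_const measurable_compose[OF measurable_component_singleton[OF that]]) simp
      then show "(\<lambda>v. \<Prod>i\<in>I. ennreal (exp (D i \<omega> \<bullet> v i))) \<in> borel_measurable (\<Pi>\<^sub>M i\<in>I. gauss (t - s))"
        by (intro borel_measurable_prod_ennreal) measurable
    qed
    also have "(\<integral>\<^sup>+v. (\<Prod>i\<in>I. ennreal (exp (D i \<omega> \<bullet> v i))) \<partial>(\<Pi>\<^sub>M i\<in>I. gauss (t - s))) =
        (\<Prod>i\<in>I. \<integral>\<^sup>+x. ennreal (exp (D i \<omega> \<bullet> x)) \<partial>gauss (t - s))"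
      by (rule P.product_nn_integral_prod[OF fin]) simp
    also have "\<dots> = ennreal (exp (\<Sum>i\<in>I. (t - s) * (norm (D i \<omega>))\<^sup>2 / 2))"
      using st by (simp add: nn_integral_exp_gauss prod_ennreal exp_sum[OF fin])
    finally show "(\<integral>\<^sup>+v. f (\<omega>, v) \<partial>distr M N V) = Z \<omega> * ennreal (exp (\<Sum>i\<in>I. (t - s) * (norm (D i \<omega>))\<^sup>2 / 2))" .
  qed
  finally show ?thesis .
qed

text \<open>By \<open>exp_increment\<close> the last noise term integrates to the exponential of its
  compensator, which cancels; this is the induction step. The grid is strictly increasing because
  the law of an increment is specified for \<open>s < t\<close>.\<close>

lemma exponential_martingale:
  assumes \<tau>: "0 \<le> \<tau> 0" "\<And>k. k < n \<Longrightarrow> \<tau> k < \<tau> (Suc k)" "\<tau> n \<le> T"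
    and D: "\<And>i k. i \<in> I \<Longrightarrow> k < n \<Longrightarrow> D k i \<in> borel_measurable (F (\<tau> k))"
  shows "exp_moment M (\<lambda>\<omega>. \<Sum>k<n. \<Sum>i\<in>I. D k i \<omega> \<bullet> (W i (\<tau> (Suc k)) \<omega> - W i (\<tau> k) \<omega>)
      - (\<tau> (Suc k) - \<tau> k) * (norm (D k i \<omega>))\<^sup>2 / 2) = 1"
  using \<tau> D
proof (induction n)
  case 0
  then show ?case by (simp add: emeasure_space_1)
next
  case (Suc n)
  have mono: "l \<le> Suc n \<Longrightarrow> k \<le> l \<Longrightarrow> \<tau> k \<le> \<tau> l" for k l
    using stepwise_mono[of "Suc n" \<tau>] less_imp_le[OF Suc.prems(2)] by blast
  define G where "G k \<omega> = (\<Sum>i\<in>I. D k i \<omega> \<bullet> (W i (\<tau> (Suc k)) \<omega> - W i (\<tau> k) \<omega>)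
      - (\<tau> (Suc k) - \<tau> k) * (norm (D k i \<omega>))\<^sup>2 / 2)" for k \<omega>
  define Q where "Q \<omega> = (\<Sum>i\<in>I. (\<tau> (Suc n) - \<tau> n) * (norm (D n i \<omega>))\<^sup>2 / 2)" for \<omega>
  have pos: "0 \<le> \<tau> k" if "k \<le> Suc n" for k using mono[OF that, of 0] Suc.prems(1) by simp
  have leT: "\<tau> k \<le> T" if "k \<le> Suc n" for k using mono[of "Suc n" k] that Suc.prems(3) by simp
  have "D k i \<in> borel_measurable (F (\<tau> n))" "W i (\<tau> k) \<in> borel_measurable (F (\<tau> n))" "W i (\<tau> (Suc k)) \<in> borel_measurable (F (\<tau> n))"
    if "i \<in> I" "k < n" for i k
  proof -
    show "D k i \<in> borel_measurable (F (\<tau> n))"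
      using that mono[of n k] by (intro measurable_F_mono[OF Suc.prems(4)]) auto
    show "W i (\<tau> k) \<in> borel_measurable (F (\<tau> n))" "W i (\<tau> (Suc k)) \<in> borel_measurable (F (\<tau> n))"
      using that mono[of n k] mono[of n "Suc k"] pos[of k] pos[of "Suc k"] leT[of k] leT[of "Suc k"]
      by (auto intro!: brownian.W_measurable_F[OF brownian_component])
  qed
  then have G: "G k \<in> borel_measurable (F (\<tau> n))" if "k < n" for k
    unfolding G_def using that by measurable
  have Dn: "D n i \<in> borel_measurable (F (\<tau> n))" if "i \<in> I" for i using Suc.prems(4)[OF that, of n] by simp
  have Q: "Q \<in> borel_measurable (F (\<tau> n))"
    unfolding Q_def using Dn by measurable
  have "exp_moment M (\<lambda>\<omega>. \<Sum>k<Suc n. G k \<omega>) =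
      (\<integral>\<^sup>+\<omega>. ennreal (exp ((\<Sum>k<n. G k \<omega>) - Q \<omega>)) * ennreal (exp (\<Sum>i\<in>I. D n i \<omega> \<bullet> (W i (\<tau> (Suc n)) \<omega> - W i (\<tau> n) \<omega>))) \<partial>M)"
  proof (rule nn_integral_cong)
    fix \<omega>
    \<comment> \<open>Everything except the last noise term, its compensator \<open>Q\<close>
      included, is measurable at time \<open>\<tau> n\<close>.\<close>
    have "(\<Sum>k<Suc n. G k \<omega>) = ((\<Sum>k<n. G k \<omega>) - Q \<omega>) + (\<Sum>i\<in>I. D n i \<omega> \<bullet> (W i (\<tau> (Suc n)) \<omega> - W i (\<tau> n) \<omega>))"
      by (simp add: G_def[of n] Q_def sum_subtractf)
    then show "ennreal (exp (\<Sum>k<Suc n. G k \<omega>)) =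
        ennreal (exp ((\<Sum>k<n. G k \<omega>) - Q \<omega>)) * ennreal (exp (\<Sum>i\<in>I. D n i \<omega> \<bullet> (W i (\<tau> (Suc n)) \<omega> - W i (\<tau> n) \<omega>)))"
      by (simp only: exp_add) (simp add: ennreal_mult)
  qed
  also have "\<dots> = (\<integral>\<^sup>+\<omega>. ennreal (exp ((\<Sum>k<n. G k \<omega>) - Q \<omega>)) * ennreal (exp (\<Sum>i\<in>I. (\<tau> (Suc n) - \<tau> n) * (norm (D n i \<omega>))\<^sup>2 / 2)) \<partial>M)"
  proof (rule exp_increment[OF _ _ _ _ Dn])
    show "0 \<le> \<tau> n" "\<tau> n < \<tau> (Suc n)" "\<tau> (Suc n) \<le> T" using pos[of n] Suc.prems by auto
    have "(\<lambda>\<omega>. (\<Sum>k<n. G k \<omega>) - Q \<omega>) \<in> borel_measurable (F (\<tau> n))"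
      using G Q by (intro borel_measurable_diff borel_measurable_sum) auto
    then show "(\<lambda>\<omega>. ennreal (exp ((\<Sum>k<n. G k \<omega>) - Q \<omega>))) \<in> borel_measurable (F (\<tau> n))" by measurable
  qed
  also have "\<dots> = exp_moment M (\<lambda>\<omega>. \<Sum>k<n. G k \<omega>)"
    unfolding Q_def[symmetric] by (simp add: ennreal_mult[symmetric] exp_add[symmetric])
  also have "\<dots> = 1"
    unfolding G_def using mono[of "Suc n" n] Suc.prems by (intro Suc.IH) auto
  finally show ?case by (simp only: G_def)
qed

text \<open>Half of the exponential martingale for \<open>2 D\<close> and half of the exponential of its bracket
  dominate \<open>exp (\<Sum> D \<bullet> dW)\<close>, by \<open>2 x y \<le> x\<^sup>2 + y\<^sup>2\<close>.\<close>

lemma exp_stochastic_sum_le: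
  assumes \<tau>: "0 \<le> \<tau> 0" "\<And>k. k < n \<Longrightarrow> \<tau> k < \<tau> (Suc k)" "\<tau> n \<le> T"
    and D: "\<And>i k. i \<in> I \<Longrightarrow> k < n \<Longrightarrow> D k i \<in> borel_measurable (F (\<tau> k))"
    and Q: "exp_moment M (\<lambda>\<omega>. \<Sum>k<n. \<Sum>i\<in>I. 2 * (\<tau> (Suc k) - \<tau> k) * (norm (D k i \<omega>))\<^sup>2) \<le> ennreal q"
    and q: "0 \<le> q"
  shows "exp_moment M (\<lambda>\<omega>. \<Sum>k<n. \<Sum>i\<in>I. D k i \<omega> \<bullet> (W i (\<tau> (Suc k)) \<omega> - W i (\<tau> k) \<omega>)) \<le> ennreal ((1 + q) / 2)"
proof -
  define S where "S \<omega> = (\<Sum>k<n. \<Sum>i\<in>I. D k i \<omega> \<bullet> (W i (\<tau> (Suc k)) \<omega> - W i (\<tau> k) \<omega>))" for \<omega>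
  \<comment> \<open>Half of the bracket of \<open>2 * S\<close>, which is the compensator in the
    exponential martingale with the integrands \<open>2 *\<^sub>R D k i \<omega>\<close>.\<close>
  define B where "B \<omega> = (\<Sum>k<n. \<Sum>i\<in>I. 2 * (\<tau> (Suc k) - \<tau> k) * (norm (D k i \<omega>))\<^sup>2)" for \<omega>
  have mono: "l \<le> n \<Longrightarrow> k \<le> l \<Longrightarrow> \<tau> k \<le> \<tau> l" for k l
    using stepwise_mono[of n \<tau>] less_imp_le[OF \<tau>(2)] by blast
  have [measurable]: "D k i \<in> borel_measurable M" if "i \<in> I" "k < n" for i k
    using D[OF that] by (rule measurable_F)
  have [measurable]: "W i (\<tau> k) \<in> borel_measurable M" if "i \<in> I" "k \<le> n" for i k
    using brownian.W_measurable[OF brownian_component[OF that(1)]] mono[of n k] mono[of k 0] \<tau> that by simp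
  have Sm: "S \<in> borel_measurable M"
    unfolding S_def by measurable
  have Bm: "B \<in> borel_measurable M"
    unfolding B_def by measurable
  have "(\<Sum>k<n. \<Sum>i\<in>I. (2 *\<^sub>R D k i \<omega>) \<bullet> (W i (\<tau> (Suc k)) \<omega> - W i (\<tau> k) \<omega>)
      - (\<tau> (Suc k) - \<tau> k) * (norm (2 *\<^sub>R D k i \<omega>))\<^sup>2 / 2) = 2 * S \<omega> - B \<omega>" for \<omega>
  proof -
    have "(2 *\<^sub>R D k i \<omega>) \<bullet> (W i (\<tau> (Suc k)) \<omega> - W i (\<tau> k) \<omega>) - (\<tau> (Suc k) - \<tau> k) * (norm (2 *\<^sub>R D k i \<omega>))\<^sup>2 / 2 =
        2 * (D k i \<omega> \<bullet> (W i (\<tau> (Suc k)) \<omega> - W i (\<tau> k) \<omega>)) - 2 * (\<tau> (Suc k) - \<tau> k) * (norm (D k i \<omega>))\<^sup>2" for k i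
      by (simp add: power_mult_distrib)
    then show ?thesis
      unfolding S_def B_def by (simp only: sum_subtractf sum_distrib_left)
  qed
  moreover have "(\<lambda>\<omega>. 2 *\<^sub>R D k i \<omega>) \<in> borel_measurable (F (\<tau> k))" if "i \<in> I" "k < n" for i k
    using D[OF that] by simp
  ultimately have mart: "exp_moment M (\<lambda>\<omega>. 2 * S \<omega> - B \<omega>) = 1"
    using exponential_martingale[OF \<tau>, of "\<lambda>k i \<omega>. 2 *\<^sub>R D k i \<omega>"] by simp
  have "exp_moment M S \<le> (\<integral>\<^sup>+\<omega>. ennreal (1/2) * (ennreal (exp (2 * S \<omega> - B \<omega>)) + ennreal (exp (B \<omega>))) \<partial>M)"
  proof (rule nn_integral_mono)
    fix \<omega>
    have "2 * exp (S \<omega> - B \<omega> / 2) * exp (B \<omega> / 2) \<le> (exp (S \<omega> - B \<omega> / 2))\<^sup>2 + (exp (B \<omega> / 2))\<^sup>2"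
      by (rule sum_squares_bound)
    also have "(exp (S \<omega> - B \<omega> / 2))\<^sup>2 = exp (2 * S \<omega> - B \<omega>)"
      by (simp add: exp_double[symmetric] right_diff_distrib)
    also have "(exp (B \<omega> / 2))\<^sup>2 = exp (B \<omega>)"
      by (simp add: exp_double[symmetric])
    also have "2 * exp (S \<omega> - B \<omega> / 2) * exp (B \<omega> / 2) = 2 * exp (S \<omega>)"
      by (simp add: exp_add[symmetric])
    finally have "exp (S \<omega>) \<le> 1/2 * (exp (2 * S \<omega> - B \<omega>) + exp (B \<omega>))" by simp
    then have "ennreal (exp (S \<omega>)) \<le> ennreal (1/2 * (exp (2 * S \<omega> - B \<omega>) + exp (B \<omega>)))" by (rule ennreal_leI)
    also have "\<dots> = ennreal (1/2) * ennreal (exp (2 * S \<omega> - B \<omega>) + exp (B \<omega>))" by (rule ennreal_mult) auto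
    also have "ennreal (exp (2 * S \<omega> - B \<omega>) + exp (B \<omega>)) = ennreal (exp (2 * S \<omega> - B \<omega>)) + ennreal (exp (B \<omega>))"
      by (rule ennreal_plus) auto
    finally show "ennreal (exp (S \<omega>)) \<le> ennreal (1/2) * (ennreal (exp (2 * S \<omega> - B \<omega>)) + ennreal (exp (B \<omega>)))" .
  qed
  also have "\<dots> = ennreal (1/2) * (exp_moment M (\<lambda>\<omega>. 2 * S \<omega> - B \<omega>) + exp_moment M B)"
    using Sm Bm by (subst nn_integral_cmult) (auto simp: nn_integral_add)
  also have "\<dots> \<le> ennreal (1/2) * (1 + ennreal q)"
    unfolding mart using Q by (intro mult_left_mono add_left_mono) (auto simp: B_def)
  also have "1 + ennreal q = ennreal (1 + q)" using q by (simp add: ennreal_plus)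
  also have "ennreal (1/2) * ennreal (1 + q) = ennreal (1/2 * (1 + q))" using q by (intro ennreal_mult[symmetric]) auto
  finally show ?thesis by (simp add: S_def)
qed

end

section \<open>The exponential moment of the U-statistic\<close>

lemma sq_dist_tendsto_sum:
  fixes f :: "'k \<Rightarrow> nat \<Rightarrow> 'a \<Rightarrow> real"
  assumes "finite K" and "\<And>k m. k \<in> K \<Longrightarrow> f k m \<in> borel_measurable M" "\<And>k. k \<in> K \<Longrightarrow> Y k \<in> borel_measurable M"
    and "\<And>k. k \<in> K \<Longrightarrow> (\<lambda>m. sq_dist M (f k m) (Y k)) \<longlonglongrightarrow> 0"
  shows "(\<lambda>m. sq_dist M (\<lambda>\<omega>. \<Sum>k\<in>K. f k m \<omega>) (\<lambda>\<omega>. \<Sum>k\<in>K. Y k \<omega>)) \<longlonglongrightarrow> 0"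
  using assms
proof (induction K)
  case empty
  then show ?case by (simp add: sq_dist_def)
next
  case (insert a K)
  have a: "f a m \<in> borel_measurable M" "Y a \<in> borel_measurable M" "(\<lambda>m. sq_dist M (f a m) (Y a)) \<longlonglongrightarrow> 0" for m
    using insert.prems by blast+
  have IH: "(\<lambda>m. sq_dist M (\<lambda>\<omega>. \<Sum>k\<in>K. f k m \<omega>) (\<lambda>\<omega>. \<Sum>k\<in>K. Y k \<omega>)) \<longlonglongrightarrow> 0"
    using insert.prems by (intro insert.IH) auto
  have m: "(\<lambda>\<omega>. \<Sum>k\<in>K. f k m \<omega>) \<in> borel_measurable M" "(\<lambda>\<omega>. \<Sum>k\<in>K. Y k \<omega>) \<in> borel_measurable M" for m
    using insert.prems by (auto intro!: borel_measurable_sum)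
  have "(\<lambda>m. sq_dist M (\<lambda>\<omega>. f a m \<omega> + (\<Sum>k\<in>K. f k m \<omega>)) (\<lambda>\<omega>. Y a \<omega> + (\<Sum>k\<in>K. Y k \<omega>))) \<longlonglongrightarrow> 0"
  proof (rule sq_dist_tendsto_triangle[where k = "\<lambda>m \<omega>. Y a \<omega> + (\<Sum>k\<in>K. f k m \<omega>)"])
    show "(\<lambda>m. sq_dist M (\<lambda>\<omega>. f a m \<omega> + (\<Sum>k\<in>K. f k m \<omega>)) (\<lambda>\<omega>. Y a \<omega> + (\<Sum>k\<in>K. f k m \<omega>))) \<longlonglongrightarrow> 0"
      using a(3) by (simp add: sq_dist_def)
    show "(\<lambda>m. sq_dist M (\<lambda>\<omega>. Y a \<omega> + (\<Sum>k\<in>K. f k m \<omega>)) (\<lambda>\<omega>. Y a \<omega> + (\<Sum>k\<in>K. Y k \<omega>))) \<longlonglongrightarrow> 0"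
      using IH by (simp add: sq_dist_def)
  qed (use m a in simp_all)
  then show ?case using insert.hyps by simp
qed

text \<open>Mean square convergence alone does not control exponential moments; the uniform bound
  \<open>c\<close> survives by Fatou's lemma along an almost everywhere convergent
  subsequence.\<close>

lemma (in prob_space) exp_moment_of_sq_limit:
  fixes S :: "nat \<Rightarrow> 'a \<Rightarrow> real"
  assumes [measurable]: "\<And>m. S m \<in> borel_measurable M" "Y \<in> borel_measurable M"
    and lim: "(\<lambda>m. sq_dist M (S m) Y) \<longlonglongrightarrow> 0"
    and le: "\<And>m. exp_moment M (\<lambda>\<omega>. a * S m \<omega>) \<le> c"
  shows "exp_moment M (\<lambda>\<omega>. a * Y \<omega>) \<le> c"
proof -
  obtain r :: "nat \<Rightarrow> nat" where r: "AE \<omega> in M. (\<lambda>k. S (r k) \<omega>) \<longlonglongrightarrow> Y \<omega>"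
    using sq_dist_AE_subseq[OF assms(1,2) lim] by blast
  have "exp_moment M (\<lambda>\<omega>. a * Y \<omega>) = (\<integral>\<^sup>+\<omega>. liminf (\<lambda>k. ennreal (exp (a * S (r k) \<omega>))) \<partial>M)"
  proof (rule nn_integral_cong_AE)
    show "AE \<omega> in M. ennreal (exp (a * Y \<omega>)) = liminf (\<lambda>k. ennreal (exp (a * S (r k) \<omega>)))"
      using r
    proof eventually_elim
      case (elim \<omega>)
      then have "(\<lambda>k. ennreal (exp (a * S (r k) \<omega>))) \<longlonglongrightarrow> ennreal (exp (a * Y \<omega>))"
        by (intro tendsto_ennrealI tendsto_exp tendsto_mult tendsto_const)
      from lim_imp_Liminf[OF sequentially_bot this] show ?case by (rule sym)
    qed
  qed
  also have "\<dots> \<le> liminf (\<lambda>k. \<integral>\<^sup>+\<omega>. ennreal (exp (a * S (r k) \<omega>)) \<partial>M)"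
    by (rule nn_integral_liminf) measurable
  also have "\<dots> \<le> c"
    by (rule Liminf_le) (simp_all add: le)
  finally show ?thesis .
qed

text \<open>This isolates what the estimate uses. \<open>\<kappa>\<close> will be a difference of
  two interaction kernels, hence the bound \<open>2 * B\<close>, and centring gives
  \<open>4 * B\<close> for \<open>\<xi>\<close>. Independence is recorded separately at each time,
  and \<open>K\<close> is the scale fixed in \<open>riemann_total_exp\<close>.\<close>

locale mean_field = brownian_family M F T "{1..N}" W
  for M :: "'a measure" and F T and N :: nat and W :: "nat \<Rightarrow> real \<Rightarrow> 'a \<Rightarrow> real ^ 'd::finite" +
  fixes X :: "nat \<Rightarrow> real \<Rightarrow> 'a \<Rightarrow> 'd torus" and \<kappa> :: "'d torus \<Rightarrow> real ^ 'd"
    and \<kappa>_mean :: "real \<Rightarrow> 'd torus \<Rightarrow> real ^ 'd" and \<xi> :: "nat \<Rightarrow> nat \<Rightarrow> real \<Rightarrow> 'a \<Rightarrow> real ^ 'd" and B K :: real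
  assumes T: "0 < T" and B: "0 < B" and K: "K = sqrt (128 * real CARD('d) * T)"
    and X_adapted: "i \<in> {1..N} \<Longrightarrow> t \<in> {0..T} \<Longrightarrow> X i t \<in> borel_measurable (F t)"
    and X_cont: "i \<in> {1..N} \<Longrightarrow> \<omega> \<in> space M \<Longrightarrow> continuous_on {0..T} (\<lambda>t. X i t \<omega>)"
    and X_indep: "t \<in> {0..T} \<Longrightarrow> indep_vars (\<lambda>_. borel) (\<lambda>i. X i t) {1..N}"
    and \<kappa>_cont: "continuous_on UNIV \<kappa>" and \<kappa>_bound: "norm (\<kappa> x) \<le> 2 * B"
    and \<kappa>_mean_cont: "continuous_on ({0..T} \<times> UNIV) (\<lambda>(t, x). \<kappa>_mean t x)"
    and \<kappa>_mean_bound: "t \<in> {0..T} \<Longrightarrow> norm (\<kappa>_mean t x) \<le> 2 * B"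
    and \<kappa>_mean: "j \<in> {1..N} \<Longrightarrow> t \<in> {0..T} \<Longrightarrow> (\<integral>\<omega>. \<kappa> (x - X j t \<omega>) \<partial>M) = \<kappa>_mean t x"
    and \<xi>: "i \<in> {1..N} \<Longrightarrow> j \<in> {1..N} \<Longrightarrow> t \<in> {0..T} \<Longrightarrow> \<xi> i j t \<omega> = \<kappa> (X i t \<omega> - X j t \<omega>) - \<kappa>_mean t (X i t \<omega>)"
begin

lemma N_pos: "0 < N" using ne by simp

lemma \<kappa>_measurable [measurable]: "\<kappa> \<in> borel_measurable borel"
  using \<kappa>_cont by (rule borel_measurable_continuous_onI)

lemma \<kappa>_mean_measurable:
  assumes t: "t \<in> {0..T}" shows "\<kappa>_mean t \<in> borel_measurable borel"
proof -
  have "continuous_on UNIV (\<lambda>x. (\<lambda>(t, x). \<kappa>_mean t x) (t, x))"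
    using t by (intro continuous_on_compose2[OF \<kappa>_mean_cont]) (auto intro!: continuous_intros)
  then show ?thesis by (simp add: borel_measurable_continuous_onI)
qed

lemma \<xi>_adapted:
  assumes "i \<in> {1..N}" "j \<in> {1..N}" "t \<in> {0..T}"
  shows "\<xi> i j t \<in> borel_measurable (F t)"
proof -
  note [measurable] = X_adapted[OF assms(1,3)] X_adapted[OF assms(2,3)] \<kappa>_mean_measurable[OF assms(3)]
  have "\<xi> i j t = (\<lambda>\<omega>. \<kappa> (X i t \<omega> - X j t \<omega>) - \<kappa>_mean t (X i t \<omega>))"
    using \<xi>[OF assms] by blast
  then show ?thesis by simp
qed

lemma ito_integrand_\<xi>:
  assumes ij: "i \<in> {1..N}" "j \<in> {1..N}"
  shows "ito_integrand M F T (W i) (\<xi> i j) (4 * B)"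
proof -
  interpret brownian M F T "W i" using ij(1) by (rule brownian_component)
  show ?thesis
  proof
    show "0 < T" by (rule T)
    show "\<xi> i j t \<in> borel_measurable (F t)" if "t \<in> {0..T}" for t
      by (rule \<xi>_adapted[OF ij that])
    fix \<omega> assume \<omega>: "\<omega> \<in> space M"
    have "continuous_on {0..T} (\<lambda>t. \<kappa> (X i t \<omega> - X j t \<omega>) - (\<lambda>(t, x). \<kappa>_mean t x) (t, X i t \<omega>))"
    proof (rule continuous_on_diff)
      show "continuous_on {0..T} (\<lambda>t. \<kappa> (X i t \<omega> - X j t \<omega>))"
        by (rule continuous_on_compose2[OF \<kappa>_cont]) (auto intro!: continuous_on_diff X_cont ij \<omega>)
      show "continuous_on {0..T} (\<lambda>t. (\<lambda>(t, x). \<kappa>_mean t x) (t, X i t \<omega>))"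
        by (rule continuous_on_compose2[OF \<kappa>_mean_cont]) (auto intro!: continuous_on_Pair continuous_on_id X_cont ij \<omega>)
    qed
    then show "continuous_on {0..T} (\<lambda>t. \<xi> i j t \<omega>)"
      by (rule continuous_on_eq) (simp add: \<xi>[OF ij])
    fix t assume t: "t \<in> {0..T}"
    show "norm (\<xi> i j t \<omega>) \<le> 4 * B"
      using norm_triangle_ineq4[of "\<kappa> (X i t \<omega> - X j t \<omega>)" "\<kappa>_mean t (X i t \<omega>)"]
        \<kappa>_bound[of "X i t \<omega> - X j t \<omega>"] \<kappa>_mean_bound[OF t, of "X i t \<omega>"]
      by (simp add: \<xi>[OF ij t])
  qed
qed

definition D :: "nat \<Rightarrow> real \<Rightarrow> 'a \<Rightarrow> real ^ 'd" where
  "D i t \<omega> = (\<Sum>j\<in>{1..N} - {i}. \<xi> i j t \<omega>)"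

lemma D_adapted: "i \<in> {1..N} \<Longrightarrow> t \<in> {0..T} \<Longrightarrow> D i t \<in> borel_measurable (F t)"
  unfolding D_def[abs_def] by (intro borel_measurable_sum \<xi>_adapted) auto

lemma D_exp_square:
  assumes i: "i \<in> {1..N}" and t: "t \<in> {0..T}"
  shows "exp_moment M (\<lambda>\<omega>. (norm (D i t \<omega>))\<^sup>2 / (4 * real CARD('d) * real N * (4 * B)\<^sup>2)) \<le> ennreal (sqrt 2)"
proof -
  define k where "k x y = \<kappa> (x - y) - \<kappa>_mean t x" for x y
  note [measurable] = \<kappa>_mean_measurable[OF t]
  have X[measurable]: "X j t \<in> borel_measurable M" if "j \<in> {1..N}" for j
    using X_adapted[OF that t] by (rule measurable_F)
  have "exp_moment M (\<lambda>\<omega>. (norm (\<Sum>j\<in>{1..N} - {i}. k (X i t \<omega>) (X j t \<omega>)))\<^sup>2 / (4 * real CARD('d) * real N * (4 * B)\<^sup>2)) \<le> ennreal (sqrt 2)"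
  proof (rule exp_norm_square_conditionally_centred[where Y = "\<lambda>i. X i t" and \<kappa> = k])
    show "indep_vars (\<lambda>_. borel) (\<lambda>i. X i t) (insert i ({1..N} - {i}))"
      using X_indep[OF t] i by (simp add: insert_absorb)
    show "card ({1..N} - {i}) \<le> N" using card_mono[of "{1..N}" "{1..N} - {i}"] by simp
    show "(\<lambda>(x, y). k x y) \<in> borel_measurable (borel \<Otimes>\<^sub>M borel)"
      unfolding k_def by measurable
    show "norm (k x y) \<le> 4 * B" for x y
      using norm_triangle_ineq4[of "\<kappa> (x - y)" "\<kappa>_mean t x"] \<kappa>_bound[of "x - y"] \<kappa>_mean_bound[OF t, of x]
      by (simp add: k_def)
    fix x j assume j: "j \<in> {1..N} - {i}"
    then have [measurable]: "X j t \<in> borel_measurable M" by (intro X) simp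
    have "integrable M (\<lambda>\<omega>. \<kappa> (x - X j t \<omega>))"
      using \<kappa>_bound by (intro integrable_const_bound[where B = "2 * B"]) auto
    then show "(\<integral>\<omega>. k x (X j t \<omega>) \<partial>M) = 0"
      using \<kappa>_mean[of j t x] j t by (simp add: k_def prob_space)
  qed (use N_pos B in auto)
  then show ?thesis
    using i t by (simp add: D_def \<xi> k_def)
qed

lemma K_pos: "0 < K" using T by (simp add: K)

definition riemann_total :: "nat \<Rightarrow> 'a \<Rightarrow> real" where
  "riemann_total m \<omega> = (\<Sum>k<Suc m. \<Sum>i\<in>{1..N}. D i (riemann_step T m k) \<omega> \<bullet>
      (W i (riemann_step T m (Suc k)) \<omega> - W i (riemann_step T m k) \<omega>))"

lemma riemann_total_exp:
  assumes a: "\<bar>a\<bar> = 1 / (real N * B * K)"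
  shows "exp_moment M (\<lambda>\<omega>. a * riemann_total m \<omega>) \<le> ennreal ((1 + sqrt 2) / 2)"
proof -
  let ?\<tau> = "riemann_step T m"
  \<comment> \<open>The value of \<open>K\<close> is made for this: with
    \<open>d = CARD('d)\<close>, \<open>2 * N * T * a\<^sup>2\<close> equals
    \<open>1 / (64 * d * N * B\<^sup>2)\<close>, the coefficient in
    \<open>D_exp_square\<close>.\<close>
  have a2: "a\<^sup>2 = 1 / (128 * real CARD('d) * T * (real N * B)\<^sup>2)"
  proof -
    have "a\<^sup>2 = (1 / (real N * B * K))\<^sup>2" unfolding a[symmetric] by simp
    also have "\<dots> = 1 / (128 * real CARD('d) * T * (real N * B)\<^sup>2)"
      using T by (simp add: K power_divide power_mult_distrib)
    finally show ?thesis .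
  qed
  have \<tau>: "?\<tau> k \<in> {0..T}" if "k \<le> Suc m" for k
    using T that by (simp add: riemann_step_ge_0 riemann_step_le)
  have inc: "?\<tau> (Suc k) - ?\<tau> k = T / real (Suc m)" for k by (rule riemann_step_Suc_diff)
  have D: "(\<lambda>\<omega>. a *\<^sub>R D i (?\<tau> k) \<omega>) \<in> borel_measurable (F (?\<tau> k))" if "i \<in> {1..N}" "k < Suc m" for i k
    using D_adapted[OF that(1) \<tau>[of k]] that by simp
  \<comment> \<open>Jensen's inequality runs over time steps and particles together. The
    \<open>m + 1\<close> in \<open>card P\<close> cancels against the mesh width, which makes the
    bound uniform in \<open>m\<close>.\<close>
  define P where "P = {..<Suc m} \<times> {1..N}"
  define x where "x p \<omega> = 2 * (T / real (Suc m)) * (a\<^sup>2 * (norm (D (snd p) (?\<tau> (fst p)) \<omega>))\<^sup>2)" for p \<omega>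
  have card: "real (card P) = real (Suc m) * real N" by (simp add: P_def card_cartesian_product algebra_simps)
  have "exp_moment M (\<lambda>\<omega>. \<Sum>p\<in>P. x p \<omega>) \<le> ennreal (sqrt 2)"
  proof (rule nn_integral_exp_sum_le)
    show "finite P" "P \<noteq> {}" using N_pos by (auto simp: P_def)
    fix p assume p: "p \<in> P"
    then have p': "snd p \<in> {1..N}" "?\<tau> (fst p) \<in> {0..T}" by (auto simp: P_def intro!: \<tau> simp del: atLeastAtMost_iff)
    have [measurable]: "D (snd p) (?\<tau> (fst p)) \<in> borel_measurable M"
      using D_adapted[OF p'] by (rule measurable_F)
    show "x p \<in> borel_measurable M" unfolding x_def by measurable
    have "real (card P) * x p \<omega> = (norm (D (snd p) (?\<tau> (fst p)) \<omega>))\<^sup>2 / (4 * real CARD('d) * real N * (4 * B)\<^sup>2)" for \<omega>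
      using T B N_pos unfolding card x_def a2 by (simp add: field_simps power2_eq_square del: of_nat_Suc)
    then show "exp_moment M (\<lambda>\<omega>. real (card P) * x p \<omega>) \<le> ennreal (sqrt 2)"
      using D_exp_square[OF p'] by (simp only:)
  qed
  moreover have "(\<Sum>p\<in>P. x p \<omega>) = (\<Sum>k<Suc m. \<Sum>i\<in>{1..N}. 2 * (?\<tau> (Suc k) - ?\<tau> k) * (norm (a *\<^sub>R D i (?\<tau> k) \<omega>))\<^sup>2)" for \<omega>
    unfolding P_def x_def inc by (simp only: sum.cartesian_product case_prod_beta' norm_scaleR power_mult_distrib power2_abs)
  ultimately have Q: "exp_moment M (\<lambda>\<omega>. \<Sum>k<Suc m. \<Sum>i\<in>{1..N}. 2 * (?\<tau> (Suc k) - ?\<tau> k) * (norm (a *\<^sub>R D i (?\<tau> k) \<omega>))\<^sup>2)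
      \<le> ennreal (sqrt 2)"
    by (simp only:)
  have "exp_moment M (\<lambda>\<omega>. \<Sum>k<Suc m. \<Sum>i\<in>{1..N}. (a *\<^sub>R D i (?\<tau> k) \<omega>) \<bullet> (W i (?\<tau> (Suc k)) \<omega> - W i (?\<tau> k) \<omega>))
      \<le> ennreal ((1 + sqrt 2) / 2)"
  proof (rule exp_stochastic_sum_le[OF _ _ _ D Q])
    show "?\<tau> k < ?\<tau> (Suc k)" for k
    proof -
      have "0 < T / real (Suc m)" using T by simp
      then show ?thesis using inc[of k] by linarith
    qed
    show "0 \<le> ?\<tau> 0" "?\<tau> (Suc m) \<le> T" using \<tau>[of 0] \<tau>[of "Suc m"] by auto
  qed auto
  moreover have "(\<Sum>k<Suc m. \<Sum>i\<in>{1..N}. (a *\<^sub>R D i (?\<tau> k) \<omega>) \<bullet> (W i (?\<tau> (Suc k)) \<omega> - W i (?\<tau> k) \<omega>)) = a * riemann_total m \<omega>" for \<omega>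
    unfolding riemann_total_def by (simp only: inner_scaleR_left sum_distrib_left)
  ultimately show ?thesis by (simp only:)
qed

definition ito_total :: "'a \<Rightarrow> real" where
  "ito_total \<omega> = (\<Sum>i\<in>{1..N}. \<Sum>j\<in>{1..N} - {i}. ito_integral M F T (W i) (\<xi> i j) \<omega>)"

lemma riemann_total_eq:
  "riemann_total m \<omega> = (\<Sum>i\<in>{1..N}. \<Sum>j\<in>{1..N} - {i}.
      riemann_sum T (W i) (\<xi> i j) m \<omega>)"
proof -
  have "riemann_total m \<omega> = (\<Sum>i\<in>{1..N}. \<Sum>k<Suc m. \<Sum>j\<in>{1..N} - {i}. \<xi> i j (riemann_step T m k) \<omega> \<bullet>
      (W i (riemann_step T m (Suc k)) \<omega> - W i (riemann_step T m k) \<omega>))"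
    unfolding riemann_total_def D_def inner_sum_left by (rule sum.swap)
  also have "\<dots> = (\<Sum>i\<in>{1..N}. \<Sum>j\<in>{1..N} - {i}. \<Sum>k<Suc m. \<xi> i j (riemann_step T m k) \<omega> \<bullet>
      (W i (riemann_step T m (Suc k)) \<omega> - W i (riemann_step T m k) \<omega>))"
    by (intro sum.cong refl sum.swap)
  finally show ?thesis unfolding riemann_sum_def simple_integral_def .
qed

lemma ito_facts:
  assumes "i \<in> {1..N}" "j \<in> {1..N}"
  shows "riemann_sum T (W i) (\<xi> i j) m \<in> borel_measurable M"
    and "ito_integral M F T (W i) (\<xi> i j) \<in> borel_measurable M"
    and "(\<lambda>m. sq_dist M (riemann_sum T (W i) (\<xi> i j) m)
        (ito_integral M F T (W i) (\<xi> i j))) \<longlonglongrightarrow> 0"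
proof -
  interpret ito_integrand M F T "W i" "\<xi> i j" "4 * B" using assms by (rule ito_integrand_\<xi>)
  show "riemann_sum T (W i) (\<xi> i j) m \<in> borel_measurable M" by (rule riemann_sum_measurable)
  show "ito_integral M F T (W i) (\<xi> i j) \<in> borel_measurable M" by (rule ito_integral_measurable)
  show "(\<lambda>m. sq_dist M (riemann_sum T (W i) (\<xi> i j) m) (ito_integral M F T (W i) (\<xi> i j))) \<longlonglongrightarrow> 0"
    by (rule riemann_sum_tendsto_ito)
qed

lemma ito_total_measurable: "ito_total \<in> borel_measurable M"
  unfolding ito_total_def[abs_def] by (intro borel_measurable_sum ito_facts) auto

lemma riemann_total_measurable: "riemann_total m \<in> borel_measurable M"
  unfolding riemann_total_eq[abs_def] by (intro borel_measurable_sum ito_facts) auto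

lemma riemann_total_tendsto: "(\<lambda>m. sq_dist M (riemann_total m) ito_total) \<longlonglongrightarrow> 0"
  unfolding riemann_total_eq[abs_def] ito_total_def[abs_def]
  by (intro sq_dist_tendsto_sum borel_measurable_sum ito_facts) auto

lemma ito_total_exp:
  "exp_moment M (\<lambda>\<omega>. \<bar>ito_total \<omega>\<bar> / (real N * B * K)) \<le> ennreal 3"
proof -
  define a where "a = 1 / (real N * B * K)"
  have a: "0 \<le> a" using B K_pos by (simp add: a_def)
  \<comment> \<open>Both signs of the parameter are needed for the absolute value; the two bounds
    add up to \<open>1 + sqrt 2\<close>, which is at most \<open>3\<close>.\<close>
  have le: "exp_moment M (\<lambda>\<omega>. b * ito_total \<omega>) \<le> ennreal ((1 + sqrt 2) / 2)" if "\<bar>b\<bar> = a" for b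
    using that unfolding a_def
    by (intro exp_moment_of_sq_limit[OF riemann_total_measurable ito_total_measurable riemann_total_tendsto] riemann_total_exp)
  have "exp_moment M (\<lambda>\<omega>. \<bar>ito_total \<omega>\<bar> / (real N * B * K)) \<le>
      (\<integral>\<^sup>+\<omega>. ennreal (exp (a * ito_total \<omega>)) + ennreal (exp ((- a) * ito_total \<omega>)) \<partial>M)"
  proof (rule nn_integral_mono)
    fix \<omega>
    have "\<bar>a * ito_total \<omega>\<bar> = a * \<bar>ito_total \<omega>\<bar>" using a by (simp add: abs_mult)
    then have "\<bar>ito_total \<omega>\<bar> / (real N * B * K) = \<bar>a * ito_total \<omega>\<bar>" by (simp only: a_def mult_1 times_divide_eq_left)
    moreover have "exp \<bar>y\<bar> \<le> exp y + exp (- y)" for y :: real by (cases "0 \<le> y") auto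
    ultimately have "exp (\<bar>ito_total \<omega>\<bar> / (real N * B * K)) \<le> exp (a * ito_total \<omega>) + exp ((- a) * ito_total \<omega>)"
      by (metis mult_minus_left)
    from ennreal_leI[OF this]
    show "ennreal (exp (\<bar>ito_total \<omega>\<bar> / (real N * B * K))) \<le> ennreal (exp (a * ito_total \<omega>)) + ennreal (exp ((- a) * ito_total \<omega>))"
      by (simp add: ennreal_plus)
  qed
  also have "\<dots> = exp_moment M (\<lambda>\<omega>. a * ito_total \<omega>) + exp_moment M (\<lambda>\<omega>. (- a) * ito_total \<omega>)"
  proof -
    note [measurable] = ito_total_measurable
    show ?thesis by (rule nn_integral_add) measurable
  qed
  also have "\<dots> \<le> ennreal ((1 + sqrt 2) / 2) + ennreal ((1 + sqrt 2) / 2)"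
    using a by (intro add_mono le) auto
  also have "\<dots> = ennreal (1 + sqrt 2)" by (subst ennreal_plus[symmetric]) auto
  also have "\<dots> \<le> ennreal 3"
    using real_sqrt_le_mono[of 2 4] by (intro ennreal_leI) simp
  finally show ?thesis .
qed

end

section \<open>Identification of the kernel for a difference of two drifts\<close>

lemma dirac_kernel_drift_difference:
  fixes F1 G1 F2 G2 :: "'d::finite torus \<Rightarrow> real ^ 'd"
  assumes b1: "\<forall>\<nu>\<in>space (prob_algebra borel). \<forall>x. b1 \<nu> x = G1 x + (LINT y|\<nu>. F1 (x - y))"
    and b2: "\<forall>\<nu>\<in>space (prob_algebra borel). \<forall>x. b2 \<nu> x = G2 x + (LINT y|\<nu>. F2 (x - y))"
    and [measurable]: "F1 \<in> borel_measurable borel" "F2 \<in> borel_measurable borel"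
  shows "dirac_kernel (\<lambda>\<nu> x. b1 \<nu> x - b2 \<nu> x) x y = (G1 x - G2 x) + (F1 (x - y) - F2 (x - y))"
proof -
  have "return borel y \<in> space (prob_algebra borel)"
    by (simp add: space_prob_algebra prob_space_return)
  moreover have "(LINT z|return borel y. F1 (x - z)) = F1 (x - y)" "(LINT z|return borel y. F2 (x - z)) = F2 (x - y)"
    by (simp_all add: integral_return)
  ultimately show ?thesis
    using b1 b2 by (simp add: dirac_kernel_def)
qed

lemma U_statistic_exp:
  fixes M :: "'a measure" and M0 :: "'b measure" and HH :: "('d::finite torus \<Rightarrow> real ^ 'd) set"
  assumes T: "0 < T" and B: "0 < B" and N: "0 < N"
    and HH: "\<forall>f\<in>HH. (\<forall>x. norm (f x) \<le> B) \<and> L-lipschitz_on UNIV f"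
    and bstar: "bstar \<in> drift_class HH"
    and mv: "mckean_vlasov_solution M0 F0 T bstar W0 X0"
    and \<mu>: "\<forall>t\<in>{0..T}. \<mu> t = distr M0 borel (X0 t)"
    and fps: "filtered_prob_space M F"
    and ibm: "independent_brownian_motions M F T {1..N} W"
    and sde: "\<forall>i\<in>{1..N}. sde_solution M F T bstar \<mu> (W i) (X i)"
    and iid: "iid_processes M T {1..N} X"
    and init: "\<forall>i\<in>{1..N}. distr M borel (X i 0) = distr M0 borel (X0 0)"
    and g: "g \<in> drift_differences HH bstar"
  shows "U_statistic M F T \<mu> N W X g \<in> borel_measurable M"
    and "exp_moment M (\<lambda>\<omega>. real N * \<bar>U_statistic M F T \<mu> N W X g \<omega>\<bar> / (B * sqrt (128 * real CARD('d) * T))) \<le> ennreal 3"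
proof -
  have psM: "prob_space M" using fps by (simp add: filtered_prob_space_def)
  have br0: "brownian M0 F0 T W0" and sde0: "sde_solution M0 F0 T bstar (\<lambda>t. distr M0 borel (X0 t)) W0 X0"
    using mckean_vlasov_brownian[OF mv] mv by (simp_all add: mckean_vlasov_solution_def)
  interpret B0: brownian M0 F0 T W0 by (rule br0)
  interpret M: brownian_family M F T "{1..N}" W
    using psM fps ibm N by (simp add: brownian_family_def brownian_family_axioms_def filtered_def filtered_axioms_def)
  obtain b where b: "b \<in> drift_class HH" and g_eq: "g = (\<lambda>\<nu> x. b \<nu> x - bstar \<nu> x)"
    using g by (auto simp: drift_differences_def)
  obtain F1 G1 where F1: "F1 \<in> HH" "G1 \<in> HH"
    and b1: "\<forall>\<nu>\<in>space (prob_algebra borel). \<forall>x. b \<nu> x = G1 x + (LINT y|\<nu>. F1 (x - y))"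
    using b by (auto simp: drift_class_def)
  obtain F2 G2 where F2: "F2 \<in> HH" "G2 \<in> HH"
    and b2: "\<forall>\<nu>\<in>space (prob_algebra borel). \<forall>x. bstar \<nu> x = G2 x + (LINT y|\<nu>. F2 (x - y))"
    using bstar by (auto simp: drift_class_def)
  have F_cont: "continuous_on UNIV F1" "continuous_on UNIV F2"
    using HH F1 F2 by (auto intro: lipschitz_on_continuous_on)
  then have [measurable]: "F1 \<in> borel_measurable borel" "F2 \<in> borel_measurable borel"
    by (auto intro: borel_measurable_continuous_onI)
  define \<kappa> where "\<kappa> z = F1 z - F2 z" for z
  have \<kappa>_cont: "continuous_on UNIV \<kappa>" unfolding \<kappa>_def by (intro continuous_on_diff F_cont)
  have [measurable]: "\<kappa> \<in> borel_measurable borel" using \<kappa>_cont by (rule borel_measurable_continuous_onI)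
  have \<kappa>_bound: "norm (\<kappa> z) \<le> 2 * B" for z
  proof -
    have "norm (F1 z) \<le> B" "norm (F2 z) \<le> B" using HH F1 F2 by auto
    then show ?thesis using norm_triangle_ineq4[of "F1 z" "F2 z"] by (simp add: \<kappa>_def)
  qed
  have kernel: "dirac_kernel g x y = (G1 x - G2 x) + \<kappa> (x - y)" for x y
    unfolding g_eq \<kappa>_def by (rule dirac_kernel_drift_difference[OF b1 b2]) measurable
  define m where "m t x = (\<integral>\<omega>. \<kappa> (x - X0 t \<omega>) \<partial>M0)" for t x
  have X0m: "X0 t \<in> borel_measurable M0" if "t \<in> {0..T}" for t
    using sde0 that by (auto simp: sde_solution_def intro: B0.measurable_F)
  have X0c: "continuous_on {0..T} (\<lambda>t. X0 t \<omega>)" if "\<omega> \<in> space M0" for \<omega>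
    using sde0 that by (auto simp: sde_solution_def)
  have xi: "xi_process g \<mu> X i j t \<omega> = \<kappa> (X i t \<omega> - X j t \<omega>) - m t (X i t \<omega>)" if t: "t \<in> {0..T}" for i j t \<omega>
  proof -
    note [measurable] = X0m[OF t]
    let ?x = "X i t \<omega>"
    have int: "integrable M0 (\<lambda>\<omega>'. \<kappa> (?x - X0 t \<omega>'))"
      using \<kappa>_bound by (intro B0.integrable_const_bound[where B = "2 * B"]) auto
    have "(LINT y|\<mu> t. dirac_kernel g ?x y) = (LINT y|distr M0 borel (X0 t). (G1 ?x - G2 ?x) + \<kappa> (?x - y))"
      using \<mu> t by (simp add: kernel)
    also have "\<dots> = (\<integral>\<omega>'. (G1 ?x - G2 ?x) + \<kappa> (?x - X0 t \<omega>') \<partial>M0)"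
      by (rule integral_distr) measurable
    also have "\<dots> = (G1 ?x - G2 ?x) + m t ?x"
      unfolding m_def using int by (subst Bochner_Integration.integral_add) (auto simp: B0.prob_space)
    finally show ?thesis by (simp add: xi_process_def kernel)
  qed
  interpret S: mean_field M F T N W X \<kappa> m "xi_process g \<mu> X" B "sqrt (128 * real CARD('d) * T)"
  proof
    show "0 < T" "0 < B" by (rule T B)+
    show "X i t \<in> borel_measurable (F t)" if "i \<in> {1..N}" "t \<in> {0..T}" for i t
      using sde that by (auto simp: sde_solution_def)
    show "continuous_on {0..T} (\<lambda>t. X i t \<omega>)" if "i \<in> {1..N}" "\<omega> \<in> space M" for i \<omega>
      using sde that by (auto simp: sde_solution_def)
    show "M.indep_vars (\<lambda>_. borel) (\<lambda>i. X i t) {1..N}" if t: "t \<in> {0..T}" for t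
    proof -
      \<comment> \<open>Evaluation at \<open>t\<close> is measurable on path space, so independence
        of the paths passes to their values at time \<open>t\<close>.\<close>
      have "M.indep_vars (\<lambda>_. borel) (\<lambda>i \<omega>. (\<lambda>p. p t) ((\<lambda>t\<in>{0..T}. X i t \<omega>))) {1..N}"
      proof (rule M.indep_vars_compose2[where Y = "\<lambda>_ p. p t" and X = "\<lambda>i \<omega>. \<lambda>t\<in>{0..T}. X i t \<omega>"
            and M' = "\<lambda>_. \<Pi>\<^sub>M t\<in>{0..T}. borel"])
        show "M.indep_vars (\<lambda>_. \<Pi>\<^sub>M t\<in>{0..T}. borel) (\<lambda>i \<omega>. \<lambda>t\<in>{0..T}. X i t \<omega>) {1..N}"
          using iid unfolding iid_processes_def by blast
        show "(\<lambda>p. p t) \<in> borel_measurable (\<Pi>\<^sub>M t\<in>{0..T}. borel)"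
          using t by (rule measurable_component_singleton)
      qed
      then show ?thesis using t by simp
    qed
    show "continuous_on UNIV \<kappa>" by (rule \<kappa>_cont)
    show "norm (\<kappa> x) \<le> 2 * B" for x by (rule \<kappa>_bound)
    show "continuous_on ({0..T} \<times> UNIV) (\<lambda>(t, x). m t x)"
      unfolding m_def by (rule B0.mean_kernel_continuous[OF X0m X0c \<kappa>_cont \<kappa>_bound])
    show "norm (m t x) \<le> 2 * B" if "t \<in> {0..T}" for t x
    proof -
      note [measurable] = X0m[OF that]
      show ?thesis unfolding m_def by (rule B0.mean_kernel_bound[OF _ \<kappa>_bound]) measurable
    qed
    show "(\<integral>\<omega>. \<kappa> (x - X j t \<omega>) \<partial>M) = m t x" if j: "j \<in> {1..N}" and t: "t \<in> {0..T}" for j t x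
      unfolding m_def
    \<comment> \<open>The centring term \<open>m\<close> is an expectation over \<open>X0\<close> on
      \<open>M0\<close>, the left side one over \<open>X j\<close> on \<open>M\<close>; uniqueness
      in law for the test function \<open>\<kappa> (x - y)\<close> of \<open>y\<close> links
      them.\<close>
    proof (rule sde_law_unique[where f = "\<lambda>y. \<kappa> (x - y)" and C = "2 * B", OF T _ bstar mv _ M.brownian_component[OF j] _ _ _ _ t])
      show "(\<forall>x. norm (f x) \<le> B) \<and> L-lipschitz_on UNIV f" if "f \<in> HH" for f using HH that by blast
      show "\<mu> t = distr M0 borel (X0 t)" if "t \<in> {0..T}" for t using \<mu> that by blast
      show "sde_solution M F T bstar \<mu> (W j) (X j)" using sde j by blast
      show "distr M borel (X j 0) = distr M0 borel (X0 0)" using init j by blast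
      show "continuous_on UNIV (\<lambda>y. \<kappa> (x - y))"
        by (rule continuous_on_compose2[OF \<kappa>_cont]) (auto intro!: continuous_intros)
      show "norm (\<kappa> (x - y)) \<le> 2 * B" for y by (rule \<kappa>_bound)
    qed
    show "xi_process g \<mu> X i j t \<omega> = \<kappa> (X i t \<omega> - X j t \<omega>) - m t (X i t \<omega>)"
      if "t \<in> {0..T}" for i j t \<omega> by (rule xi[OF that])
  qed simp
  have U: "U_statistic M F T \<mu> N W X g \<omega> = 1 / (real N)\<^sup>2 * S.ito_total \<omega>" for \<omega>
    unfolding U_statistic_def S.ito_total_def ..
  show "U_statistic M F T \<mu> N W X g \<in> borel_measurable M"
    unfolding U[abs_def] using S.ito_total_measurable by measurable
  have "real N * \<bar>U_statistic M F T \<mu> N W X g \<omega>\<bar> / (B * sqrt (128 * real CARD('d) * T)) =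
      \<bar>S.ito_total \<omega>\<bar> / (real N * B * sqrt (128 * real CARD('d) * T))" for \<omega>
    using N by (simp add: U abs_mult power2_eq_square field_simps)
  then show "exp_moment M (\<lambda>\<omega>. real N * \<bar>U_statistic M F T \<mu> N W X g \<omega>\<bar> / (B * sqrt (128 * real CARD('d) * T))) \<le> ennreal 3"
    using S.ito_total_exp by (simp only:)
qed

section \<open>Tail bound and Orlicz norm\<close>

lemma powr_two_thirds_le: "0 \<le> (a :: real) \<Longrightarrow> a powr (2/3) \<le> 1 + a"
proof (cases "a \<le> 1")
  case True
  assume "0 \<le> a"
  then show ?thesis using True powr_mono2[of "2/3" a 1] by simp
next
  case False
  then have "a powr (2/3) \<le> a powr 1" by (intro powr_mono) auto
  then show ?thesis using False by simp
qed

text \<open>Markov's inequality for \<open>exp (Z \<omega>)\<close>.\<close>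

lemma (in prob_space) exp_tail:
  assumes [measurable]: "Z \<in> borel_measurable M"
    and le: "exp_moment M Z \<le> ennreal c" and c: "0 \<le> c"
  shows "prob {\<omega>\<in>space M. Z \<omega> > (v :: real)} \<le> c * exp (- v)"
proof -
  let ?A = "{\<omega>\<in>space M. Z \<omega> > v}"
  have "emeasure M ?A = (\<integral>\<^sup>+\<omega>. indicator ?A \<omega> \<partial>M)" by simp
  also have "\<dots> \<le> (\<integral>\<^sup>+\<omega>. ennreal (exp (- v)) * ennreal (exp (Z \<omega>)) \<partial>M)"
  proof (rule nn_integral_mono)
    fix \<omega>
    show "(indicator ?A \<omega> :: ennreal) \<le> ennreal (exp (- v)) * ennreal (exp (Z \<omega>))"
    proof (cases "\<omega> \<in> ?A")
      case True
      then have "1 \<le> exp (- v) * exp (Z \<omega>)" by (simp add: exp_add[symmetric])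
      then have "ennreal 1 \<le> ennreal (exp (- v) * exp (Z \<omega>))" by (rule ennreal_leI)
      then show ?thesis using True by (simp add: ennreal_mult)
    qed simp
  qed
  also have "\<dots> = ennreal (exp (- v)) * exp_moment M Z"
    by (rule nn_integral_cmult) measurable
  also have "\<dots> \<le> ennreal (exp (- v)) * ennreal c" using le by (intro mult_left_mono) auto
  also have "\<dots> = ennreal (c * exp (- v))" using c by (simp add: ennreal_mult mult.commute)
  finally show ?thesis using c by (simp add: emeasure_eq_measure)
qed

text \<open>Since \<open>64 powr (2/3) = 16\<close>, one has
  \<open>16 * a powr (2/3) \<le> 1 + z\<close>, and Bernoulli's inequality for the power
  \<open>16\<close> turns this into a gain of \<open>1 / 16\<close>. The gain absorbs the
  \<open>3\<close> that bounds \<open>exp 1\<close> and later the \<open>3\<close> of the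
  exponential moment, as \<open>9 / 16 \<le> 1\<close>.\<close>

lemma exp_powr_two_thirds_le:
  assumes "0 \<le> a" "64 * a \<le> (z :: real)"
  shows "exp (a powr (2/3)) - 1 \<le> 3 / 16 * exp z"
proof -
  have "(64 :: real) powr (2/3) = (4 powr 3) powr (2/3)" by simp
  also have "\<dots> = 4 powr 2" by (subst powr_powr) simp
  finally have 64: "(64 :: real) powr (2/3) = 16" by simp
  have "16 * a powr (2/3) = (64 * a) powr (2/3)" using assms by (simp add: powr_mult 64)
  also have "\<dots> \<le> 1 + z" using powr_two_thirds_le[of "64 * a"] assms by simp
  finally have a: "16 * a powr (2/3) \<le> 1 + z" .
  define y where "y = exp (a powr (2/3)) - 1"
  have "0 \<le> y" by (simp add: y_def)
  then have "1 + real 16 * y \<le> (1 + y) ^ 16" by (intro Bernoulli_inequality) simp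
  also have "(1 + y) ^ 16 = exp (16 * a powr (2/3))"
    unfolding y_def using exp_of_nat_mult[of 16 "a powr (2/3)"] by simp
  also have "\<dots> \<le> exp (1 + z)" using a by simp
  also have "\<dots> \<le> 3 * exp z" unfolding exp_add using exp_le by (intro mult_right_mono) auto
  finally show ?thesis unfolding y_def by simp
qed

lemma ln_ln_ge:
  assumes "3 \<le> (N :: nat)"
  shows "0 < ln (ln (3 :: real))" "ln (ln 3) \<le> ln (ln (real N))" "1 < ln (real N)"
proof -
  have e: "exp 1 < (3 :: real)"
  proof -
    \<comment> \<open>Positivity of \<open>ln (ln 3)\<close> amounts to \<open>exp 1 < 3\<close>.
      The bound \<open>1 + x + x\<^sup>2\<close> at \<open>x = 1 / 4\<close> is sharp enough, since
      \<open>(21 / 16) ^ 4\<close> is just below \<open>3\<close>.\<close>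
    have "exp (1 / 4) \<le> 1 + 1 / 4 + (1 / 4 :: real)\<^sup>2" by (rule exp_bound) auto
    then have "exp (1 / 4 :: real) ^ 4 \<le> (21 / 16) ^ 4" by (intro power_mono) (auto simp: power2_eq_square)
    also have "exp (1 / 4 :: real) ^ 4 = exp 1" using exp_of_nat_mult[of 4 "1 / 4 :: real"] by simp
    also have "(21 / 16 :: real) ^ 4 < 3" by (simp add: power_divide)
    finally show ?thesis .
  qed
  then have 1: "1 < ln (3 :: real)" by (subst ln_exp[symmetric]) (simp only: ln_less_cancel_iff exp_gt_zero zero_less_numeral)
  then show "0 < ln (ln (3 :: real))" by simp
  have 3: "ln 3 \<le> ln (real N)" using assms by simp
  then show "ln (ln 3) \<le> ln (ln (real N))" "1 < ln (real N)" using 1 by auto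
qed

lemma (in prob_space) exp_moment_two_thirds_tail:
  fixes U :: "'a \<Rightarrow> real"
  assumes [measurable]: "U \<in> borel_measurable M" and K: "0 < K" and B: "0 < B" and N: "3 \<le> (N :: nat)"
    and le: "exp_moment M (\<lambda>\<omega>. real N * \<bar>U \<omega>\<bar> / (B * K)) \<le> ennreal 3"
    and C: "C = 64 * (1 + 1 / ln (ln 3)) * K"
  shows "u \<ge> C * B * (ln (real N))\<^sup>2 / real N \<Longrightarrow>
      prob {\<omega>\<in>space M. \<bar>U \<omega>\<bar> > u} \<le> exp (- ((u * real N / (C * B * ln (ln (real N)))) powr (2 / 3)))"
    and "orlicz_norm M (2 / 3) U \<le> ennreal (3 * C * B * ln (ln (real N)) / real N)"
proof -
  define l where "l = ln (ln (3 :: real))"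
  \<comment> \<open>The ratio \<open>C / K\<close>. In the tail bound
    \<open>r \<ge> 3 + 1 / l\<close> pays for the prefactor \<open>3\<close> and for the power
    \<open>2/3\<close>; in the Orlicz bound \<open>r * l \<ge> 64\<close> supplies the factor that
    \<open>exp_powr_two_thirds_le\<close> asks for.\<close>
  define r where "r = 64 * (1 + 1 / l)"
  define lN where "lN = ln (ln (real N))"
  have l: "0 < l" "l \<le> lN" "1 < ln (real N)" using ln_ln_ge[OF N] by (auto simp: l_def lN_def)
  have r: "64 \<le> r" "r * l \<ge> 64" "r \<ge> 3 + 1 / l" using l by (auto simp: r_def field_simps)
  have C: "C = r * K" by (simp add: C r_def l_def)
  have N0: "0 < real N" using N by simp
  define Z where "Z \<omega> = real N * \<bar>U \<omega>\<bar> / (B * K)" for \<omega>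
  have [measurable]: "Z \<in> borel_measurable M" unfolding Z_def by measurable
  {
    assume u: "u \<ge> C * B * (ln (real N))\<^sup>2 / real N"
    \<comment> \<open>In units of \<open>v\<close> the event becomes
      \<open>Z \<omega> > r * v\<close>; the threshold for \<open>u\<close> gives
      \<open>v \<ge> 1\<close>, because \<open>ln (real N) > 1\<close>.\<close>
    define v where "v = u * real N / (C * B)"
    have CB: "0 < C * B" using r K B by (simp add: C)
    have "(ln (real N))\<^sup>2 \<le> v" using u CB N0 by (simp add: v_def field_simps)
    moreover have "1 \<le> (ln (real N))\<^sup>2" using l(3) by (simp add: one_le_power)
    ultimately have v: "1 \<le> v" by simp
    have "{\<omega>\<in>space M. \<bar>U \<omega>\<bar> > u} = {\<omega>\<in>space M. Z \<omega> > r * v}"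
    proof -
      have "\<bar>U \<omega>\<bar> > u \<longleftrightarrow> Z \<omega> > r * v" for \<omega>
        using K B N0 r by (simp add: Z_def v_def C field_simps)
      then show ?thesis by simp
    qed
    then have "prob {\<omega>\<in>space M. \<bar>U \<omega>\<bar> > u} \<le> 3 * exp (- (r * v))"
      using exp_tail[of Z 3 "r * v"] le by (simp add: Z_def)
    also have "\<dots> \<le> exp (2 * v) * exp (- (r * v))"
    proof (rule mult_right_mono)
      have "3 \<le> exp (2 :: real)" using exp_ge_add_one_self[of 2] by simp
      also have "\<dots> \<le> exp (2 * v)" using v by simp
      finally show "3 \<le> exp (2 * v)" .
    qed simp
    also have "\<dots> = exp (2 * v - r * v)" by (simp add: exp_add[symmetric])
    also have "\<dots> \<le> exp (- ((v / lN) powr (2/3)))"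
    proof -
      have "(v / lN) powr (2/3) \<le> 1 + v / lN" using v l by (intro powr_two_thirds_le) auto
      \<comment> \<open>As \<open>v \<ge> 1\<close>, the additive \<open>1\<close> is absorbed into
        \<open>v\<close>, so that a large multiple of \<open>v\<close> dominates.\<close>
      also have "\<dots> \<le> v + v * (1 / l)" using v l by (auto intro!: add_mono simp: frac_le)
      finally have 1: "(v / lN) powr (2/3) \<le> v + v * (1 / l)" .
      have "(3 + 1 / l) * v \<le> r * v" using r v by (intro mult_right_mono) auto
      then have "2 * v - r * v \<le> - (v + v * (1 / l))" by (simp add: algebra_simps)
      with 1 show ?thesis by simp
    qed
    also have "v / lN = u * real N / (C * B * lN)" by (simp add: v_def)
    finally show "prob {\<omega>\<in>space M. \<bar>U \<omega>\<bar> > u} \<le> exp (- ((u * real N / (C * B * ln (ln (real N)))) powr (2 / 3)))"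
      by (simp add: lN_def)
  }
  define c where "c = 3 * C * B * lN / real N"
  have c: "0 < c" using l K B N0 r by (simp add: c_def C)
  have "(\<integral>\<^sup>+\<omega>. ennreal (exp ((\<bar>U \<omega>\<bar> / c) powr (2/3)) - 1) \<partial>M) \<le> (\<integral>\<^sup>+\<omega>. ennreal (3/16) * ennreal (exp (Z \<omega>)) \<partial>M)"
  proof (rule nn_integral_mono)
    fix \<omega>
    have "64 * (\<bar>U \<omega>\<bar> / c) \<le> Z \<omega>"
    proof -
      have "64 \<le> r * l" by (rule r)
      also have "\<dots> \<le> r * lN" using l r by (intro mult_left_mono) auto
      finally have rl: "64 \<le> 3 * r * lN" by simp
      have Z0: "0 \<le> Z \<omega>" using B K by (simp add: Z_def)
      have lN: "0 < lN" using l by simp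
      have "64 * (\<bar>U \<omega>\<bar> / c) = 64 / (3 * r * lN) * Z \<omega>"
        using K B N0 lN r by (simp add: c_def C Z_def field_simps)
      also have "\<dots> \<le> 1 * Z \<omega>"
      proof (rule mult_right_mono[OF _ Z0])
        show "64 / (3 * r * lN) \<le> 1" using rl by (subst divide_le_eq_1_pos) linarith+
      qed
      finally show ?thesis by simp
    qed
    then have "exp ((\<bar>U \<omega>\<bar> / c) powr (2/3)) - 1 \<le> 3/16 * exp (Z \<omega>)"
      using c by (intro exp_powr_two_thirds_le) auto
    from ennreal_leI[OF this] show "ennreal (exp ((\<bar>U \<omega>\<bar> / c) powr (2/3)) - 1) \<le> ennreal (3/16) * ennreal (exp (Z \<omega>))"
      by (subst ennreal_mult[symmetric]) simp_all
  qed
  also have "\<dots> = ennreal (3/16) * exp_moment M Z"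
    by (rule nn_integral_cmult) measurable
  also have "\<dots> \<le> ennreal (3/16) * ennreal 3" using le unfolding Z_def by (intro mult_left_mono) auto
  also have "\<dots> = ennreal (9/16)" by (subst ennreal_mult[symmetric]) auto
  also have "\<dots> \<le> 1" by simp
  finally have "ennreal c \<in> {ennreal c |c. c > 0 \<and> (\<integral>\<^sup>+\<omega>. ennreal (exp ((\<bar>U \<omega>\<bar> / c) powr (2/3)) - 1) \<partial>M) \<le> 1}"
    using c by blast
  from Inf_lower[OF this] show "orlicz_norm M (2 / 3) U \<le> ennreal (3 * C * B * ln (ln (real N)) / real N)"
    unfolding orlicz_norm_def c_def lN_def .
qed

theorem lemma17:
  fixes T :: real
  assumes "T > 0"
  shows "\<exists>C>0. \<forall>(B :: real) (L :: real) (HH :: ('d::finite torus \<Rightarrow> real ^ 'd) set) bstar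
      (M0 :: 'b measure) F0 W0 X0 \<mu> \<mu>0.
    (\<forall>f\<in>HH. (\<forall>x. norm (f x) \<le> B) \<and> L-lipschitz_on UNIV f) \<longrightarrow>
    bstar \<in> drift_class HH \<longrightarrow>
    mckean_vlasov_solution M0 F0 T bstar W0 X0 \<longrightarrow>
    distr M0 borel (X0 0) = \<mu>0 \<longrightarrow>
    (\<forall>t\<in>{0..T}. \<mu> t = distr M0 borel (X0 t)) \<longrightarrow>
    (\<forall>N\<ge>3. \<forall>(M :: 'a measure) F W X.
      filtered_prob_space M F \<longrightarrow>
      independent_brownian_motions M F T {1..N} W \<longrightarrow>
      (\<forall>i\<in>{1..N}. sde_solution M F T bstar \<mu> (W i) (X i)) \<longrightarrow>
      iid_processes M T {1..N} X \<longrightarrow>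
      (\<forall>i\<in>{1..N}. distr M borel (X i 0) = \<mu>0) \<longrightarrow>
      (\<forall>g\<in>drift_differences HH bstar.
        (\<forall>u \<ge> C * B * (ln (real N))\<^sup>2 / real N.
          measure M {\<omega>\<in>space M. \<bar>U_statistic M F T \<mu> N W X g \<omega>\<bar> > u}
            \<le> exp (- ((u * real N / (C * B * ln (ln (real N)))) powr (2 / 3)))) \<and>
        orlicz_norm M (2 / 3) (U_statistic M F T \<mu> N W X g)
          \<le> ennreal (3 * C * B * ln (ln (real N)) / real N)))"
proof -
  define K where "K = sqrt (128 * real CARD('d) * T)"
  \<comment> \<open>\<open>C\<close> depends on \<open>T\<close> and the dimension only; it is fixed
    before \<open>B\<close>, \<open>L\<close>, the class and \<open>N\<close>.\<close>
  define C where "C = 64 * (1 + 1 / ln (ln 3)) * K"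
  have K: "0 < K" using assms by (simp add: K_def)
  have "0 < 1 + 1 / ln (ln (3 :: real))" using ln_ln_ge(1)[of 3] by (intro add_pos_pos divide_pos_pos) auto
  then have C: "0 < C" using K unfolding C_def by (intro mult_pos_pos) auto
  show ?thesis
  proof (intro exI[of _ C] conjI C allI impI ballI)
    fix B L :: real and HH :: "('d torus \<Rightarrow> real ^ 'd) set" and bstar and M0 :: "'b measure" and F0
      and W0 :: "real \<Rightarrow> 'b \<Rightarrow> real ^ 'd" and X0 \<mu> \<mu>0 and N :: nat
      and M :: "'a measure" and F and W :: "nat \<Rightarrow> real \<Rightarrow> 'a \<Rightarrow> real ^ 'd" and X g
    assume HH: "\<forall>f\<in>HH. (\<forall>x. norm (f x) \<le> B) \<and> L-lipschitz_on UNIV f" and bstar: "bstar \<in> drift_class HH"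
      and mv: "mckean_vlasov_solution M0 F0 T bstar W0 X0" and \<mu>0: "distr M0 borel (X0 0) = \<mu>0"
      and \<mu>: "\<forall>t\<in>{0..T}. \<mu> t = distr M0 borel (X0 t)" and N: "3 \<le> N" and fps: "filtered_prob_space M F"
      and ibm: "independent_brownian_motions M F T {1..N} W"
      and sde: "\<forall>i\<in>{1..N}. sde_solution M F T bstar \<mu> (W i) (X i)"
      and iid: "iid_processes M T {1..N} X" and init: "\<forall>i\<in>{1..N}. distr M borel (X i 0) = \<mu>0"
      and g: "g \<in> drift_differences HH bstar"
    interpret prob_space M using fps by (simp add: filtered_prob_space_def)
    let ?U = "U_statistic M F T \<mu> N W X g"
    \<comment> \<open>The exponent divides by the bound, which must therefore be positive; keeping
      \<open>B'\<close> free prepares the case \<open>B = 0\<close>.\<close>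
    have U: "?U \<in> borel_measurable M" "exp_moment M (\<lambda>\<omega>. real N * \<bar>?U \<omega>\<bar> / (B' * K)) \<le> ennreal 3"
      if B': "0 < B'" "B \<le> B'" for B'
    proof -
      have HH': "\<forall>f\<in>HH. (\<forall>x. norm (f x) \<le> B') \<and> L-lipschitz_on UNIV f"
        using HH B'(2) order_trans by blast
      have N': "0 < N" using N by simp
      have init': "\<forall>i\<in>{1..N}. distr M borel (X i 0) = distr M0 borel (X0 0)" using init \<mu>0 by simp
      note * = U_statistic_exp[OF assms B'(1) N' HH' bstar mv \<mu> fps ibm sde iid init' g, folded K_def]
      show "?U \<in> borel_measurable M" "exp_moment M (\<lambda>\<omega>. real N * \<bar>?U \<omega>\<bar> / (B' * K)) \<le> ennreal 3"
        by (rule *)+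
    qed
    note bound = exp_moment_two_thirds_tail[OF U(1) K _ N U(2) C_def]
    \<comment> \<open>Membership of \<open>bstar\<close> shows that the class is not empty, which
      forces \<open>0 \<le> B\<close>.\<close>
    obtain f where "f \<in> HH" using bstar by (auto simp: drift_class_def)
    then have "0 \<le> B" using HH norm_ge_zero order_trans by blast
    then consider "0 < B" | "B = 0" by linarith
    then show tail: "measure M {\<omega>\<in>space M. \<bar>?U \<omega>\<bar> > u} \<le> exp (- ((u * real N / (C * B * ln (ln (real N)))) powr (2 / 3)))"
      if u: "C * B * (ln (real N))\<^sup>2 / real N \<le> u" for u
    proof cases
      case 1
      then show ?thesis using u by (intro bound) auto
    next
      case 2 \<comment> \<open>Here the right-hand side is \<open>1\<close>, because \<open>x / 0 = 0\<close> and \<open>0 powr (2 / 3) = 0\<close>.\<close>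
      then show ?thesis by simp
    qed
    from \<open>0 \<le> B\<close> consider "0 < B" | "B = 0" by linarith
    then show "orlicz_norm M (2 / 3) ?U \<le> ennreal (3 * C * B * ln (ln (real N)) / real N)"
    proof cases
      case 1
      then show ?thesis by (intro bound) auto
    next
      case 2
      \<comment> \<open>Every \<open>B' > 0\<close> is also a bound for the class.\<close>
      have "orlicz_norm M (2 / 3) ?U \<le> 0 + ennreal e" if e: "0 < e" for e
      proof -
        define B' where "B' = e * real N / (3 * C * ln (ln (real N)))"
        have lN: "0 < ln (ln (real N))" using ln_ln_ge[OF N] by linarith
        have "0 < B'" using e N C lN by (simp add: B'_def)
        then have "orlicz_norm M (2 / 3) ?U \<le> ennreal (3 * C * B' * ln (ln (real N)) / real N)"
          using 2 by (intro bound(2)) auto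
        moreover have "3 * C * B' * ln (ln (real N)) / real N = e"
          using C lN N by (simp add: B'_def)
        ultimately show ?thesis by simp
      qed
      then have "orlicz_norm M (2 / 3) ?U \<le> 0" by (rule ennreal_le_epsilon)
      then show ?thesis by simp
    qed
  qed
qed

end
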